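(* Let $k\ge 4$ be an integer and let $G$ be a connected graph on $n$ vertices with chromatic number $\chi(G)=k$. Then \[ P_G(k)\le k!\,(k-1)^{n-k}, \] with equality if and only if the $2$-core of $G$ is a $k$-clique.
   Context: All graphs are finite, simple and undirected. $P_G(k)$ denotes the number of proper $k$-colorings of $G$, i.e. functions $c:V(G)\to\{1,\dots,k\}$ with $c(u)\ne c(v)$ whenever $uv$ is an edge. The $2$-core of $G$ is the graph obtained by repeatedly deleting vertices of degree at most one until none remain. *)

theory Defs
  imports "Graph_Theory.Graph_Theory" "HOL-Library.FuncSet"
begin

text \<open>
  Finite simple undirected graphs are the symmetric digraphs of the locale \<^locale>\<open>graph\<close>:
  an edge is a pair of opposite arcs, and \<open>u \<rightarrow>\<^bsub>G\<^esub> v\<close> is adjacency.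
\<close>

definition proper_colorings :: "('a,'b) pre_digraph \<Rightarrow> nat \<Rightarrow> ('a \<Rightarrow> nat) set" where
  "proper_colorings G k =
     {c \<in> verts G \<rightarrow>\<^sub>E {1..k}. \<forall>u v. u \<rightarrow>\<^bsub>G\<^esub> v \<longrightarrow> c u \<noteq> c v}"

definition num_colorings :: "('a,'b) pre_digraph \<Rightarrow> nat \<Rightarrow> nat" where
  "num_colorings G k = card (proper_colorings G k)"

definition chromatic_number :: "('a,'b) pre_digraph \<Rightarrow> nat" where
  "chromatic_number G = (LEAST k. proper_colorings G k \<noteq> {})"

text \<open>
  In a symmetric digraph without parallel arcs the degree of a vertex in the
  undirected sense is its \<^const>\<open>out_degree\<close>.
\<close>

definition prune_step :: "('a,'b) pre_digraph \<Rightarrow> ('a,'b) pre_digraph \<Rightarrow> bool" where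
  "prune_step G H \<longleftrightarrow>
     (\<exists>v \<in> verts G. out_degree G v \<le> 1 \<and> H = pre_digraph.del_vert G v)"

definition is_two_core :: "('a,'b) pre_digraph \<Rightarrow> ('a,'b) pre_digraph \<Rightarrow> bool" where
  "is_two_core G H \<longleftrightarrow> prune_step\<^sup>*\<^sup>* G H \<and> \<not> (\<exists>H'. prune_step H H')"

definition two_core :: "('a,'b) pre_digraph \<Rightarrow> ('a,'b) pre_digraph" where
  "two_core G = (THE H. is_two_core G H)"

lemma chromatic_number_colorable:
  assumes "graph G"
  shows "proper_colorings G (chromatic_number G) \<noteq> {}"
proof -
  interpret graph G by fact
  obtain f :: "'a \<Rightarrow> nat" where f: "bij_betw f (verts G) {1..card (verts G)}"
    using finite_verts finite_same_card_bij[of "verts G" "{1..card (verts G)}"] by auto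
  have "u \<in> verts G \<and> v \<in> verts G \<and> u \<noteq> v" if "u \<rightarrow>\<^bsub>G\<^esub> v" for u v
    using that adj_in_verts adj_not_same by blast
  then have "restrict f (verts G) u \<noteq> restrict f (verts G) v" if "u \<rightarrow>\<^bsub>G\<^esub> v" for u v
    using that f unfolding bij_betw_def by (metis inj_on_contraD restrict_apply')
  moreover have "restrict f (verts G) \<in> verts G \<rightarrow>\<^sub>E {1..card (verts G)}"
    using bij_betw_imp_funcset[OF f] by (simp only: restrict_PiE_iff) blast
  ultimately have "restrict f (verts G) \<in> proper_colorings G (card (verts G))"
    unfolding proper_colorings_def by blast
  then have "proper_colorings G (card (verts G)) \<noteq> {}" by blast
  then show ?thesis unfolding chromatic_number_def by (rule LeastI)
qed

lemma (in wf_digraph) prune_induced: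
  assumes "prune_step\<^sup>*\<^sup>* G H"
  shows "verts H \<subseteq> verts G \<and> H = G \<restriction> verts H"
  using assms
proof (induction rule: rtranclp_induct)
  case base
  show ?case by (auto simp: induce_subgraph_def intro!: pre_digraph.equality)
next
  case (step H K)
  then obtain v where "K = pre_digraph.del_vert H v"
    unfolding prune_step_def by blast
  then have "K = pre_digraph.del_vert (G \<restriction> verts H) v"
    using step.IH by argo
  then have "K = G \<restriction> (verts H - {v})"
    by (auto simp: pre_digraph.del_vert_def induce_subgraph_def)
  moreover have "verts H - {v} \<subseteq> verts G" using step.IH by blast
  ultimately show ?case by simp
qed

lemma (in fin_digraph) two_core_verts_subset:
  assumes H: "is_two_core G H" and K: "prune_step\<^sup>*\<^sup>* G K"
  shows "verts H \<subseteq> verts K"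
  using K
proof (induction rule: rtranclp_induct)
  case base
  show ?case using H prune_induced unfolding is_two_core_def by blast
next
  case (step K L)
  then obtain v where v: "out_degree K v \<le> 1" "L = pre_digraph.del_vert K v"
    unfolding prune_step_def by blast
  have ind: "H = G \<restriction> verts H" "K = G \<restriction> verts K"
    using H step.hyps(1) prune_induced unfolding is_two_core_def by blast+
  have "out_arcs (G \<restriction> verts H) v \<subseteq> out_arcs (G \<restriction> verts K) v"
    using step.IH by auto
  moreover have "finite (out_arcs (G \<restriction> verts K) v)"
    by (rule finite_subset[OF _ finite_arcs]) auto
  ultimately have "out_degree (G \<restriction> verts H) v \<le> out_degree (G \<restriction> verts K) v"
    unfolding out_degree_def by (rule card_mono[rotated])
  then have "out_degree H v \<le> out_degree K v"
    using ind by argo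
  then have "v \<notin> verts H"
    using v(1) H unfolding is_two_core_def prune_step_def by (meson le_trans)
  then show ?case using step.IH v(2) by (auto simp: pre_digraph.del_vert_def)
qed

lemma (in fin_digraph) ex1_two_core: "\<exists>!H. is_two_core G H"
proof (rule ex_ex1I)
  define m where "m = (LEAST m. \<exists>H. prune_step\<^sup>*\<^sup>* G H \<and> card (verts H) = m)"
  have "\<exists>H. prune_step\<^sup>*\<^sup>* G H \<and> card (verts H) = m"
    unfolding m_def by (rule LeastI_ex) blast
  then obtain H where H: "prune_step\<^sup>*\<^sup>* G H" "card (verts H) = m" by blast
  have "\<not> prune_step H H'" for H'
  proof
    assume s: "prune_step H H'"
    have "finite (verts H)"
      using prune_induced[OF H(1)] finite_verts finite_subset by blast
    moreover obtain v where "v \<in> verts H" "verts H' = verts H - {v}"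
      using s unfolding prune_step_def by (auto simp: pre_digraph.del_vert_def)
    ultimately have "card (verts H') < m"
      using H(2) card_Diff1_less[of "verts H" v] by simp
    moreover have "m \<le> card (verts H')"
      unfolding m_def by (rule Least_le) (use H(1) s in \<open>auto intro: rtranclp.rtrancl_into_rtrancl\<close>)
    ultimately show False by simp
  qed
  with H(1) show "\<exists>H. is_two_core G H" unfolding is_two_core_def by blast
next
  fix H K assume HK: "is_two_core G H" "is_two_core G K"
  then have "verts H = verts K"
    using two_core_verts_subset unfolding is_two_core_def by (metis HK subset_antisym)
  with HK show "H = K"
    using prune_induced unfolding is_two_core_def by metis
qed

lemma (in fin_digraph) is_two_core_two_core: "is_two_core G (two_core G)"
  unfolding two_core_def by (rule theI'[OF ex1_two_core])

end

theory Submission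
  imports Defs "HOL-Combinatorics.Transposition"
begin

text \<open>
  Put \<open>q = k - 1\<close>. A connected graph that is not \<open>q\<close>-colorable contains a vertex-critical set \<open>H\<close>, and
  coloring the remaining vertices one by one, each adjacent to an earlier one, gives
  \<open>P(G) \<le> P(H) * q ^ (n - card H)\<close>. If \<open>H\<close> is a clique, then \<open>P(H) = fact k\<close>. Otherwise the bound for \<open>H\<close>
  is strict, by induction on \<open>k\<close> and on \<open>card H\<close>. If two vertices separate \<open>H\<close>, then merging or joining them
  reduces to smaller graphs. If not, fix a vertex \<open>v\<close> and let \<open>insert v I\<close> be its color class.
  What is left needs \<open>q\<close> colors, so it has a component to which the bound for \<open>q\<close> colors applies
  (for \<open>k = 4\<close>: a component \<open>D\<close> with fewer than \<open>2 ^ card D\<close> colorings with 3 colors), and its other components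
  have at most as many colorings as spanning trees of them. Summing over \<open>I\<close>, it remains to bound
  \<open>\<Phi>(v) = (\<Sum>I. r ^ card I * (1 - r) ^ rank (H - {v} - I))\<close> with \<open>r = 1 / q\<close> for a suitable \<open>v\<close>: by less than
  \<open>(1 - r) ^ (q - 1)\<close> if \<open>q \<ge> 4\<close>, and by \<open>1 / 3\<close> if \<open>q = 3\<close>, where \<open>v\<close> has degree at least four by Brooks' theorem.

  Equality forces \<open>H\<close> to be a clique and every added vertex to have exactly one earlier neighbor,
  so that pruning vertices of degree one leads back to \<open>H\<close>.
\<close>

section \<open>Components and rank\<close>

text \<open>The threshold \<open>x ^ (q - 1)\<close> is the value of \<open>\<Phi>\<close> in the
  extremal case: if \<open>H\<close> is a clique on \<open>q + 1\<close> vertices, only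
  \<open>I = {}\<close> occurs and the rest has rank \<open>q - 1\<close>. The starting point is the
  estimate of \<open>\<Phi>\<close> by a process that exposes vertices one at a time: a vertex is
  outside the color class (weight \<open>x\<close>) or inside it (weight \<open>r\<close>), and
  \<open>x + r = 1\<close>, so nothing is lost on average. The remaining work is to find a vertex
  \<open>v\<close> around which this process is strictly wasteful. The recursion on the number of
  colors cannot descend to three. An odd cycle of length \<open>n \<ge> 5\<close> has
  \<open>2 ^ n - 2\<close> colorings with three colors, more than \<open>6 * 2 ^ (n - 3)\<close>.
  For \<open>q = 3\<close> the only general substitute is fewer than \<open>2 ^ n\<close> colorings,
  weaker by a factor of 4/3, and this factor must be regained from \<open>\<Phi>\<close>: the target
  drops from \<open>(2/3) ^ 2 = 4/9\<close> to 1/3. Several of the estimates then meet 1/3 exactly,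
  which explains the case analysis for four colors.\<close>

locale ugraph =
  fixes E :: "'a \<Rightarrow> 'a \<Rightarrow> bool"
  assumes E_sym: "E u v \<Longrightarrow> E v u"
    and E_irr: "\<not> E u u"
begin

text \<open>\<open>cov S A\<close>: every component of the graph induced on \<open>S\<close> meets \<open>A\<close>.\<close>

definition cov :: "'a set \<Rightarrow> 'a set \<Rightarrow> bool" where
  "cov S A \<longleftrightarrow> A \<subseteq> S \<and> (\<forall>X. A \<subseteq> X \<longrightarrow> X \<subset> S \<longrightarrow> (\<exists>u\<in>X. \<exists>v\<in>S - X. E u v))"

definition conn :: "'a set \<Rightarrow> bool" where
  "conn S \<longleftrightarrow> (\<exists>a\<in>S. cov S {a})"

text \<open>For \<open>B\<close> contained in \<open>S\<close> this is the union of the components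
  of \<open>S\<close> that meet \<open>B\<close>. No paths are involved: covered sets are closed
  under unions, so there is a largest one.\<close>

definition rch :: "'a set \<Rightarrow> 'a set \<Rightarrow> 'a set" where
  "rch S B = \<Union>{X. X \<subseteq> S \<and> cov X B}"

definition Nb :: "'a set \<Rightarrow> 'a set \<Rightarrow> 'a set" where
  "Nb S K = {s \<in> S. \<exists>y\<in>K. E y s}"

lemma covI:
  assumes "A \<subseteq> S" "\<And>X. A \<subseteq> X \<Longrightarrow> X \<subset> S \<Longrightarrow> \<exists>u\<in>X. \<exists>v\<in>S - X. E u v"
  shows "cov S A"
  using assms unfolding cov_def by blast

lemma covD:
  assumes "cov S A" "A \<subseteq> X" "X \<subset> S"
  shows "\<exists>u v. u \<in> X \<and> v \<in> S \<and> v \<notin> X \<and> E u v"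
proof -
  have "\<exists>u\<in>X. \<exists>v\<in>S - X. E u v" using assms unfolding cov_def by simp
  then show ?thesis by blast
qed

lemma cov_subset: "cov S A \<Longrightarrow> A \<subseteq> S"
  unfolding cov_def by blast

lemma ex_max_on_Diff:
  fixes f :: "'b \<Rightarrow> nat"
  assumes "A - B \<noteq> {}" "finite A"
  shows "\<exists>a\<in>A - B. \<forall>b\<in>A - B. f b \<le> f a"
proof -
  have "finite (f ` (A - B))" "f ` (A - B) \<noteq> {}" using assms by auto
  then have "Max (f ` (A - B)) \<in> f ` (A - B)" by (rule Max_in)
  then obtain a where "a \<in> A - B" "f a = Max (f ` (A - B))" by auto
  then have "\<forall>b\<in>A - B. f b \<le> f a" using \<open>finite (f ` (A - B))\<close> by simp
  then show ?thesis using \<open>a \<in> A - B\<close> by blast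
qed

lemma cov_self: "cov S S"
  unfolding cov_def by blast

lemma cov_mono: assumes "cov S A" "A \<subseteq> B" "B \<subseteq> S" shows "cov S B"
proof (rule covI)
  fix X assume X: "B \<subseteq> X" "X \<subset> S"
  then have "A \<subseteq> X" using assms by simp
  then obtain u v where "u \<in> X" "v \<in> S" "v \<notin> X" "E u v" using covD[OF assms(1) _ X(2)] by blast
  then show "\<exists>u\<in>X. \<exists>v\<in>S - X. E u v" by blast
qed (use assms in simp)

lemma cov_trans: "cov S B \<Longrightarrow> cov B A \<Longrightarrow> cov S A"
proof (rule covI)
  assume SB: "cov S B" and BA: "cov B A"
  show "A \<subseteq> S" using SB BA cov_subset by blast
  fix X assume X: "A \<subseteq> X" "X \<subset> S"
  show "\<exists>u\<in>X. \<exists>v\<in>S - X. E u v"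
  proof (cases "B \<subseteq> X")
    case True then show ?thesis using covD[OF SB _ X(2)] by blast
  next
    case False
    then have "X \<inter> B \<subset> B" "A \<subseteq> X \<inter> B" using X BA cov_subset by auto
    then obtain u v where "u \<in> X \<inter> B" "v \<in> B" "v \<notin> X \<inter> B" "E u v" using covD[OF BA, of "X \<inter> B"] by blast
    then show ?thesis using cov_subset[OF SB] by blast
  qed
qed

lemma cov_Un: "cov X A \<Longrightarrow> cov Y B \<Longrightarrow> cov (X \<union> Y) (A \<union> B)"
proof (rule covI)
  assume XA: "cov X A" and YB: "cov Y B"
  show "A \<union> B \<subseteq> X \<union> Y" using XA YB cov_subset by blast
  fix Z assume Z: "A \<union> B \<subseteq> Z" "Z \<subset> X \<union> Y"
  then consider "\<not> X \<subseteq> Z" | "\<not> Y \<subseteq> Z" by blast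
  then show "\<exists>u\<in>Z. \<exists>v\<in>X \<union> Y - Z. E u v"
  proof cases
    case 1
    then have "A \<subseteq> Z \<inter> X" "Z \<inter> X \<subset> X" using Z XA cov_subset by auto
    then obtain u v where "u \<in> Z \<inter> X" "v \<in> X" "v \<notin> Z \<inter> X" "E u v" using covD[OF XA, of "Z \<inter> X"] by blast
    then show ?thesis by blast
  next
    case 2
    then have "B \<subseteq> Z \<inter> Y" "Z \<inter> Y \<subset> Y" using Z YB cov_subset by auto
    then obtain u v where "u \<in> Z \<inter> Y" "v \<in> Y" "v \<notin> Z \<inter> Y" "E u v" using covD[OF YB, of "Z \<inter> Y"] by blast
    then show ?thesis by blast
  qed
qed

lemma cov_insert_adj: "cov X A \<Longrightarrow> u \<in> X \<Longrightarrow> E u z \<Longrightarrow> cov (insert z X) A"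
proof -
  assume a: "cov X A" "u \<in> X" "E u z"
  have "cov (insert z X) X"
    by (rule covI) (use a in blast)+
  then show ?thesis using a(1) cov_trans by blast
qed

lemma cov_grow:
  assumes "cov S A" "A \<noteq> S"
  shows "\<exists>u w. u \<in> A \<and> w \<in> S \<and> w \<notin> A \<and> E u w"
proof -
  have "A \<subset> S" using assms cov_subset by blast
  then show ?thesis using covD[OF assms(1) order_refl] by blast
qed

text \<open>A component containing \<open>w\<close> falls into pieces that each contain a root or a
  neighbour of \<open>w\<close>; every other component keeps its root.\<close>

lemma cov_delete:
  assumes "cov S A" "w \<in> S" "w \<notin> A"
  shows "cov (S - {w}) (A \<union> Nb S {w})"
proof (rule covI)
  show "A \<union> Nb S {w} \<subseteq> S - {w}"
    using assms cov_subset E_irr unfolding Nb_def by blast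
  fix X assume X: "A \<union> Nb S {w} \<subseteq> X" "X \<subset> S - {w}"
  then have "A \<subseteq> insert w X" "insert w X \<subset> S" using assms by auto
  then obtain u v where uv: "u \<in> insert w X" "v \<in> S" "v \<notin> insert w X" "E u v"
    using covD[OF assms(1), of "insert w X"] by blast
  then have "u \<noteq> w" using X(1) unfolding Nb_def by blast
  then show "\<exists>u\<in>X. \<exists>v\<in>S - {w} - X. E u v" using uv by blast
qed

lemma conn_root: "cov S {a} \<Longrightarrow> conn S"
  unfolding conn_def using cov_subset by blast

lemma conn_cov:
  assumes "conn S" "A \<subseteq> S" "A \<noteq> {}"
  shows "cov S A"
proof -
  obtain b where b: "b \<in> S" "cov S {b}" using assms(1) unfolding conn_def by blast
  obtain a where a: "a \<in> A" using assms(3) by blast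
  show ?thesis
  proof (rule covI)
    fix X assume X: "A \<subseteq> X" "X \<subset> S"
    show "\<exists>u\<in>X. \<exists>v\<in>S - X. E u v"
    proof (cases "b \<in> X")
      case True then show ?thesis using covD[OF b(2) _ X(2)] by blast
    next
      case False
      then have "{b} \<subseteq> S - X" "S - X \<subset> S" using b X a by auto
      then obtain u v where "u \<in> S - X" "v \<in> S" "v \<notin> S - X" "E u v"
        using covD[OF b(2), of "S - X"] by blast
      then show ?thesis using E_sym by blast
    qed
  qed (use assms in auto)
qed

lemma conn_nonempty: "conn S \<Longrightarrow> S \<noteq> {}"
  unfolding conn_def by blast

lemma conn_edge:
  assumes "conn S" "X \<subset> S" "X \<noteq> {}"
  shows "\<exists>u v. u \<in> X \<and> v \<in> S \<and> v \<notin> X \<and> E u v"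
  by (rule covD[OF conn_cov[OF assms(1) _ assms(3)] order_refl assms(2)]) (use assms(2) in blast)

lemma connI:
  assumes "S \<noteq> {}" "\<And>X. X \<subset> S \<Longrightarrow> X \<noteq> {} \<Longrightarrow> \<exists>u\<in>X. \<exists>v\<in>S - X. E u v"
  shows "conn S"
proof -
  obtain a where "a \<in> S" using assms(1) by blast
  then have "cov S {a}" using assms(2) by (intro covI) auto
  then show ?thesis using conn_root by blast
qed

lemma conn_singleton: "conn {a}"
  by (rule connI) auto

lemma cov_conn: "cov S B \<Longrightarrow> conn B \<Longrightarrow> conn S"
  using cov_trans[of S B] conn_root[of S] unfolding conn_def[of B] by blast

lemma conn_insert: "conn S \<Longrightarrow> u \<in> S \<Longrightarrow> E u z \<Longrightarrow> conn (insert z S)"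
  using cov_insert_adj[OF cov_self, of u S z] cov_conn by blast

lemma cov_rch: assumes "B \<subseteq> S" shows "cov (rch S B) B"
proof (rule covI)
  have "cov B B" by (rule cov_self)
  then show "B \<subseteq> rch S B" unfolding rch_def using assms by blast
  fix X assume X: "B \<subseteq> X" "X \<subset> rch S B"
  then obtain Y where Y: "Y \<subseteq> S" "cov Y B" "\<not> Y \<subseteq> X" unfolding rch_def by blast
  then have "B \<subseteq> X \<inter> Y" "X \<inter> Y \<subset> Y" using X cov_subset by auto
  then obtain u v where "u \<in> X \<inter> Y" "v \<in> Y" "v \<notin> X \<inter> Y" "E u v" using covD[OF Y(2), of "X \<inter> Y"] by blast
  moreover have "Y \<subseteq> rch S B" unfolding rch_def using Y by blast
  ultimately show "\<exists>u\<in>X. \<exists>v\<in>rch S B - X. E u v" by blast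
qed

lemma rch_subset: "rch S B \<subseteq> S"
  unfolding rch_def by blast

lemma rch_base: "B \<subseteq> S \<Longrightarrow> B \<subseteq> rch S B"
  using cov_rch cov_subset by blast

lemma rch_max: "X \<subseteq> S \<Longrightarrow> cov X B \<Longrightarrow> X \<subseteq> rch S B"
  unfolding rch_def by blast

lemma rch_closed: "B \<subseteq> S \<Longrightarrow> u \<in> rch S B \<Longrightarrow> v \<in> S \<Longrightarrow> E u v \<Longrightarrow> v \<in> rch S B"
  using cov_insert_adj[OF cov_rch, of B S u v] rch_max[of "insert v (rch S B)" S B] rch_subset by blast

lemma conn_rch: "b \<in> S \<Longrightarrow> conn (rch S {b})"
  using cov_rch conn_root by blast

lemma finite_rch: "finite S \<Longrightarrow> finite (rch S B)"
  using rch_subset finite_subset by blast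

text \<open>A minimal \<open>A\<close> with \<open>cov S A\<close> has one vertex in each component, so \<open>cc\<close> counts components and
  \<open>rank\<close> is the number of edges of a spanning forest.\<close>

definition cc :: "'a set \<Rightarrow> nat" where
  "cc S = (LEAST m. \<exists>A. cov S A \<and> card A = m)"

definition rank :: "'a set \<Rightarrow> nat" where
  "rank S = card S - cc S"

lemma cc_witness: obtains A where "cov S A" "card A = cc S"
proof -
  have "\<exists>A. cov S A \<and> card A = cc S"
    unfolding cc_def by (rule LeastI_ex) (use cov_self in blast)
  then show ?thesis using that by blast
qed

lemma cc_le: "cov S A \<Longrightarrow> cc S \<le> card A"
  unfolding cc_def by (rule Least_le) blast

lemma cc_le_card: "cc S \<le> card S"
  using cc_le cov_self by blast

lemma rank_insert_adj:
  assumes "finite S" "z \<notin> S" "u \<in> S" "E u z"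
  shows "Suc (rank S) \<le> rank (insert z S)"
proof -
  obtain A where A: "cov S A" "card A = cc S" by (rule cc_witness)
  have "cc (insert z S) \<le> cc S" using cc_le[OF cov_insert_adj[OF A(1) assms(3,4)]] A(2) by simp
  then show ?thesis unfolding rank_def using assms cc_le_card[of S] by simp
qed

text \<open>A connected block brings at most one new component, and none if it has a neighbour in
  \<open>S\<close>. The difference of one between the two bounds is what \<open>Ph_absorb\<close>
  has to account for.\<close>

lemma rank_Un_conn:
  assumes "finite S" "finite K" "S \<inter> K = {}" "conn K"
  shows "rank S + card K - 1 \<le> rank (S \<union> K)"
    and "Nb S K \<noteq> {} \<Longrightarrow> rank S + card K \<le> rank (S \<union> K)"
proof -
  obtain A where A: "cov S A" "card A = cc S" by (rule cc_witness)
  obtain k where k: "k \<in> K" "cov K {k}" using assms(4) unfolding conn_def by blast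
  have "cov (S \<union> K) (A \<union> {k})" using cov_Un[OF A(1) k(2)] .
  then have "cc (S \<union> K) \<le> card (A \<union> {k})" by (rule cc_le)
  also have "\<dots> \<le> cc S + 1" using A(2) card_Un_le[of A "{k}"] by simp
  finally have 1: "cc (S \<union> K) \<le> cc S + 1" .
  have cd: "card (S \<union> K) = card S + card K" using assms card_Un_disjoint by blast
  show "rank S + card K - 1 \<le> rank (S \<union> K)"
    unfolding rank_def cd using 1 cc_le_card[of S] by linarith
  assume "Nb S K \<noteq> {}"
  then obtain s y where sy: "s \<in> S" "y \<in> K" "E y s" unfolding Nb_def by blast
  have "cov K {y}" using conn_cov[OF assms(4), of "{y}"] sy by blast
  moreover have "cov (insert y S) S" using cov_insert_adj[OF cov_self sy(1) E_sym[OF sy(3)]] .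
  ultimately have "cov (insert y S \<union> K) (S \<union> {y})" using cov_Un by blast
  then have "cov (S \<union> K) (insert y S)" using sy by (simp add: insert_absorb)
  then have "cov (S \<union> K) A"
    using cov_trans \<open>cov (insert y S) S\<close> A(1) by blast
  then have "cc (S \<union> K) \<le> cc S" using cc_le A(2) by metis
  then show "rank S + card K \<le> rank (S \<union> K)"
    unfolding rank_def cd using cc_le_card[of S] by linarith
qed

lemma rank_mono: assumes "finite B" "A \<subseteq> B" shows "rank A \<le> rank B"
proof -
  have "rank A \<le> rank (A \<union> C)" if "finite C" "A \<inter> C = {}" "finite A" for C
    using that
  proof (induction C rule: finite_induct)
    case (insert z C)
    have "rank (A \<union> C) + card {z} - 1 \<le> rank (A \<union> C \<union> {z})"
      by (rule rank_Un_conn(1)) (use insert conn_singleton in auto)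
    then show ?case using insert by simp
  qed simp
  from this[of "B - A"] show ?thesis using assms finite_subset[OF assms(2,1)]
    by (simp add: Un_absorb1)
qed

lemma rank_conn: assumes "conn S" shows "card S - 1 \<le> rank S"
proof -
  obtain a where "cov S {a}" using assms unfolding conn_def by blast
  then have "cc S \<le> 1" using cc_le[of S "{a}"] by simp
  then show ?thesis unfolding rank_def by simp
qed

definition indep :: "'a set \<Rightarrow> bool" where
  "indep I \<longleftrightarrow> (\<forall>u\<in>I. \<forall>v\<in>I. \<not> E u v)"

end

section \<open>Weighted sums over color classes\<close>

locale qgraph = ugraph E for E :: "'a \<Rightarrow> 'a \<Rightarrow> bool" +
  fixes q :: nat
  assumes q2: "2 \<le> q"
begin

definition r :: real where "r = 1 / real q"
definition x :: real where "x = 1 - r"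

lemma r_pos: "0 < r" and r_le: "r \<le> 1/2" and xr: "x + r = 1" and x_pos: "0 < x" and x_less: "x < 1"
  and x_def': "x = (real q - 1) / real q"
proof -
  show "0 < r" "r \<le> 1/2" using q2 unfolding r_def by (auto simp: field_simps)
  then show "x + r = 1" "0 < x" "x < 1" "x = (real q - 1) / real q"
    using q2 unfolding x_def by (auto simp: r_def field_simps)
qed

lemma x_pow_pos: "0 < x ^ n" and r_pow_pos: "0 < r ^ n" and x_pow_le1: "x ^ n \<le> 1"
  using x_pos r_pos x_less by (auto intro: power_le_one)

lemma x_pow_anti: "m \<le> n \<Longrightarrow> x ^ n \<le> x ^ m"
  using x_pos x_less by (intro power_decreasing) auto

lemma r_pow_anti: "m \<le> n \<Longrightarrow> r ^ n \<le> r ^ m"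
  using r_pos r_le by (intro power_decreasing) auto

text \<open>\<open>q ^ card S * om S\<close> is the number of colorings with \<open>q\<close> colors
  of a spanning forest of the graph on \<open>S\<close>.\<close>

definition om :: "'a set \<Rightarrow> real" where "om S = x ^ rank S"

text \<open>For \<open>S = V - {v}\<close> and \<open>A = Nb V {v}\<close>, the sets \<open>I\<close> below are those for which \<open>insert v I\<close> can be
  the color class of \<open>v\<close>, and \<open>q ^ card (S - I) * om (S - I)\<close> bounds the number of colorings of the rest
  with \<open>q\<close> colors. Only \<open>W = {}\<close> has this meaning; other \<open>W\<close> occur when a vertex is moved out of \<open>S\<close>.\<close>

definition Ph :: "'a set \<Rightarrow> 'a set \<Rightarrow> 'a set \<Rightarrow> real" where
  "Ph S A W = (\<Sum>I | I \<subseteq> S - A \<and> indep I \<and> W \<subseteq> I. r ^ card I * om (S - I))"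

lemma om_pos: "0 < om S" and om_le1: "om S \<le> 1"
  unfolding om_def using x_pow_pos x_pow_le1 by auto

lemma om_mono: "finite B \<Longrightarrow> A \<subseteq> B \<Longrightarrow> om B \<le> om A"
  unfolding om_def by (rule x_pow_anti) (rule rank_mono)

lemma om_insert_adj: "finite S \<Longrightarrow> z \<notin> S \<Longrightarrow> u \<in> S \<Longrightarrow> E u z \<Longrightarrow> om (insert z S) \<le> x * om S"
  unfolding om_def using x_pow_anti[OF rank_insert_adj] by simp

lemma om_conn: "conn S \<Longrightarrow> om S \<le> x ^ (card S - 1)"
  unfolding om_def by (rule x_pow_anti) (rule rank_conn)

section \<open>Exposing, absorbing and removing vertices in weighted sums\<close>

lemma fin_ind: "finite S \<Longrightarrow> finite {I. I \<subseteq> S - A \<and> P I}"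
  by (rule finite_subset[of _ "Pow S"]) auto

lemma Ph_zero: "\<not> W \<subseteq> S - A \<Longrightarrow> Ph S A W = 0"
  unfolding Ph_def by (rule sum.neutral) auto

text \<open>Removing \<open>w\<close> from both \<open>S\<close> and \<open>I\<close> does not
  change \<open>S - I\<close>. Independence keeps the neighbours of \<open>w\<close> out of
  \<open>I\<close>, so they may be added to \<open>A\<close>, where \<open>cov_delete\<close> wants
  them as roots.\<close>

lemma Ph_closed:
  assumes "finite S" "w \<in> S" "w \<notin> A"
  shows "(\<Sum>I | I \<subseteq> S - A \<and> indep I \<and> insert w W \<subseteq> I. r ^ card I * om (S - I))
    = r * Ph (S - {w}) (A \<union> Nb S {w}) (W - {w})"
proof -
  let ?L = "{I. I \<subseteq> S - A \<and> indep I \<and> insert w W \<subseteq> I}"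
  let ?R = "{I. I \<subseteq> S - {w} - (A \<union> Nb S {w}) \<and> indep I \<and> W - {w} \<subseteq> I}"
  have "(\<Sum>I\<in>?L. r ^ card I * om (S - I)) = (\<Sum>J\<in>?R. r * (r ^ card J * om (S - {w} - J)))"
  proof (rule sum.reindex_bij_witness[of _ "insert w" "\<lambda>I. I - {w}"])
    fix I assume I: "I \<in> ?L"
    then have fI: "finite I" "w \<in> I" using assms finite_subset[of I S] by auto
    show "insert w (I - {w}) = I" using I by blast
    show "I - {w} \<in> ?R" using I unfolding indep_def Nb_def by blast
    have "card I = Suc (card (I - {w}))" using fI card_Suc_Diff1 by metis
    moreover have "S - {w} - (I - {w}) = S - I" using fI by blast
    ultimately show "r * (r ^ card (I - {w}) * om (S - {w} - (I - {w}))) = r ^ card I * om (S - I)"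
      by simp
  next
    fix J assume J: "J \<in> ?R"
    then show "insert w J - {w} = J" by blast
    have "\<not> E w u" "\<not> E u w" if "u \<in> J" for u
      using J that E_sym unfolding Nb_def by blast+
    then show "insert w J \<in> ?L" using J assms E_irr unfolding indep_def by blast
  qed
  then show ?thesis unfolding Ph_def sum_distrib_left .
qed

lemma Ph_branch:
  assumes "finite S" "w \<in> S" "w \<notin> A"
  shows "Ph S A {} = Ph S (insert w A) {} + r * Ph (S - {w}) (A \<union> Nb S {w}) {}"
proof -
  let ?f = "\<lambda>I. r ^ card I * om (S - I)"
  have eq: "{I. I \<subseteq> S - A \<and> indep I \<and> {} \<subseteq> I} =
      {I. I \<subseteq> S - insert w A \<and> indep I \<and> {} \<subseteq> I} \<union> {I. I \<subseteq> S - A \<and> indep I \<and> insert w {} \<subseteq> I}"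
    by blast
  have "Ph S A {} = Ph S (insert w A) {} + sum ?f {I. I \<subseteq> S - A \<and> indep I \<and> insert w {} \<subseteq> I}"
    unfolding Ph_def eq by (rule sum.union_disjoint) (auto intro!: fin_ind assms)
  then show ?thesis using Ph_closed[OF assms, of "{}"] by simp
qed

lemma Ph_self: "finite S \<Longrightarrow> Ph S S {} = om S"
proof -
  have "{I. I \<subseteq> S - S \<and> indep I \<and> {} \<subseteq> I} = {{}}" unfolding indep_def by auto
  then show ?thesis unfolding Ph_def by simp
qed

text \<open>Expose a vertex \<open>w\<close> next to \<open>A\<close>. Outside \<open>I\<close> it
  joins \<open>A\<close> and raises the rank, a factor \<open>x\<close>; inside \<open>I\<close> it
  costs \<open>r\<close>, and its neighbours become roots. The two factors add up to one. The second
  branch is wasteful, since \<open>om (A \<union> Nb S {w})\<close> is estimated by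
  \<open>om A\<close>; \<open>Ph_gain\<close> and \<open>Ph_cycle\<close> recover part of
  this.\<close>

lemma Ph_le_om0:
  assumes "finite S" "cov S A" shows "Ph S A {} \<le> om A"
  using assms
proof (induction "card (S - A)" arbitrary: S A rule: less_induct)
  case less
  show ?case
  proof (cases "A = S")
    case True then show ?thesis using Ph_self less by simp
  next
    case False
    then obtain u w where uw: "u \<in> A" "w \<in> S" "w \<notin> A" "E u w" using cov_grow[OF less(3)] by blast
    have AS: "A \<subseteq> S" using less cov_subset by blast
    have fA: "finite A" using AS less finite_subset by blast
    have "card (S - insert w A) < card (S - A)" by (rule psubset_card_mono) (use uw less(2) in auto)
    moreover have "cov S (insert w A)" by (rule cov_mono[OF less(3)]) (use uw AS in auto)
    ultimately have "Ph S (insert w A) {} \<le> om (insert w A)" using less(1)[OF _ less(2)] by blast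
    also have "\<dots> \<le> x * om A" using om_insert_adj[OF fA uw(3,1,4)] .
    finally have 1: "Ph S (insert w A) {} \<le> x * om A" .
    have "card (S - {w} - (A \<union> Nb S {w})) < card (S - A)" by (rule psubset_card_mono) (use uw less(2) in auto)
    then have "Ph (S - {w}) (A \<union> Nb S {w}) {} \<le> om (A \<union> Nb S {w})"
      using less(1)[OF _ _ cov_delete[OF less(3) uw(2,3)]] less(2) by blast
    also have "\<dots> \<le> om A" by (rule om_mono) (use fA less in \<open>auto simp: Nb_def\<close>)
    finally have "r * Ph (S - {w}) (A \<union> Nb S {w}) {} \<le> r * om A" using r_pos by simp
    then have "Ph S A {} \<le> (x + r) * om A"
      using 1 Ph_branch[OF less(2) uw(2,3)] by (simp add: distrib_right)
    then show ?thesis using xr by simp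
  qed
qed

lemma Ph_le_om:
  assumes "finite W" "finite S" "cov S A" shows "Ph S A W \<le> r ^ card W * om A"
  using assms
proof (induction "card W" arbitrary: W S A)
  case 0 then show ?case using Ph_le_om0 by simp
next
  case (Suc m)
  then obtain w W' where w: "W = insert w W'" "w \<notin> W'" "card W' = m" "finite W'"
    by (metis card_Suc_eq finite_insert)
  show ?case
  proof (cases "w \<in> S \<and> w \<notin> A")
    case False
    then have "Ph S A W = 0" using w by (intro Ph_zero) auto
    then show ?thesis using r_pow_pos om_pos by (simp add: less_imp_le)
  next
    case True
    have fA: "finite A" using Suc cov_subset finite_subset by metis
    have "Ph S A W = r * Ph (S - {w}) (A \<union> Nb S {w}) W'"
      using Ph_closed[OF Suc(4), of w A W'] True w unfolding Ph_def by simp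
    also have "Ph (S - {w}) (A \<union> Nb S {w}) W' \<le> r ^ card W' * om (A \<union> Nb S {w})"
      using Suc(1)[of W' "S - {w}"] w Suc(4) cov_delete[OF Suc(5)] True by simp
    also have "\<dots> \<le> r ^ card W' * om A"
      by (intro mult_left_mono om_mono) (use fA Suc in \<open>auto simp: Nb_def less_imp_le[OF r_pow_pos]\<close>)
    finally show ?thesis using w r_pos by simp
  qed
qed

text \<open>Since \<open>K\<close> joins \<open>A\<close>, the sets \<open>I\<close> stay the same.
  The block raises the rank by \<open>card K\<close>, unless all its neighbours in \<open>S\<close>
  lie in \<open>I\<close>, when it may be one less. As
  \<open>x ^ (card K - 1) = x ^ card K + x ^ (card K - 1) * r\<close>, these exceptional
  \<open>I\<close> contribute a second sum in which \<open>Nb S K\<close> is forced into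
  \<open>I\<close>. This is what the parameter \<open>W\<close> is for.\<close>

lemma Ph_absorb:
  assumes "finite S" "finite K" "S \<inter> K = {}" "conn K" "A \<subseteq> S"
  shows "Ph (S \<union> K) (A \<union> K) W \<le> x ^ card K * Ph S A W + x ^ (card K - 1) * r * Ph S A (W \<union> Nb S K)"
proof -
  have c0: "card K \<noteq> 0" using assms conn_nonempty by auto
  have eq: "S \<union> K - (A \<union> K) = S - A" using assms by blast
  let ?F = "{I. I \<subseteq> S - A \<and> indep I \<and> W \<subseteq> I}"
  let ?G = "{I. I \<subseteq> S - A \<and> indep I \<and> W \<union> Nb S K \<subseteq> I}"
  let ?w = "\<lambda>I. r ^ card I * om (S - I)"
  have fF: "finite ?F" by (rule fin_ind) (rule assms)
  have "r ^ card I * om (S \<union> K - I) \<le> x ^ card K * ?w I + x ^ (card K - 1) * r * (if Nb S K \<subseteq> I then ?w I else 0)"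
    if I: "I \<in> ?F" for I
  proof -
    have e: "S \<union> K - I = (S - I) \<union> K" using I assms by blast
    have fS: "finite (S - I)" "(S - I) \<inter> K = {}" using assms by auto
    have xx: "x ^ (card K - 1) = x ^ card K + x ^ (card K - 1) * r"
    proof -
      obtain m where m: "card K = Suc m" using c0 by (cases "card K") auto
      have "x ^ m = x ^ m * (x + r)" using xr by simp
      then show ?thesis unfolding m by (simp add: algebra_simps)
    qed
    have "om (S \<union> K - I) \<le> x ^ card K * om (S - I) + x ^ (card K - 1) * r * (if Nb S K \<subseteq> I then om (S - I) else 0)"
    proof (cases "Nb S K \<subseteq> I")
      case True
      have "om (S - I \<union> K) \<le> x ^ (rank (S - I) + (card K - 1))"
        unfolding om_def using rank_Un_conn(1)[OF fS(1) assms(2) fS(2) assms(4)] c0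
        by (intro x_pow_anti) auto
      also have "\<dots> = x ^ (card K - 1) * om (S - I)" unfolding om_def by (simp add: power_add)
      also have "\<dots> = (x ^ card K + x ^ (card K - 1) * r) * om (S - I)"
        by (rule arg_cong[where f = "\<lambda>t. t * om (S - I)"]) (rule xx)
      finally show ?thesis unfolding e if_P[OF True] by (simp only: distrib_right)
    next
      case False
      then have "Nb (S - I) K \<noteq> {}" unfolding Nb_def by blast
      then have "om (S - I \<union> K) \<le> x ^ (rank (S - I) + card K)"
        unfolding om_def using rank_Un_conn(2)[OF fS(1) assms(2) fS(2) assms(4)]
        by (intro x_pow_anti) auto
      then show ?thesis using False e unfolding om_def by (simp add: power_add mult.commute)
    qed
    then have "r ^ card I * om (S \<union> K - I) \<le> r ^ card I * (x ^ card K * om (S - I) + x ^ (card K - 1) * r * (if Nb S K \<subseteq> I then om (S - I) else 0))"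
      using r_pow_pos by (simp add: less_imp_le mult_left_mono)
    also have "\<dots> = x ^ card K * ?w I + x ^ (card K - 1) * r * (if Nb S K \<subseteq> I then ?w I else 0)"
      by (simp add: algebra_simps)
    finally show ?thesis .
  qed
  then have "Ph (S \<union> K) (A \<union> K) W \<le>
     (\<Sum>I\<in>?F. x ^ card K * ?w I + x ^ (card K - 1) * r * (if Nb S K \<subseteq> I then ?w I else 0))"
    unfolding Ph_def eq by (intro sum_mono) blast
  also have "\<dots> = x ^ card K * Ph S A W + x ^ (card K - 1) * r * (\<Sum>I\<in>?F. if Nb S K \<subseteq> I then ?w I else 0)"
    unfolding Ph_def by (simp add: sum.distrib sum_distrib_left)
  also have "(\<Sum>I\<in>?F. if Nb S K \<subseteq> I then ?w I else 0) = sum ?w {I \<in> ?F. Nb S K \<subseteq> I}"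
    by (rule sum.inter_filter[OF fF, symmetric])
  also have "{I \<in> ?F. Nb S K \<subseteq> I} = ?G" by blast
  finally show ?thesis unfolding Ph_def .
qed

lemma Ph_absorb1:
  assumes "finite S" "z \<notin> S" "A \<subseteq> S"
  shows "Ph (insert z S) (insert z A) W \<le> x * Ph S A W + r * Ph S A (W \<union> Nb S {z})"
  using Ph_absorb[of S "{z}" A W] assms conn_singleton by simp

text \<open>Pair \<open>I\<close> with \<open>insert z I\<close>. If \<open>I\<close> contains no
  neighbour of \<open>z\<close>, the pair has the factors \<open>x\<close> and \<open>r\<close>,
  with sum one; otherwise only \<open>I\<close> itself occurs, and \<open>om\<close> is antitone.
  Thus \<open>S\<close> may be cut down to any part that still covers it.\<close>

lemma Ph_remove1:
  assumes "finite X" "z \<notin> X" "A \<subseteq> X" "u \<in> X" "E u z"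
  shows "Ph (insert z X) A {} \<le> Ph X A {}"
proof -
  have zA: "z \<notin> A" using assms by blast
  let ?F = "{I. I \<subseteq> X - A \<and> indep I}"
  let ?F' = "{I. I \<subseteq> X - A \<and> indep I \<and> Nb X {z} \<inter> I = {}}"
  let ?w = "\<lambda>I. r ^ card I * om (X - I)"
  have fF: "finite ?F" by (rule fin_ind) (rule assms)
  have "Ph (insert z X) A {} = Ph (insert z X) (insert z A) {} + r * Ph (insert z X - {z}) (A \<union> Nb (insert z X) {z}) {}"
    by (rule Ph_branch) (use assms zA in auto)
  also have "Ph (insert z X) (insert z A) {} = (\<Sum>I\<in>?F. r ^ card I * om (insert z X - I))"
    unfolding Ph_def using assms by (intro sum.cong) auto
  also have "insert z X - {z} = X" using assms by blast
  also have "Ph X (A \<union> Nb (insert z X) {z}) {} = sum ?w ?F'"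
    unfolding Ph_def using assms E_irr by (intro sum.cong) (auto simp: Nb_def)
  also have "?F' = {I \<in> ?F. Nb X {z} \<inter> I = {}}" by blast
  also have "sum ?w {I \<in> ?F. Nb X {z} \<inter> I = {}} = (\<Sum>I\<in>?F. if Nb X {z} \<inter> I = {} then ?w I else 0)"
    by (rule sum.inter_filter[OF fF])
  finally have "Ph (insert z X) A {} =
     (\<Sum>I\<in>?F. r ^ card I * om (insert z X - I) + r * (if Nb X {z} \<inter> I = {} then ?w I else 0))"
    by (simp add: sum.distrib sum_distrib_left)
  also have "\<dots> \<le> sum ?w ?F"
  proof (rule sum_mono)
    fix I assume I: "I \<in> ?F"
    have e: "insert z X - I = insert z (X - I)" using I assms by blast
    show "r ^ card I * om (insert z X - I) + r * (if Nb X {z} \<inter> I = {} then ?w I else 0) \<le> ?w I"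
    proof (cases "Nb X {z} \<inter> I = {}")
      case True
      then have "u \<in> X - I" using assms E_sym unfolding Nb_def by blast
      then have "om (insert z X - I) \<le> x * om (X - I)"
        unfolding e using om_insert_adj[of "X - I" z u] assms by simp
      then have "r ^ card I * om (insert z X - I) \<le> r ^ card I * (x * om (X - I))"
        using r_pow_pos by (simp add: less_imp_le mult_left_mono)
      then have "r ^ card I * om (insert z X - I) + r * ?w I \<le> (x + r) * ?w I"
        by (simp add: algebra_simps)
      then show ?thesis using True xr by simp
    next
      case False
      have "om (insert z X - I) \<le> om (X - I)" unfolding e by (rule om_mono) (use assms in auto)
      then show ?thesis using False r_pow_pos by (simp add: less_imp_le mult_left_mono)
    qed
  qed
  finally show ?thesis unfolding Ph_def by simp
qed

lemma Ph_remove: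
  assumes "finite S" "cov S X" "A \<subseteq> X"
  shows "Ph S A {} \<le> Ph X A {}"
  using assms
proof (induction "card (S - X)" arbitrary: X rule: less_induct)
  case less
  show ?case
  proof (cases "X = S")
    case False
    then obtain u z where uz: "u \<in> X" "z \<in> S" "z \<notin> X" "E u z" using cov_grow[OF less(3)] by blast
    have XS: "X \<subseteq> S" using less(3) cov_subset by blast
    have "card (S - insert z X) < card (S - X)" by (rule psubset_card_mono) (use uz less(2) in auto)
    moreover have "cov S (insert z X)" by (rule cov_mono[OF less(3)]) (use uz XS in auto)
    moreover have "A \<subseteq> insert z X" using less(4) by blast
    ultimately have "Ph S A {} \<le> Ph (insert z X) A {}" using less(1)[OF _ less(2)] by blast
    also have "\<dots> \<le> Ph X A {}"
      by (rule Ph_remove1[OF _ uz(3) less(4) uz(1,4)]) (use XS less(2) finite_subset in blast)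
    finally show ?thesis .
  qed simp
qed

text \<open>The roots outside \<open>B\<close> are absorbed singly. The bound is the solution of the
  recursion \<open>t \<mapsto> x * t + r * r\<close> with start value 1: the second term comes from
  a root with at least one neighbour forced into \<open>I\<close>, and \<open>r\<close> is the fixed
  point.\<close>

lemma Ph_conn_bound:
  assumes "finite S" "conn S" "conn B" "B \<subseteq> A" "A \<subseteq> S"
  shows "Ph S A {} \<le> x ^ (card B - 1) * (x ^ Suc (card (A - B)) + r)"
  using assms
proof (induction "card (A - B)" arbitrary: S A)
  case 0
  then have fA: "finite A" "A = B" using finite_subset[of A S] by auto
  have "A \<noteq> {}" using conn_nonempty[OF 0(4)] fA by simp
  then have "Ph S A {} \<le> om A" by (rule Ph_le_om0[OF 0(2) conn_cov[OF 0(3) 0(6)]])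
  also have "\<dots> \<le> x ^ (card B - 1)" using om_conn 0 fA by simp
  finally show ?case using 0 xr by simp
next
  case (Suc m)
  have fA: "finite A" using Suc finite_subset by blast
  define f where "f a = card (rch (S - {a}) B)" for a
  have ne: "A - B \<noteq> {}" using Suc by auto
  obtain a where a: "a \<in> A - B" "\<And>b. b \<in> A - B \<Longrightarrow> f b \<le> f a"
    using that ex_max_on_Diff[of A B f] ne fA by blast
  define X where "X = rch (S - {a}) B"
  have BS: "B \<subseteq> S - {a}" using Suc a by blast
  have X: "B \<subseteq> X" "X \<subseteq> S - {a}" "cov X B" "finite X"
    unfolding X_def using rch_base[OF BS] rch_subset cov_rch[OF BS] finite_rch Suc by auto
  have cX: "conn X" by (rule cov_conn[OF X(3) Suc(5)])
  have Bne: "B \<noteq> {}" by (rule conn_nonempty[OF Suc(5)])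
  have "X \<subset> S" "X \<noteq> {}" using X a Suc(7) Bne by auto
  then obtain u v where uv: "u \<in> X" "v \<in> S" "v \<notin> X" "E u v" using conn_edge[OF Suc(4), of X] by blast
  then have va: "v = a" using rch_closed[OF BS, of u v] unfolding X_def by blast
  have AX: "A - {a} \<subseteq> X"
  proof
    fix b assume b: "b \<in> A - {a}"
    show "b \<in> X"
    proof (rule ccontr)
      assume bX: "b \<notin> X"
      then have "b \<in> A - B" using b X by blast
      have "cov (insert a X) B" using cov_insert_adj[OF X(3) uv(1)] uv va by simp
      moreover have "insert a X \<subseteq> S - {b}" using X b bX a Suc by auto
      ultimately have "insert a X \<subseteq> rch (S - {b}) B" by (rule rch_max[rotated])
      then have "card (insert a X) \<le> f b" unfolding f_def using Suc by (intro card_mono finite_rch) auto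
      moreover have "a \<notin> X" using X(2) by blast
      ultimately show False using a(2)[OF \<open>b \<in> A - B\<close>] X(4) unfolding f_def X_def[symmetric] by simp
    qed
  qed
  have "Ph S A {} \<le> Ph (insert a X) A {}"
  proof (rule Ph_remove[OF Suc(3)])
    show "cov S (insert a X)" by (rule conn_cov[OF Suc(4)]) (use X a Suc(7) in auto)
  qed (use AX in auto)
  also have "\<dots> = Ph (insert a X) (insert a (A - {a})) {}" using a by (simp add: insert_absorb)
  also have "\<dots> \<le> x * Ph X (A - {a}) {} + r * Ph X (A - {a}) ({} \<union> Nb X {a})"
    by (rule Ph_absorb1) (use X AX in auto)
  finally have 1: "Ph S A {} \<le> x * Ph X (A - {a}) {} + r * Ph X (A - {a}) (Nb X {a})" by simp
  have BA: "B \<subseteq> A - {a}" using a Suc by blast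
  have "A - {a} - B = (A - B) - {a}" by blast
  then have m: "card (A - {a} - B) = m" using Suc(2) a by simp
  have IH: "Ph X (A - {a}) {} \<le> x ^ (card B - 1) * (x ^ Suc m + r)"
    using Suc(1)[OF m[symmetric] X(4) cX Suc(5) BA AX] m by simp
  have "u \<in> Nb X {a}" using uv va E_sym unfolding Nb_def by auto
  then have c1: "1 \<le> card (Nb X {a})" using X(4) unfolding Nb_def by (simp add: Suc_le_eq card_gt_0_iff) blast
  have "Ph X (A - {a}) (Nb X {a}) \<le> r ^ card (Nb X {a}) * om (A - {a})"
  proof (rule Ph_le_om)
    show "cov X (A - {a})" by (rule conn_cov[OF cX AX]) (use BA Bne in blast)
  qed (use X in \<open>auto simp: Nb_def\<close>)
  also have "\<dots> \<le> r ^ 1 * x ^ (card B - 1)"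
  proof (rule mult_mono)
    have "om (A - {a}) \<le> om B" using om_mono fA BA by simp
    then show "om (A - {a}) \<le> x ^ (card B - 1)" using om_conn[OF Suc(5)] by linarith
  qed (use r_pow_anti[OF c1] r_pos om_pos in \<open>auto intro: less_imp_le\<close>)
  finally have "r * Ph X (A - {a}) (Nb X {a}) \<le> r * (r * x ^ (card B - 1))" using r_pos by simp
  then have "Ph S A {} \<le> x * (x ^ (card B - 1) * (x ^ Suc m + r)) + r * (r * x ^ (card B - 1))"
    using 1 mult_left_mono[OF IH less_imp_le[OF x_pos]] by linarith
  also have "\<dots> = x ^ (card B - 1) * (x ^ Suc (Suc m) + r * (x + r))" by (simp add: algebra_simps)
  finally show ?case using xr Suc(2) by simp
qed

text \<open>\<open>Z\<close> links the root \<open>y\<close> to another root, so \<open>y\<close>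
  has a neighbour in the part \<open>X\<close> covered by the remaining roots. When \<open>y\<close>
  is absorbed, the second sum forces that neighbour into \<open>I\<close> and yields another
  \<open>r\<close>.\<close>

lemma Ph_pendant:
  assumes "finite S" "cov S A" "y \<in> A" "conn Z" "Z \<subseteq> S" "y \<in> Z" "Z \<inter> (A - {y}) \<noteq> {}"
  shows "Ph S A {} \<le> (x + r\<^sup>2) * om (A - {y})"
proof -
  have AS: "A \<subseteq> S" using assms cov_subset by blast
  have BS: "A - {y} \<subseteq> S - {y}" using AS by blast
  define X where "X = rch (S - {y}) (A - {y})"
  have X: "A - {y} \<subseteq> X" "X \<subseteq> S - {y}" "cov X (A - {y})" "finite X"
    unfolding X_def using rch_base[OF BS] rch_subset cov_rch[OF BS] finite_rch assms by auto
  have "X \<inter> Z \<subset> Z" "X \<inter> Z \<noteq> {}" using assms X by auto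
  then obtain u v where uv: "u \<in> X \<inter> Z" "v \<in> Z" "v \<notin> X \<inter> Z" "E u v" using conn_edge[OF assms(4), of "X \<inter> Z"] by blast
  then have "v = y" using rch_closed[OF BS, of u v] assms unfolding X_def by blast
  then have "u \<in> Nb X {y}" using uv E_sym unfolding Nb_def by auto
  then have c1: "1 \<le> card (Nb X {y})" using X(4) unfolding Nb_def by (simp add: Suc_le_eq card_gt_0_iff) blast
  have "Ph S A {} \<le> Ph (insert y X) A {}"
  proof (rule Ph_remove[OF assms(1)])
    show "cov S (insert y X)" by (rule cov_mono[OF assms(2)]) (use assms(3) X AS in auto)
  qed (use X in auto)
  also have "\<dots> = Ph (insert y X) (insert y (A - {y})) {}" using assms by (simp add: insert_absorb)
  also have "\<dots> \<le> x * Ph X (A - {y}) {} + r * Ph X (A - {y}) ({} \<union> Nb X {y})"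
    by (rule Ph_absorb1) (use X in auto)
  also have "\<dots> \<le> x * om (A - {y}) + r * (r ^ 1 * om (A - {y}))"
  proof (intro add_mono mult_left_mono)
    show "Ph X (A - {y}) {} \<le> om (A - {y})" by (rule Ph_le_om0[OF X(4,3)])
    have "Ph X (A - {y}) (Nb X {y}) \<le> r ^ card (Nb X {y}) * om (A - {y})"
      by (rule Ph_le_om) (use X in \<open>auto simp: Nb_def\<close>)
    also have "\<dots> \<le> r ^ 1 * om (A - {y})"
      by (rule mult_right_mono) (use r_pow_anti[OF c1] om_pos in \<open>auto intro: less_imp_le\<close>)
    finally show "Ph X (A - {y}) ({} \<union> Nb X {y}) \<le> r ^ 1 * om (A - {y})" by simp
  qed (use x_pos r_pos in auto)
  finally show ?thesis by (simp add: algebra_simps power2_eq_square)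
qed

text \<open>In the branch with \<open>w\<close> in \<open>I\<close>, the new root \<open>y\<close>
  is linked to a further root without using \<open>w\<close>. Then \<open>Ph_pendant\<close> gives
  the factor \<open>x + r * r = 1 - r * x\<close>, where the basic estimate gives one.\<close>

lemma Ph_closed_gain:
  assumes "finite S" "cov S A" "w \<in> S" "w \<notin> A" "y \<in> Nb S {w}" "y \<notin> A"
    and "conn Z" "Z \<subseteq> S - {w}" "y \<in> Z" "Z \<inter> (A \<union> Nb S {w} - {y}) \<noteq> {}"
  shows "Ph (S - {w}) (A \<union> Nb S {w}) {} \<le> (1 - r * x) * om A"
proof -
  have fA: "finite A" using assms cov_subset finite_subset by metis
  have "Ph (S - {w}) (A \<union> Nb S {w}) {} \<le> (x + r\<^sup>2) * om (A \<union> Nb S {w} - {y})"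
    by (rule Ph_pendant[of _ _ _ Z]) (use assms cov_delete in auto)
  also have "\<dots> \<le> (x + r\<^sup>2) * om A"
    by (intro mult_left_mono om_mono) (use assms fA x_pos in \<open>auto simp: Nb_def\<close>)
  also have "x + r\<^sup>2 = 1 - r * x" unfolding x_def by (simp add: power2_eq_square algebra_simps)
  finally show ?thesis .
qed

text \<open>The branch with \<open>w\<close> outside \<open>I\<close> is not improved, the other one
  is: \<open>x + r * (1 - r * x) = 1 - x * r * r\<close>. The set \<open>Z\<close> with the vertex
  \<open>w\<close> plays the part of a cycle through the roots.\<close>

lemma Ph_gain:
  assumes "finite S" "cov S A" "u \<in> A" "w \<in> S" "w \<notin> A" "E u w" "y \<in> Nb S {w}" "y \<notin> A"
    and "conn Z" "Z \<subseteq> S - {w}" "y \<in> Z" "Z \<inter> (A \<union> Nb S {w} - {y}) \<noteq> {}"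
  shows "Ph S A {} \<le> (1 - x * r\<^sup>2) * om A"
proof -
  have AS: "A \<subseteq> S" using assms cov_subset by blast
  have fA: "finite A" using assms AS finite_subset by metis
  have "Ph S (insert w A) {} \<le> om (insert w A)"
    by (rule Ph_le_om0[OF assms(1) cov_mono[OF assms(2)]]) (use assms AS in auto)
  also have "\<dots> \<le> x * om A" using om_insert_adj[OF fA] assms by blast
  finally have 1: "Ph S (insert w A) {} \<le> x * om A" .
  have "r * Ph (S - {w}) (A \<union> Nb S {w}) {} \<le> r * ((1 - r * x) * om A)"
    using Ph_closed_gain[OF assms(1,2,4,5,7-12)] r_pos by simp
  then have "Ph S A {} \<le> x * om A + r * ((1 - r * x) * om A)"
    using 1 Ph_branch[OF assms(1,4,5)] by simp
  also have "\<dots> = (x + r - x * r\<^sup>2) * om A" by (simp add: algebra_simps power2_eq_square)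
  finally show ?thesis using xr by simp
qed

text \<open>\<open>Y\<close> stays connected without any one of its vertices, so it behaves like a
  cycle. The exposure is continued until it touches \<open>Y\<close>. If a single root lies in
  \<open>Y\<close>, \<open>Ph_gain\<close> applies there. If the exposed vertex is put into
  \<open>I\<close> and lies in \<open>Y\<close>, or has two neighbours in \<open>Y\<close>, these
  become two linked roots and \<open>Ph_closed_gain\<close> applies. In all other branches
  \<open>Y\<close> survives with at most one root.\<close>

lemma Ph_cycle:
  assumes "finite S" "cov S A" "Y \<subseteq> S" "conn Y" "\<And>w. w \<in> Y \<Longrightarrow> conn (Y - {w})" "3 \<le> card Y"
    and "card (Y \<inter> A) \<le> 1"
  shows "Ph S A {} \<le> (1 - x * r\<^sup>2) * om A"
  using assms(1-3,7)
proof (induction "card (S - A)" arbitrary: S A rule: less_induct)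
  case less
  have AS: "A \<subseteq> S" using less cov_subset by blast
  have fA: "finite A" using less AS finite_subset by metis
  have fY: "finite Y" using assms(6) card.infinite by force
  have two: "\<exists>y\<in>Nb Y {w}. y \<noteq> a" if w: "w \<in> Y" for w a
  proof (cases "a \<in> Y \<and> a \<noteq> w")
    case True
    have "{w} \<subset> Y - {a}"
    proof -
      have "card (Y - {a}) \<ge> 2" using assms(6) fY True by simp
      then have "card (Y - {a}) \<noteq> card {w}" by simp
      then have "Y - {a} \<noteq> {w}" by metis
      moreover have "{w} \<subseteq> Y - {a}" using True w by auto
      ultimately show ?thesis by (metis psubsetI)
    qed
    then obtain u v where "u \<in> {w}" "v \<in> Y - {a}" "v \<notin> {w}" "E u v"
      using conn_edge[OF assms(5), of a "{w}"] True by blast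
    then show ?thesis unfolding Nb_def by blast
  next
    case False
    have "Y \<noteq> {w}" using assms(6) by auto
    then have "{w} \<subset> Y" using w by blast
    then obtain u v where "u \<in> {w}" "v \<in> Y" "v \<notin> {w}" "E u v"
      using conn_edge[OF assms(4), of "{w}"] by blast
    then have "v \<in> Nb Y {w}" "v \<noteq> a" using False unfolding Nb_def by auto
    then show ?thesis by blast
  qed
  show ?case
  proof (cases "Y \<inter> A = {}")
    case False
    then obtain a where a: "a \<in> Y" "a \<in> A" by blast
    have YA: "Y \<inter> A = {a}" using a less(5) fY
      card_le_Suc0_iff_eq[of "Y \<inter> A"] by auto
    obtain w where w: "w \<in> Y" "E a w" using two[OF a(1), of a] unfolding Nb_def by blast
    obtain y where y: "y \<in> Y" "E w y" "y \<noteq> a" using two[OF w(1), of a] unfolding Nb_def by blast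
    have wa: "w \<noteq> a" "y \<noteq> w" using w y E_irr by auto
    show ?thesis
      by (rule Ph_gain[of S A a w y "Y - {w}"])
        (use less a w y wa YA assms in \<open>auto simp: Nb_def\<close>)
  next
    case True
    have "A \<noteq> S" using True less(4) assms(6) by (metis Int_absorb2 card.empty not_numeral_le_zero)
    then obtain u w where uw: "u \<in> A" "w \<in> S" "w \<notin> A" "E u w" using cov_grow[OF less(3)] by blast
    have "card (S - insert w A) < card (S - A)" by (rule psubset_card_mono) (use uw less(2) in auto)
    moreover have "cov S (insert w A)" by (rule cov_mono[OF less(3)]) (use uw AS in auto)
    moreover have "card (Y \<inter> insert w A) \<le> 1" using True by (cases "w \<in> Y") auto
    ultimately have "Ph S (insert w A) {} \<le> (1 - x * r\<^sup>2) * om (insert w A)"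
      using less(1)[OF _ less(2) _ less(4)] by blast
    also have nn: "0 \<le> 1 - x * r\<^sup>2"
    proof -
      have "r\<^sup>2 \<le> 1" using r_pos r_le by (intro power_le_one) auto
      then have "x * r\<^sup>2 \<le> 1 * 1" using x_pos x_less by (intro mult_mono) auto
      then show ?thesis by simp
    qed
    then have "(1 - x * r\<^sup>2) * om (insert w A) \<le> (1 - x * r\<^sup>2) * (x * om A)"
      using om_insert_adj[OF fA uw(3,1,4)] by (rule mult_left_mono[rotated])
    finally have 1: "Ph S (insert w A) {} \<le> (1 - x * r\<^sup>2) * (x * om A)" .
    have le: "(1 - r * x) * om A \<le> (1 - x * r\<^sup>2) * om A"
    proof -
      have "x * r\<^sup>2 \<le> r * x" using r_pos r_le x_pos by (simp add: power2_eq_square)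
      then show ?thesis using om_pos[of A] by (intro mult_right_mono) auto
    qed
    have 2: "Ph (S - {w}) (A \<union> Nb S {w}) {} \<le> (1 - x * r\<^sup>2) * om A"
    proof (cases "w \<in> Y \<or> \<not> card (Y \<inter> Nb S {w}) \<le> 1")
      case True': True
      obtain y1 y2 Z where yz: "y1 \<in> Nb S {w}" "y2 \<in> Nb S {w}" "y1 \<noteq> y2" "y1 \<in> Z" "y2 \<in> Z" "Z \<subseteq> Y - {w}" "conn Z"
      proof (cases "w \<in> Y")
        case True
        obtain y1 where y1: "y1 \<in> Nb Y {w}" using two[OF True, of w] by blast
        obtain y2 where y2: "y2 \<in> Nb Y {w}" "y2 \<noteq> y1" using two[OF True, of y1] by blast
        show ?thesis using that[of y1 y2 "Y - {w}"] y1 y2 assms(5)[OF True] less(4) E_irr unfolding Nb_def by blast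
      next
        case False
        then obtain y1 y2 where "y1 \<in> Y \<inter> Nb S {w}" "y2 \<in> Y \<inter> Nb S {w}" "y1 \<noteq> y2"
          using True' fY card_le_Suc0_iff_eq[of "Y \<inter> Nb S {w}"] by auto
        then show ?thesis using that[of y1 y2 Y] False assms(4) by blast
      qed
      have "Ph (S - {w}) (A \<union> Nb S {w}) {} \<le> (1 - r * x) * om A"
        by (rule Ph_closed_gain[of _ _ _ y1 Z]) (use less uw yz True in auto)
      then show ?thesis using le by linarith
    next
      case False
      have "card (S - {w} - (A \<union> Nb S {w})) < card (S - A)" by (rule psubset_card_mono) (use uw less(2) in auto)
      moreover have "card (Y \<inter> (A \<union> Nb S {w})) \<le> 1"
      proof -
        have "Y \<inter> (A \<union> Nb S {w}) = Y \<inter> Nb S {w}" using True by blast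
        then show ?thesis using False by simp
      qed
      moreover have "Y \<subseteq> S - {w}" using less(4) False by blast
      ultimately have "Ph (S - {w}) (A \<union> Nb S {w}) {} \<le> (1 - x * r\<^sup>2) * om (A \<union> Nb S {w})"
        using less(1)[OF _ _ cov_delete[OF less(3) uw(2,3)]] less(2) by blast
      also have "\<dots> \<le> (1 - x * r\<^sup>2) * om A"
        using nn by (intro mult_left_mono om_mono) (use fA less in \<open>auto simp: Nb_def\<close>)
      finally show ?thesis .
    qed
    have "Ph S A {} = Ph S (insert w A) {} + r * Ph (S - {w}) (A \<union> Nb S {w}) {}"
      using Ph_branch[OF less(2) uw(2,3)] .
    also have "\<dots> \<le> (1 - x * r\<^sup>2) * (x * om A) + r * ((1 - x * r\<^sup>2) * om A)"
      using 1 2 r_pos by (intro add_mono mult_left_mono) auto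
    also have "\<dots> = (x + r) * ((1 - x * r\<^sup>2) * om A)" by (simp add: algebra_simps)
    finally show ?thesis using xr by simp
  qed
qed

end

section \<open>Colorings and critical sets\<close>

lemma transpose_image_eq: "i \<in> C \<Longrightarrow> j \<in> C \<Longrightarrow> transpose i j ` C = C"
proof
  assume ij: "i \<in> C" "j \<in> C"
  show "transpose i j ` C \<subseteq> C" using ij by (auto simp: transpose_def)
  then have "transpose i j ` (transpose i j ` C) \<subseteq> transpose i j ` C" by (rule image_mono)
  then show "C \<subseteq> transpose i j ` C" by (simp add: image_image)
qed

text \<open>Two transpositions suffice: the first takes \<open>i\<close> to \<open>i'\<close>, the
  second corrects the image of \<open>j\<close> without moving \<open>i'\<close>.\<close>

lemma ex_permutation_pair:
  assumes "i \<in> C" "j \<in> C" "i' \<in> C" "j' \<in> C" "(i = j) = (i' = j')"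
  shows "\<exists>\<pi>. bij \<pi> \<and> \<pi> ` C = C \<and> \<pi> i = i' \<and> \<pi> j = j'"
proof -
  let ?p = "transpose i i'"
  let ?s = "transpose (?p j) j'"
  have p: "?p ` C = C" "bij ?p" using transpose_image_eq assms by auto
  then have "?p j \<in> C" using assms by blast
  then have s: "?s ` C = C" "bij ?s" using transpose_image_eq assms by auto
  have "?s (?p i) = i'"
  proof (cases "i = j")
    case True then show ?thesis using assms by simp
  next
    case False
    then have "?p j \<noteq> i'" "j' \<noteq> i'" using assms by (auto simp: transpose_def)
    then show ?thesis by (simp add: transpose_def)
  qed
  moreover have "?s (?p j) = j'" by simp
  moreover have "bij (?s \<circ> ?p)" using p s bij_comp by blast
  moreover have "(?s \<circ> ?p) ` C = C" using p(1) s(1) by (metis image_comp)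
  ultimately show ?thesis by (intro exI[of _ "?s \<circ> ?p"]) auto
qed

context ugraph
begin

definition cl :: "'a set \<Rightarrow> nat set \<Rightarrow> ('a \<Rightarrow> nat) set" where
  "cl V C = {c \<in> V \<rightarrow>\<^sub>E C. \<forall>u\<in>V. \<forall>v\<in>V. E u v \<longrightarrow> c u \<noteq> c v}"

definition P :: "'a set \<Rightarrow> nat set \<Rightarrow> nat" where
  "P V C = card (cl V C)"

text \<open>Only existence matters here, so the values outside \<open>V\<close> are left free;
  colorings can then be updated and glued without restoring \<open>undefined\<close>.\<close>

definition col :: "'a set \<Rightarrow> nat \<Rightarrow> bool" where
  "col V m \<longleftrightarrow> (\<exists>c::'a \<Rightarrow> nat. (\<forall>v\<in>V. c v < m) \<and> (\<forall>u\<in>V. \<forall>v\<in>V. E u v \<longrightarrow> c u \<noteq> c v))"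

definition crit :: "'a set \<Rightarrow> nat \<Rightarrow> bool" where
  "crit V m \<longleftrightarrow> finite V \<and> \<not> col V m \<and> (\<forall>v\<in>V. col (V - {v}) m)"

lemma finite_cl: "finite V \<Longrightarrow> finite C \<Longrightarrow> finite (cl V C)"
  unfolding cl_def by (simp add: finite_PiE)

lemma cl_restrict: "c \<in> cl V C \<Longrightarrow> X \<subseteq> V \<Longrightarrow> restrict c X \<in> cl X C"
  unfolding cl_def by (fastforce simp: PiE_iff)

lemma cl_val: "c \<in> cl V C \<Longrightarrow> v \<in> V \<Longrightarrow> c v \<in> C"
  unfolding cl_def by (auto simp: PiE_iff)

lemma cl_edge: "c \<in> cl V C \<Longrightarrow> v \<in> V \<Longrightarrow> u \<in> V \<Longrightarrow> E u v \<Longrightarrow> c u \<noteq> c v"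
  unfolding cl_def by auto

lemma cl_ext: "c \<in> cl V C \<Longrightarrow> v \<notin> V \<Longrightarrow> c v = undefined"
  unfolding cl_def by (auto simp: PiE_iff extensional_def)

lemma cl_restrict_self: "c \<in> cl V C \<Longrightarrow> restrict c V = c"
  unfolding cl_def by (auto simp: PiE_iff extensional_restrict)

lemma cl_eqI: "c \<in> cl V C \<Longrightarrow> d \<in> cl V C \<Longrightarrow> (\<And>v. v \<in> V \<Longrightarrow> c v = d v) \<Longrightarrow> c = d"
  using cl_ext by (metis ext)

lemma restrict_eqD: "restrict c X = restrict d X \<Longrightarrow> v \<in> X \<Longrightarrow> c v = d v"
  by (metis restrict_apply')

section \<open>Counting extensions of colorings\<close>

lemma card_extend_insert:
  assumes "finite X" "finite C" "z \<notin> X" "u \<in> X" "E u z" "F \<subseteq> cl X C"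
  shows "card {c \<in> cl (insert z X) C. restrict c X \<in> F} \<le> card F * (card C - 1)"
proof -
  let ?G = "{c \<in> cl (insert z X) C. restrict c X \<in> F}"
  let ?h = "\<lambda>c. (restrict c X, c z)"
  have fF: "finite F" using assms finite_cl finite_subset by blast
  have "inj_on ?h ?G"
  proof (rule inj_onI)
    fix c d assume cd: "c \<in> ?G" "d \<in> ?G" "?h c = ?h d"
    show "c = d"
      by (rule cl_eqI[of c "insert z X" C d]) (use cd restrict_eqD[of c X d] in auto)
  qed
  moreover have "?h ` ?G \<subseteq> (SIGMA f:F. C - {f u})"
  proof
    fix p assume "p \<in> ?h ` ?G"
    then obtain c where c: "c \<in> ?G" "p = ?h c" by blast
    then have "c z \<noteq> c u" "c z \<in> C" using cl_edge[of c "insert z X" C z u] cl_val[of c "insert z X" C z] assms by auto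
    then show "p \<in> (SIGMA f:F. C - {f u})" using c assms by auto
  qed
  moreover have "finite (SIGMA f:F. C - {f u})" using fF assms by blast
  ultimately have "card ?G \<le> card (SIGMA f:F. C - {f u})" by (rule card_inj_on_le)
  also have "\<dots> = (\<Sum>f\<in>F. card (C - {f u}))" using fF assms by (simp add: card_SigmaI)
  also have "\<dots> = (\<Sum>f\<in>F. card C - 1)"
    by (rule sum.cong) (use assms cl_val in \<open>auto intro!: card_Diff_singleton\<close>)
  finally show ?thesis by simp
qed

text \<open>The vertices of \<open>V - X\<close> are colored one after another, each next to an
  earlier one and hence with at most \<open>card C - 1\<close> choices. A family \<open>F\<close>
  takes the place of all colorings of \<open>X\<close> because the bound is also applied to those
  that agree on two given vertices.\<close>

lemma card_extend:
  assumes "finite V" "finite C" "cov V X" "F \<subseteq> cl X C"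
  shows "card {c \<in> cl V C. restrict c X \<in> F} \<le> card F * (card C - 1) ^ card (V - X)"
  using assms(3,4)
proof (induction "card (V - X)" arbitrary: X F rule: less_induct)
  case less
  have XV: "X \<subseteq> V" using less(2) cov_subset by blast
  have fX: "finite X" using XV assms(1) finite_subset by blast
  show ?case
  proof (cases "X = V")
    case True
    have "{c \<in> cl V C. restrict c X \<in> F} \<subseteq> F" using cl_restrict_self True by force
    moreover have "finite F" using less(3) fX finite_cl assms finite_subset by metis
    ultimately show ?thesis using True card_mono by auto
  next
    case False
    then obtain u z where uz: "u \<in> X" "z \<in> V" "z \<notin> X" "E u z" using cov_grow[OF less(2)] by blast
    let ?X = "insert z X"
    let ?F = "{c \<in> cl ?X C. restrict c X \<in> F}"
    have sub: "V - ?X \<subset> V - X" using uz by auto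
    then have lt: "card (V - ?X) < card (V - X)" using assms(1) by (intro psubset_card_mono) auto
    have cv: "cov V ?X" by (rule cov_mono[OF less(2)]) (use uz XV in auto)
    have "{c \<in> cl V C. restrict c X \<in> F} \<subseteq> {c \<in> cl V C. restrict c ?X \<in> ?F}"
    proof clarify
      fix c assume c: "c \<in> cl V C" "restrict c X \<in> F"
      have "restrict (restrict c ?X) X = restrict c X" by (auto simp: restrict_def)
      then show "restrict c ?X \<in> cl ?X C \<and> restrict (restrict c ?X) X \<in> F"
        using c cl_restrict[of c V C ?X] uz XV by simp
    qed
    then have "card {c \<in> cl V C. restrict c X \<in> F} \<le> card {c \<in> cl V C. restrict c ?X \<in> ?F}"
      by (intro card_mono) (auto intro: finite_subset[OF _ finite_cl[OF assms(1,2)]])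
    also have "\<dots> \<le> card ?F * (card C - 1) ^ card (V - ?X)" by (rule less(1)[OF lt cv]) simp
    also have "\<dots> \<le> card F * (card C - 1) * (card C - 1) ^ card (V - ?X)"
      by (rule mult_le_mono1) (rule card_extend_insert[OF fX assms(2) uz(3,1,4) less(3)])
    also have "\<dots> = card F * (card C - 1) ^ Suc (card (V - ?X))" by simp
    also have "Suc (card (V - ?X)) = card (V - X)"
    proof -
      have "V - X = insert z (V - ?X)" using uz by blast
      then have "card (V - X) = card (insert z (V - ?X))" by (rule arg_cong)
      also have "\<dots> = Suc (card (V - ?X))" by (rule card_insert_disjoint) (use assms(1) in auto)
      finally show ?thesis by (rule sym)
    qed
    finally show ?thesis .
  qed
qed

lemma P_extend:
  assumes "finite V" "finite C" "cov V X"
  shows "P V C \<le> P X C * (card C - 1) ^ card (V - X)"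
proof -
  have "cl V C = {c \<in> cl V C. restrict c X \<in> cl X C}" using cl_restrict cov_subset[OF assms(3)] by blast
  then show ?thesis using card_extend[OF assms order_refl] unfolding P_def by simp
qed

lemma P_Un_le:
  assumes "finite D" "finite B" "finite C"
  shows "P (D \<union> B) C \<le> P D C * card C ^ card B"
proof -
  let ?h = "\<lambda>c. (restrict c D, restrict c B)"
  have "inj_on ?h (cl (D \<union> B) C)"
  proof (rule inj_onI)
    fix c d assume cd: "c \<in> cl (D \<union> B) C" "d \<in> cl (D \<union> B) C" "?h c = ?h d"
    show "c = d"
      by (rule cl_eqI[OF cd(1,2)]) (use cd(3) restrict_eqD[of c D d] restrict_eqD[of c B d] in auto)
  qed
  moreover have "?h ` cl (D \<union> B) C \<subseteq> cl D C \<times> (B \<rightarrow>\<^sub>E C)"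
    using cl_restrict[of _ "D \<union> B" C D] cl_val by (auto simp: PiE_iff)
  ultimately have "P (D \<union> B) C \<le> card (cl D C \<times> (B \<rightarrow>\<^sub>E C))"
    unfolding P_def using assms by (intro card_inj_on_le) (auto simp: finite_cl finite_PiE)
  also have "\<dots> = P D C * card C ^ card B" unfolding P_def using assms by (simp add: card_cartesian_product card_PiE)
  finally show ?thesis .
qed

lemma P_empty: "P {} C = 1"
proof -
  have "cl {} C = {\<lambda>_. undefined}" unfolding cl_def by (auto simp: PiE_empty_domain)
  then show ?thesis unfolding P_def by simp
qed

lemma P_cov_le:
  assumes "finite V" "finite C" "cov V A"
  shows "P V C \<le> card C ^ card A * (card C - 1) ^ (card V - card A)"
proof -
  have AV: "A \<subseteq> V" using cov_subset assms by blast
  then have fA: "finite A" using assms finite_subset by blast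
  have "P A C \<le> card C ^ card A" using P_Un_le[of "{}" A C] assms fA P_empty by simp
  then have "P V C \<le> card C ^ card A * (card C - 1) ^ card (V - A)"
    using P_extend[OF assms] by (meson le_trans mult_le_mono1)
  then show ?thesis using card_Diff_subset[OF fA AV] by simp
qed

section \<open>Colorability and critical sets\<close>

lemma col_mono: "col V m \<Longrightarrow> U \<subseteq> V \<Longrightarrow> col U m"
  unfolding col_def by blast

lemma ncol_card: assumes "finite V" "\<not> col V m" shows "m < card V"
proof (rule ccontr)
  assume "\<not> m < card V"
  obtain f :: "'a \<Rightarrow> nat" where f: "bij_betw f V {0..<card V}" using ex_bij_betw_finite_nat[OF assms(1)] by blast
  have "col V m" unfolding col_def
  proof (intro exI[of _ f] conjI ballI impI)
    fix v assume "v \<in> V"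
    then have "f v \<in> {0..<card V}" using f bij_betwE by blast
    then show "f v < m" using \<open>\<not> m < card V\<close> by simp
  next
    fix u v assume "u \<in> V" "v \<in> V" "E u v"
    then show "f u \<noteq> f v" using f E_irr unfolding bij_betw_def inj_on_def by blast
  qed
  then show False using assms by blast
qed

lemma col_indep: assumes "indep I" "col (V - I) m" shows "col V (Suc m)"
proof -
  obtain c where c: "\<forall>v\<in>V - I. c v < m" "\<forall>u\<in>V - I. \<forall>v\<in>V - I. E u v \<longrightarrow> c u \<noteq> (c v::nat)"
    using assms(2) unfolding col_def by blast
  let ?d = "\<lambda>v. if v \<in> I then m else c v"
  have "\<forall>v\<in>V. ?d v < Suc m" using c(1) by (auto intro: less_SucI)
  moreover have "?d u \<noteq> ?d v" if uv: "u \<in> V" "v \<in> V" "E u v" for u v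
  proof -
    have "\<not> (u \<in> I \<and> v \<in> I)" using assms(1) uv unfolding indep_def by blast
    then show ?thesis using c uv by (cases "u \<in> I"; cases "v \<in> I") (auto dest: bspec)
  qed
  ultimately show ?thesis unfolding col_def by (intro exI[of _ ?d]) blast
qed

text \<open>A smallest covering set has one root in each component. If all components were
  \<open>m\<close>-colorable, so would be \<open>X\<close>; let \<open>D\<close> be one that is not.
  Each other component is counted with \<open>card C\<close> choices for its root and
  \<open>card C - 1\<close> for every further vertex.\<close>

lemma P_component:
  assumes "finite X" "finite C" "\<not> col X m"
  shows "\<exists>D. D \<subseteq> X \<and> conn D \<and> \<not> col D m \<and> 1 \<le> cc X \<and> card D + (cc X - 1) \<le> card X \<and>
    P X C \<le> P D C * card C ^ (cc X - 1) * (card C - 1) ^ (card X - card D - (cc X - 1))"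
proof -
  obtain A where A: "cov X A" "card A = cc X" by (rule cc_witness)
  have AX: "A \<subseteq> X" using A cov_subset by blast
  have fA: "finite A" using AX assms finite_subset by blast
  define D where "D a = rch X {a}" for a
  have Dcl: "v \<in> D a" if "a \<in> A" "u \<in> D a" "v \<in> X" "E u v" for a u v
    using rch_closed[of "{a}" X u v] that AX unfolding D_def by blast
  have DX: "D a \<subseteq> X" for a unfolding D_def by (rule rch_subset)
  have aD: "a \<in> D a" if "a \<in> A" for a using rch_base[of "{a}" X] that AX unfolding D_def by blast
  have X_eq: "X \<subseteq> \<Union> (D ` A)"
  proof (rule ccontr)
    assume "\<not> X \<subseteq> \<Union> (D ` A)"
    then have "\<Union> (D ` A) \<subset> X" using DX by blast
    moreover have "A \<subseteq> \<Union> (D ` A)" using aD by blast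
    ultimately obtain u v where "u \<in> \<Union> (D ` A)" "v \<in> X" "v \<notin> \<Union> (D ` A)" "E u v"
      using covD[OF A(1), of "\<Union> (D ` A)"] by metis
    then show False using Dcl by blast
  qed
  have "\<exists>a\<in>A. \<not> col (D a) m"
  proof (rule ccontr)
    assume "\<not> (\<exists>a\<in>A. \<not> col (D a) m)"
    then have "\<forall>a\<in>A. \<exists>c::'a\<Rightarrow>nat. (\<forall>v\<in>D a. c v < m) \<and> (\<forall>u\<in>D a. \<forall>v\<in>D a. E u v \<longrightarrow> c u \<noteq> c v)"
      unfolding col_def by blast
    then obtain c :: "'a \<Rightarrow> 'a \<Rightarrow> nat" where
      c: "\<forall>a\<in>A. (\<forall>v\<in>D a. c a v < m) \<and> (\<forall>u\<in>D a. \<forall>v\<in>D a. E u v \<longrightarrow> c a u \<noteq> c a v)"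
      by metis
    \<comment> \<open>Adjacent vertices lie in the same sets \<open>D a\<close>, so
      \<open>SOME\<close> makes the same choice for both.\<close>
    define g where "g v = (SOME a. a \<in> A \<and> v \<in> D a)" for v
    have g: "g v \<in> A \<and> v \<in> D (g v)" if "v \<in> X" for v
      unfolding g_def by (rule someI_ex) (use X_eq that in blast)
    have "g u = g v" if "u \<in> X" "v \<in> X" "E u v" for u v
    proof -
      have "(a \<in> A \<and> u \<in> D a) = (a \<in> A \<and> v \<in> D a)" for a
        using Dcl[of a u v] Dcl[of a v u] that E_sym by blast
      then show ?thesis unfolding g_def by simp
    qed
    then have "col X m" unfolding col_def using g c by (intro exI[of _ "\<lambda>v. c (g v) v"]) metis
    then show False using assms by blast
  qed
  then obtain a where a: "a \<in> A" "\<not> col (D a) m" by blast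
  have cD: "cov (D a) {a}" unfolding D_def by (rule cov_rch) (use a AX in blast)
  \<comment> \<open>A second root inside \<open>D a\<close> could be dropped, against the minimality
    of \<open>card A = cc X\<close>.\<close>
  have disj: "D a \<inter> (A - {a}) = {}"
  proof (rule ccontr)
    assume "D a \<inter> (A - {a}) \<noteq> {}"
    then obtain b where b: "b \<in> D a" "b \<in> A" "b \<noteq> a" by blast
    have "cov (D a \<union> (A - {b})) ({a} \<union> (A - {b}))" using cov_Un[OF cD cov_self] .
    moreover have "{a} \<union> (A - {b}) = A - {b}" using a b by blast
    moreover have "cov X (D a \<union> (A - {b}))" by (rule cov_mono[OF A(1)]) (use b DX AX in auto)
    ultimately have "cov X (A - {b})" using cov_trans by metis
    then have "cc X \<le> card (A - {b})" by (rule cc_le)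
    moreover have "card (A - {b}) < card A" by (rule card_Diff1_less[OF fA b(2)])
    ultimately show False using A(2) by simp
  qed
  let ?B = "A - {a}"
  have cB: "card ?B = cc X - 1" using A(2) a fA by simp
  have fD: "finite (D a)" using DX assms finite_subset by metis
  have cY: "card (D a \<union> ?B) = card (D a) + (cc X - 1)" using disj cB fD fA by (simp add: card_Un_disjoint)
  have sub: "D a \<union> ?B \<subseteq> X" using DX AX by auto
  have "P X C \<le> P (D a \<union> ?B) C * (card C - 1) ^ card (X - (D a \<union> ?B))"
    by (rule P_extend[OF assms(1,2)]) (rule cov_mono[OF A(1)], use aD[OF a(1)] sub in auto)
  also have "\<dots> \<le> P (D a) C * card C ^ card ?B * (card C - 1) ^ card (X - (D a \<union> ?B))"
    by (rule mult_le_mono1) (rule P_Un_le, use fD fA assms in auto)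
  also have "card (X - (D a \<union> ?B)) = card X - card (D a) - (cc X - 1)"
    using card_Diff_subset[OF _ sub] fD fA cY by simp
  finally have "P X C \<le> P (D a) C * card C ^ (cc X - 1) * (card C - 1) ^ (card X - card (D a) - (cc X - 1))"
    using cB by simp
  moreover have "1 \<le> cc X" using A(2) a fA by (metis One_nat_def Suc_leI card_gt_0_iff empty_iff)
  moreover have "card (D a) + (cc X - 1) \<le> card X" using cY card_mono[OF assms(1) sub] by simp
  ultimately show ?thesis using a(2) DX conn_root[OF cD] by blast
qed

lemma P_color_class:
  assumes "finite V" "v \<in> V" "finite C"
  shows "P V C \<le> (\<Sum>i\<in>C. \<Sum>I | I \<subseteq> V - {v} - Nb V {v} \<and> indep I. P (V - {v} - I) (C - {i}))"
proof -
  let ?N = "{I. I \<subseteq> V - {v} - Nb V {v} \<and> indep I}"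
  define G where "G i I = {c \<in> cl V C. c v = i \<and> {u \<in> V - {v}. c u = i} = I}" for i I
  have fN: "finite ?N" by (rule finite_subset[of _ "Pow V"]) (use assms in auto)
  have fG: "finite (G i I)" for i I unfolding G_def using finite_cl[OF assms(1,3)] by simp
  have sub: "cl V C \<subseteq> (\<Union>i\<in>C. \<Union>I\<in>?N. G i I)"
  proof
    fix c assume c: "c \<in> cl V C"
    let ?I = "{u \<in> V - {v}. c u = c v}"
    have "?I \<in> ?N"
      using cl_edge[OF c] assms E_sym unfolding Nb_def indep_def by fastforce
    moreover have "c v \<in> C" using cl_val[OF c assms(2)] .
    ultimately show "c \<in> (\<Union>i\<in>C. \<Union>I\<in>?N. G i I)" using c unfolding G_def by blast
  qed
  have "card (G i I) \<le> P (V - {v} - I) (C - {i})" for i I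
  proof -
    have "inj_on (\<lambda>c. restrict c (V - {v} - I)) (G i I)"
    proof (rule inj_onI)
      fix c d assume cd: "c \<in> G i I" "d \<in> G i I" "restrict c (V - {v} - I) = restrict d (V - {v} - I)"
      show "c = d"
      proof (rule cl_eqI[of c V C d])
        fix u assume u: "u \<in> V"
        show "c u = d u"
        proof (cases "u \<in> V - {v} - I")
          case True then show ?thesis using restrict_eqD[OF cd(3)] by blast
        next
          case False
          then have uI: "u = v \<or> u \<in> I" using u by simp
          have vi: "e v = i" "w \<in> I \<Longrightarrow> e w = i" if "e \<in> G i I" for e w
            using that unfolding G_def by auto
          show ?thesis using uI vi(1)[OF cd(1)] vi(1)[OF cd(2)] vi(2)[OF cd(1)] vi(2)[OF cd(2)] by metis
        qed
      qed (use cd in \<open>auto simp: G_def\<close>)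
    qed
    moreover have "(\<lambda>c. restrict c (V - {v} - I)) ` G i I \<subseteq> cl (V - {v} - I) (C - {i})"
    proof clarify
      fix c assume c: "c \<in> G i I"
      then have "c \<in> cl V C" unfolding G_def by blast
      then have "restrict c (V - {v} - I) \<in> cl (V - {v} - I) C" by (rule cl_restrict) blast
      moreover have "\<forall>u\<in>V - {v} - I. c u \<noteq> i" using c unfolding G_def by blast
      ultimately show "restrict c (V - {v} - I) \<in> cl (V - {v} - I) (C - {i})"
        unfolding cl_def by (auto simp: PiE_iff)
    qed
    ultimately show ?thesis
      unfolding P_def using assms by (intro card_inj_on_le) (auto simp: finite_cl)
  qed
  then have 1: "(\<Sum>i\<in>C. \<Sum>I\<in>?N. card (G i I)) \<le> (\<Sum>i\<in>C. \<Sum>I\<in>?N. P (V - {v} - I) (C - {i}))"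
    by (intro sum_mono)
  have "P V C \<le> card (\<Union>i\<in>C. \<Union>I\<in>?N. G i I)"
    unfolding P_def using sub fG fN assms by (intro card_mono) auto
  also have "\<dots> \<le> (\<Sum>i\<in>C. card (\<Union>I\<in>?N. G i I))" using assms(3) by (rule card_UN_le)
  also have "\<dots> \<le> (\<Sum>i\<in>C. \<Sum>I\<in>?N. card (G i I))" using fN by (intro sum_mono card_UN_le)
  finally show ?thesis using 1 by linarith
qed

lemma crit_exists: assumes "finite V" "\<not> col V m" shows "\<exists>H. H \<subseteq> V \<and> crit H m"
  using assms
proof (induction V rule: finite_psubset_induct)
  case (psubset V)
  show ?case
  proof (cases "\<forall>v\<in>V. col (V - {v}) m")
    case True then show ?thesis using psubset unfolding crit_def by blast
  next
    case False
    then obtain v where v: "v \<in> V" "\<not> col (V - {v}) m" by blast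
    then have "V - {v} \<subset> V" by blast
    from psubset.IH[OF this v(2)] obtain H where "H \<subseteq> V - {v}" "crit H m" by blast
    then show ?thesis by (intro exI[of _ H]) auto
  qed
qed

lemma crit_subset_col: assumes "crit V m" "U \<subset> V" shows "col U m"
proof -
  obtain v where "v \<in> V" "v \<notin> U" using assms(2) by blast
  then have "col (V - {v}) m" "U \<subseteq> V - {v}" using assms unfolding crit_def by auto
  then show ?thesis by (rule col_mono)
qed

lemma col_insert:
  assumes "finite V" "\<forall>u\<in>V - {v}. c u < m" "\<forall>u\<in>V - {v}. \<forall>w\<in>V - {v}. E u w \<longrightarrow> c u \<noteq> (c w::nat)"
    and "card (c ` Nb V {v}) < m"
  shows "col V m"
proof -
  have "\<not> {..<m} \<subseteq> c ` Nb V {v}"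
  proof
    assume "{..<m} \<subseteq> c ` Nb V {v}"
    moreover have "finite (c ` Nb V {v})" using assms(1) unfolding Nb_def by simp
    ultimately have "card {..<m} \<le> card (c ` Nb V {v})" by (rule card_mono[rotated])
    then show False using assms(4) by simp
  qed
  then obtain i where i: "i < m" "i \<notin> c ` Nb V {v}" by blast
  show ?thesis unfolding col_def
  proof (intro exI[of _ "c(v := i)"] conjI ballI impI)
    fix u w assume uw: "u \<in> V" "w \<in> V" "E u w"
    consider "u = v" "w \<noteq> v" | "w = v" "u \<noteq> v" | "u \<noteq> v" "w \<noteq> v" using uw E_irr by blast
    then show "(c(v := i)) u \<noteq> (c(v := i)) w"
    proof cases
      case 1 then have "w \<in> Nb V {v}" using uw unfolding Nb_def by blast
      then show ?thesis using 1 i by auto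
    next
      case 2 then have "u \<in> Nb V {v}" using uw E_sym unfolding Nb_def by blast
      then show ?thesis using 2 i by auto
    next
      case 3 then show ?thesis using assms(3) uw by simp
    qed
  qed (use assms(2) i in auto)
qed

lemma crit_degree: assumes "crit V m" "v \<in> V" shows "m \<le> card (Nb V {v})"
proof (rule ccontr)
  assume a: "\<not> m \<le> card (Nb V {v})"
  obtain c where c: "\<forall>u\<in>V - {v}. c u < m" "\<forall>u\<in>V - {v}. \<forall>w\<in>V - {v}. E u w \<longrightarrow> c u \<noteq> (c w::nat)"
    using assms unfolding crit_def col_def by blast
  have fV: "finite V" using assms unfolding crit_def by blast
  then have "finite (Nb V {v})" unfolding Nb_def by simp
  from card_image_le[OF this, of c] have "card (c ` Nb V {v}) < m" using a by linarith
  then have "col V m" by (rule col_insert[OF fV c])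
  then show False using assms unfolding crit_def by blast
qed

text \<open>Otherwise a coloring of \<open>V - {w}\<close> could be extended by giving
  \<open>w\<close> the color of \<open>v\<close>.\<close>

lemma crit_neighbours: assumes "crit V m" "v \<in> V" "w \<in> V" "v \<noteq> w" shows "\<not> Nb V {w} \<subseteq> Nb V {v}"
proof
  assume a: "Nb V {w} \<subseteq> Nb V {v}"
  obtain c where c: "\<forall>u\<in>V - {w}. c u < m" "\<forall>u\<in>V - {w}. \<forall>t\<in>V - {w}. E u t \<longrightarrow> c u \<noteq> (c t::nat)"
    using assms unfolding crit_def col_def by blast
  have vw: "E v t" "E t v" if "E w t" "t \<in> V" for t using a that E_sym unfolding Nb_def by blast+
  have "col V m" unfolding col_def
  proof (intro exI[of _ "c(w := c v)"] conjI ballI impI)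
    fix u t assume ut: "u \<in> V" "t \<in> V" "E u t"
    consider "u = w" "t \<noteq> w" | "t = w" "u \<noteq> w" | "u \<noteq> w" "t \<noteq> w" using ut E_irr by blast
    then show "(c(w := c v)) u \<noteq> (c(w := c v)) t"
      by cases (use c ut vw E_sym assms in \<open>auto simp: fun_upd_def\<close>)
  qed (use c assms in auto)
  then show False using assms unfolding crit_def by blast
qed

text \<open>If both colorings give the same answer to whether \<open>a\<close> and \<open>b\<close>
  agree, a permutation of the colors makes them coincide on \<open>{a,b}\<close>. The case
  \<open>a = b\<close> is included; it shows that critical sets have no cut vertex.\<close>

lemma col_glue:
  assumes "\<forall>u\<in>X. \<forall>v\<in>Y. \<not> E u v"
    and c: "\<forall>v\<in>X \<union> {a,b}. c v < m" "\<forall>u\<in>X \<union> {a,b}. \<forall>v\<in>X \<union> {a,b}. E u v \<longrightarrow> c u \<noteq> (c v::nat)"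
    and d: "\<forall>v\<in>Y \<union> {a,b}. d v < m" "\<forall>u\<in>Y \<union> {a,b}. \<forall>v\<in>Y \<union> {a,b}. E u v \<longrightarrow> d u \<noteq> (d v::nat)"
    and eq: "(c a = c b) = (d a = d b)"
  shows "col (X \<union> Y \<union> {a,b}) m"
proof -
  obtain \<pi> where p: "bij \<pi>" "\<pi> ` {..<m} = {..<m}" "\<pi> (d a) = c a" "\<pi> (d b) = c b"
    using ex_permutation_pair[of "d a" "{..<m}" "d b" "c a" "c b"] c(1) d(1) eq by auto
  let ?e = "\<lambda>v. if v \<in> X \<union> {a,b} then c v else \<pi> (d v)"
  have e2: "?e v = \<pi> (d v)" if "v \<in> Y \<union> {a,b}" "v \<notin> X" for v using that p by auto
  have inj: "\<pi> i = \<pi> j \<longleftrightarrow> i = j" for i j using p(1) by (metis bij_pointE)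
  have rng: "\<pi> i < m" if "i < m" for i using p(2) that by blast
  show ?thesis unfolding col_def
  proof (intro exI[of _ ?e] conjI ballI impI)
    fix v assume "v \<in> X \<union> Y \<union> {a, b}"
    then show "?e v < m" using c(1) d(1) rng by auto
  next
    fix u v assume uv: "u \<in> X \<union> Y \<union> {a, b}" "v \<in> X \<union> Y \<union> {a, b}" "E u v"
    show "?e u \<noteq> ?e v"
    proof (cases "u \<in> X \<union> {a,b} \<and> v \<in> X \<union> {a,b}")
      case True
      then have "c u \<noteq> c v" using bspec[OF bspec[OF c(2)], of u v] uv(3) by blast
      then show ?thesis using True by simp
    next
      case False
      have uX: "u \<notin> X"
      proof
        assume "u \<in> X"
        then have "v \<in> Y" using False uv(2) by auto
        then show False using assms(1) \<open>u \<in> X\<close> uv(3) by blast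
      qed
      have "v \<notin> X"
      proof
        assume "v \<in> X"
        then have "u \<in> Y" using False uv(1) by auto
        then show False using assms(1) \<open>v \<in> X\<close> E_sym[OF uv(3)] by blast
      qed
      with uX have "u \<notin> X \<and> v \<notin> X" by simp
      then have "?e u = \<pi> (d u)" "?e v = \<pi> (d v)" "u \<in> Y \<union> {a,b}" "v \<in> Y \<union> {a,b}" using e2[of u] e2[of v] uv(1,2) by auto
      then show ?thesis using bspec[OF bspec[OF d(2)], of u v] uv(3) inj by metis
    qed
  qed
qed

lemma crit_conn_Diff1:
  assumes "crit V m" "v \<in> V" "V - {v} \<noteq> {}" shows "conn (V - {v})"
proof (rule connI[OF assms(3)], rule ccontr)
  fix X assume X: "X \<subset> V - {v}" "X \<noteq> {}" "\<not> (\<exists>u\<in>X. \<exists>w\<in>V - {v} - X. E u w)"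
  let ?Y = "V - {v} - X"
  have "X \<union> {v,v} \<subset> V" "?Y \<union> {v,v} \<subset> V" using X assms by auto
  then have "col (X \<union> {v,v}) m" "col (?Y \<union> {v,v}) m" using crit_subset_col assms by blast+
  then obtain c d :: "'a \<Rightarrow> nat" where
    c: "\<forall>u\<in>X \<union> {v,v}. c u < m" "\<forall>u\<in>X \<union> {v,v}. \<forall>w\<in>X \<union> {v,v}. E u w \<longrightarrow> c u \<noteq> c w" and
    d: "\<forall>u\<in>?Y \<union> {v,v}. d u < m" "\<forall>u\<in>?Y \<union> {v,v}. \<forall>w\<in>?Y \<union> {v,v}. E u w \<longrightarrow> d u \<noteq> d w"
    unfolding col_def by blast
  have "col (X \<union> ?Y \<union> {v,v}) m"
    by (rule col_glue[OF _ c d]) (use X in blast)+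
  moreover have "X \<union> ?Y \<union> {v,v} = V" using X assms by blast
  ultimately show False using assms unfolding crit_def by simp
qed

lemma crit_conn: assumes "crit V m" "1 \<le> m" shows "conn V"
proof -
  have "V \<noteq> {}" using assms unfolding crit_def col_def by blast
  then obtain v where v: "v \<in> V" by blast
  have "Nb V {v} \<noteq> {}" using crit_degree[OF assms(1) v] assms(2) by auto
  then obtain u where u: "u \<in> V" "E v u" unfolding Nb_def by blast
  then have uv: "u \<in> V - {v}" "E u v" using E_irr E_sym by auto
  then have "conn (V - {v})" using crit_conn_Diff1[OF assms(1) v] by blast
  then have "conn (insert v (V - {v}))" using conn_insert uv by blast
  then show ?thesis using v by (simp add: insert_absorb)
qed

end

section \<open>From numbers of colorings to weighted sums\<close>

context qgraph
begin

lemma P_rank_le: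
  assumes "finite X" "card C = q"
  shows "real (P X C) \<le> real q ^ card X * om X"
proof -
  have fC: "finite C" using assms q2 card.infinite by force
  obtain A where A: "cov X A" "card A = cc X" by (rule cc_witness)
  have le: "cc X \<le> card X" by (rule cc_le_card)
  have "real (P X C) \<le> real (q ^ cc X * (q - 1) ^ (card X - cc X))"
    using P_cov_le[OF assms(1) fC A(1)] A(2) assms(2) by (metis of_nat_le_iff)
  also have "\<dots> = real q ^ cc X * (real q - 1) ^ (card X - cc X)" using q2 by (simp add: of_nat_diff)
  also have "\<dots> = real q ^ card X * om X"
  proof -
    have "real q ^ card X = real q ^ cc X * real q ^ (card X - cc X)" using le by (simp add: power_add[symmetric])
    then show ?thesis unfolding om_def rank_def x_def' using q2 by (simp add: power_divide)
  qed
  finally show ?thesis .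
qed

text \<open>The denominator is the number of colorings of a spanning tree of \<open>D\<close>. The
  quotient therefore isolates what \<open>D\<close> saves over the forest bound of
  \<open>P_rank_le\<close>.\<close>

lemma P_component_le:
  assumes "finite X" "card C = q" "\<not> col X m"
  shows "\<exists>D. D \<subseteq> X \<and> conn D \<and> \<not> col D m \<and>
    real (P X C) \<le> real (P D C) / (real q * (real q - 1) ^ (card D - 1)) * (real q ^ card X * om X)"
proof -
  have fC: "finite C" using assms q2 card.infinite by force
  obtain D where D: "D \<subseteq> X" "conn D" "\<not> col D m" "1 \<le> cc X" "card D + (cc X - 1) \<le> card X"
     "P X C \<le> P D C * card C ^ (cc X - 1) * (card C - 1) ^ (card X - card D - (cc X - 1))"
    using P_component[OF assms(1) fC assms(3)] by blast
  have le: "cc X \<le> card X" by (rule cc_le_card)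
  have fD: "finite D" using D assms finite_subset by blast
  have D1: "1 \<le> card D" using conn_nonempty[OF D(2)] fD by (simp add: Suc_le_eq card_gt_0_iff)
  have "real (P X C) \<le> real (P D C * q ^ (cc X - 1) * (q - 1) ^ (card X - card D - (cc X - 1)))"
    using D(6) assms(2) by (metis of_nat_le_iff)
  also have "\<dots> = real (P D C) * (real q ^ (cc X - 1) * (real q - 1) ^ (card X - card D - (cc X - 1)))"
    using q2 by (simp add: of_nat_diff)
  also have "real q ^ (cc X - 1) * (real q - 1) ^ (card X - card D - (cc X - 1)) =
      real q ^ card X * om X / (real q * (real q - 1) ^ (card D - 1))"
  proof -
    have e1: "real q ^ card X = real q ^ cc X * real q ^ (card X - cc X)" using le by (simp add: power_add[symmetric])
    have "real q ^ card X * om X = real q ^ cc X * (real q - 1) ^ (card X - cc X)"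
      unfolding om_def rank_def x_def' e1 using q2 by (simp add: power_divide)
    moreover have "real q ^ cc X = real q * real q ^ (cc X - 1)" using D(4) by (metis Suc_diff_1 le_simps(3) power_Suc One_nat_def)
    moreover have "(real q - 1) ^ (card X - cc X) = (real q - 1) ^ (card D - 1) * (real q - 1) ^ (card X - card D - (cc X - 1))"
    proof -
      have "card X - cc X = (card D - 1) + (card X - card D - (cc X - 1))" using D D1 by linarith
      then show ?thesis by (metis power_add)
    qed
    ultimately show ?thesis using q2 by simp
  qed
  finally show ?thesis using D by (intro exI[of _ D]) (simp add: field_simps)
qed

text \<open>Since \<open>card (V - {v} - I) + card I = card V - 1\<close>, taking out a common power
  of \<open>q\<close> leaves the weight \<open>r ^ card I\<close>.\<close>

lemma sum_class_eq:
  assumes "finite V" "v \<in> V" "card C = Suc q"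
  shows "(\<Sum>i\<in>C. \<Sum>I | I \<subseteq> V - {v} - Nb V {v} \<and> indep I. k * (real q ^ card (V - {v} - I) * om (V - {v} - I)))
    = (real q + 1) * k * real q ^ (card V - 1) * Ph (V - {v}) (Nb V {v}) {}"
proof -
  let ?S = "V - {v}"
  have "real q ^ card (?S - I) = real q ^ (card V - 1) * r ^ card I" if "I \<subseteq> ?S - Nb V {v}" for I
  proof -
    have I: "I \<subseteq> ?S" using that by blast
    have fS: "finite ?S" using assms(1) by simp
    have fI: "finite I" "card I \<le> card ?S" using I fS finite_subset[of I ?S] card_mono[of ?S I] by blast+
    have "card (?S - I) = card ?S - card I" using card_Diff_subset[OF fI(1) I] .
    moreover have "card ?S = card V - 1" using assms by simp
    ultimately have "card V - 1 = card (?S - I) + card I" using fI by simp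
    then have "real q ^ (card V - 1) = real q ^ card (?S - I) * real q ^ card I" by (simp add: power_add)
    then show ?thesis unfolding r_def using q2 by (simp add: power_divide)
  qed
  then have "(\<Sum>I | I \<subseteq> ?S - Nb V {v} \<and> indep I. k * (real q ^ card (?S - I) * om (?S - I)))
     = k * real q ^ (card V - 1) * Ph ?S (Nb V {v}) {}"
    unfolding Ph_def sum_distrib_left by (intro sum.cong) auto
  then show ?thesis using assms by (simp add: algebra_simps)
qed

lemma P_class_le:
  assumes "finite V" "v \<in> V" "card C = Suc q" "0 \<le> k"
    and "\<And>I i. I \<subseteq> V - {v} - Nb V {v} \<Longrightarrow> indep I \<Longrightarrow> i \<in> C \<Longrightarrow>
      real (P (V - {v} - I) (C - {i})) \<le> k * (real q ^ card (V - {v} - I) * om (V - {v} - I))"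
  shows "real (P V C) \<le> (real q + 1) * k * real q ^ (card V - 1) * Ph (V - {v}) (Nb V {v}) {}"
proof -
  have fC: "finite C" using assms card.infinite by force
  have "real (P V C) \<le> (\<Sum>i\<in>C. \<Sum>I | I \<subseteq> V - {v} - Nb V {v} \<and> indep I. real (P (V - {v} - I) (C - {i})))"
    using P_color_class[OF assms(1,2) fC] by (metis (no_types, lifting) of_nat_le_iff of_nat_sum sum.cong)
  also have "\<dots> \<le> (\<Sum>i\<in>C. \<Sum>I | I \<subseteq> V - {v} - Nb V {v} \<and> indep I. k * (real q ^ card (V - {v} - I) * om (V - {v} - I)))"
    using assms(5) by (intro sum_mono) auto
  finally show ?thesis using sum_class_eq[OF assms(1-3)] by simp
qed

lemma P_class_less:
  assumes "finite V" "v \<in> V" "card C = Suc q" "0 \<le> k"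
    and "\<And>I i. I \<subseteq> V - {v} - Nb V {v} \<Longrightarrow> indep I \<Longrightarrow> i \<in> C \<Longrightarrow>
      real (P (V - {v} - I) (C - {i})) < k * (real q ^ card (V - {v} - I) * om (V - {v} - I))"
  shows "real (P V C) < (real q + 1) * k * real q ^ (card V - 1) * Ph (V - {v}) (Nb V {v}) {}"
proof -
  have fC: "finite C" using assms card.infinite by force
  have neC: "C \<noteq> {}" using assms by auto
  have "{} \<in> {I. I \<subseteq> V - {v} - Nb V {v} \<and> indep I}" unfolding indep_def by blast
  then have ne: "{I. I \<subseteq> V - {v} - Nb V {v} \<and> indep I} \<noteq> {}" by blast
  have "real (P V C) \<le> (\<Sum>i\<in>C. \<Sum>I | I \<subseteq> V - {v} - Nb V {v} \<and> indep I. real (P (V - {v} - I) (C - {i})))"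
    using P_color_class[OF assms(1,2) fC] by (metis (no_types, lifting) of_nat_le_iff of_nat_sum sum.cong)
  also have "\<dots> < (\<Sum>i\<in>C. \<Sum>I | I \<subseteq> V - {v} - Nb V {v} \<and> indep I. k * (real q ^ card (V - {v} - I) * om (V - {v} - I)))"
    using assms(5) by (intro sum_strict_mono fC neC ne fin_ind) (use assms(1) in auto)
  finally show ?thesis using sum_class_eq[OF assms(1-3)] by simp
qed

end

section \<open>Cuts of two vertices\<close>

definition add_edge :: "('a \<Rightarrow> 'a \<Rightarrow> bool) \<Rightarrow> 'a \<Rightarrow> 'a \<Rightarrow> 'a \<Rightarrow> 'a \<Rightarrow> bool" where
  "add_edge E a b = (\<lambda>u v. E u v \<or> u = a \<and> v = b \<or> u = b \<and> v = a)"

text \<open>The vertex \<open>b\<close> is merged into \<open>a\<close>; it has to be removed from the vertex set as well.\<close>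

definition merge :: "('a \<Rightarrow> 'a \<Rightarrow> bool) \<Rightarrow> 'a \<Rightarrow> 'a \<Rightarrow> 'a \<Rightarrow> 'a \<Rightarrow> bool" where
  "merge E a b = (\<lambda>u v. E u v \<or> u = a \<and> E b v \<or> v = a \<and> E b u)"

context ugraph
begin

lemma ugraph_add_edge: "a \<noteq> b \<Longrightarrow> ugraph (add_edge E a b)"
  by unfold_locales (auto simp: add_edge_def E_irr dest: E_sym)

lemma ugraph_merge: "\<not> E a b \<Longrightarrow> ugraph (merge E a b)"
  by unfold_locales (auto simp: merge_def E_irr dest: E_sym)

lemma P_merge:
  assumes "finite S" "finite C" "a \<in> S" "b \<in> S" "a \<noteq> b" "\<not> E a b"
  shows "card {c \<in> cl S C. c a = c b} \<le> ugraph.P (merge E a b) (S - {b}) C"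
proof -
  interpret m: ugraph "merge E a b" by (rule ugraph_merge[OF assms(6)])
  let ?F = "{c \<in> cl S C. c a = c b}"
  let ?h = "\<lambda>c. restrict c (S - {b})"
  have "inj_on ?h ?F"
  proof (rule inj_onI)
    fix c d assume cd: "c \<in> ?F" "d \<in> ?F" "?h c = ?h d"
    have ab: "c a = d a" using restrict_eqD[OF cd(3)] assms by blast
    show "c = d"
    proof (rule cl_eqI[of c S C d])
      fix v assume "v \<in> S"
      then show "c v = d v" using restrict_eqD[OF cd(3), of v] ab cd by (cases "v = b") auto
    qed (use cd in auto)
  qed
  moreover have "?h ` ?F \<subseteq> m.cl (S - {b}) C"
  proof clarify
    fix c assume c: "c \<in> cl S C" "c a = c b"
    have "c u \<noteq> c v" if uv: "u \<in> S - {b}" "v \<in> S - {b}" "merge E a b u v" for u v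
    proof -
      consider "E u v" | "u = a" "E b v" | "v = a" "E b u" using uv(3) unfolding merge_def by blast
      then show ?thesis
      proof cases
        case 1 then show ?thesis using cl_edge[OF c(1), of v u] uv by blast
      next
        case 2 then show ?thesis using cl_edge[OF c(1), of v b] uv c(2) assms by simp
      next
        case 3 then show ?thesis using cl_edge[OF c(1), of u b] uv c(2) assms by simp
      qed
    qed
    then show "?h c \<in> m.cl (S - {b}) C" unfolding m.cl_def using cl_val[OF c(1)] by (auto simp: PiE_iff)
  qed
  ultimately show ?thesis
    unfolding m.P_def using assms m.finite_cl by (intro card_inj_on_le) auto
qed

lemma merge_col:
  assumes "a \<in> S" "a \<noteq> b" "\<not> E a b" "ugraph.col (merge E a b) (S - {b}) m"
  shows "\<exists>c::'a \<Rightarrow> nat. (\<forall>v\<in>S. c v < m) \<and> (\<forall>u\<in>S. \<forall>v\<in>S. E u v \<longrightarrow> c u \<noteq> c v) \<and> c a = c b"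
proof -
  interpret m: ugraph "merge E a b" by (rule ugraph_merge[OF assms(3)])
  obtain c :: "'a \<Rightarrow> nat" where c: "\<forall>v\<in>S - {b}. c v < m"
    "\<And>u v. u \<in> S - {b} \<Longrightarrow> v \<in> S - {b} \<Longrightarrow> merge E a b u v \<Longrightarrow> c u \<noteq> c v"
    using assms(4) unfolding m.col_def by blast
  let ?d = "c(b := c a)"
  have "?d u \<noteq> ?d v" if uv: "u \<in> S" "v \<in> S" "E u v" for u v
  proof -
    consider "u = b" "v \<noteq> b" | "v = b" "u \<noteq> b" | "u \<noteq> b" "v \<noteq> b" using uv E_irr by blast
    then show ?thesis
    proof cases
      case 1 then show ?thesis using c(2)[of a v] uv assms by (simp add: merge_def)
    next
      case 2 then show ?thesis using c(2)[of u a] uv assms E_sym[OF uv(3)] by (simp add: merge_def)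
    next
      case 3 then show ?thesis using c(2)[of u v] uv by (simp add: merge_def)
    qed
  qed
  moreover have "\<forall>v\<in>S. ?d v < m" using c(1) assms by auto
  ultimately show ?thesis using assms(2) by (intro exI[of _ ?d]) auto
qed

text \<open>Renaming colors shows that every ordered pair of distinct colors occurs equally often on
  \<open>a\<close> and \<open>b\<close>, and there are \<open>card C * (card C - 1)\<close> such
  pairs.\<close>

lemma card_two_values:
  assumes "finite S" "finite C" "a \<in> S" "b \<in> S" "i \<in> C" "j \<in> C" "i \<noteq> j"
  shows "card C * (card C - 1) * card {g \<in> cl S C. g a = i \<and> g b = j} \<le> card {g \<in> cl S C. g a \<noteq> g b}"
proof -
  define G where "G p = {g \<in> cl S C. g a = fst p \<and> g b = snd p}" for p
  let ?D = "SIGMA s:C. C - {s}"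
  have fin: "finite (G p)" for p unfolding G_def using finite_cl[OF assms(1,2)] by simp
  have le: "card (G (i,j)) \<le> card (G p)" if p: "p \<in> ?D" for p
  proof -
    obtain s t where st: "p = (s,t)" "s \<in> C" "t \<in> C" "s \<noteq> t" using p by auto
    obtain \<pi> where pi: "bij \<pi>" "\<pi> ` C = C" "\<pi> i = s" "\<pi> j = t"
      using ex_permutation_pair[of i C j s t] assms st by auto
    have inj: "\<pi> m = \<pi> n \<longleftrightarrow> m = n" for m n using pi(1) by (metis bij_pointE)
    let ?h = "\<lambda>g. restrict (\<pi> \<circ> g) S"
    have "inj_on ?h (G (i,j))"
    proof (rule inj_onI)
      fix c d assume cd: "c \<in> G (i,j)" "d \<in> G (i,j)" "?h c = ?h d"
      show "c = d"
      proof (rule cl_eqI[of c S C d])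
        fix v assume "v \<in> S"
        then have "(\<pi> \<circ> c) v = (\<pi> \<circ> d) v" using restrict_eqD[OF cd(3)] by blast
        then show "c v = d v" using inj by simp
      qed (use cd in \<open>auto simp: G_def\<close>)
    qed
    moreover have "?h ` G (i,j) \<subseteq> G p"
    proof clarify
      fix c assume c: "c \<in> G (i,j)"
      then have c': "c \<in> cl S C" "c a = i" "c b = j" unfolding G_def by auto
      have "\<forall>v\<in>S. \<pi> (c v) \<in> C" using cl_val[OF c'(1)] pi(2) by blast
      moreover have "\<forall>u\<in>S. \<forall>v\<in>S. E u v \<longrightarrow> \<pi> (c u) \<noteq> \<pi> (c v)" using cl_edge[OF c'(1)] inj by metis
      ultimately have "?h c \<in> cl S C" unfolding cl_def by (auto simp: PiE_iff)
      then show "?h c \<in> G p" unfolding G_def using c' pi st assms by simp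
    qed
    ultimately show ?thesis using fin by (rule card_inj_on_le)
  qed
  have fD: "finite ?D" using assms by blast
  have "card ?D = card C * (card C - 1)" using assms by (simp add: card_SigmaI card_Diff_singleton)
  then have "card C * (card C - 1) * card (G (i,j)) = (\<Sum>p\<in>?D. card (G (i,j)))" by simp
  also have "\<dots> \<le> (\<Sum>p\<in>?D. card (G p))" by (rule sum_mono) (rule le)
  also have "\<dots> = card (\<Union>p\<in>?D. G p)"
    by (rule card_UN_disjoint[symmetric]) (use fD fin in \<open>auto simp: G_def\<close>)
  also have "\<dots> \<le> card {g \<in> cl S C. g a \<noteq> g b}"
    by (rule card_mono) (use finite_cl[OF assms(1,2)] in \<open>auto simp: G_def\<close>)
  finally show ?thesis unfolding G_def by simp
qed

text \<open>\<open>F\<close> consists of the colorings of a spanning tree with bipartition \<open>\<pi>\<close>. Two vertices on the same side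
  agree in more than a third of them, so an edge within a side excludes more than a third of \<open>F\<close>.\<close>

lemma P_three_less:
  assumes "finite D" "conn D" "\<not> col D 2" "card C = 3"
  shows "P D C < 2 ^ card D"
proof -
  have fC: "finite C" using assms(4) card.infinite by force
  \<comment> \<open>The size is \<open>3 * 2 ^ (card X - 1)\<close>, written without subtraction.
    Agreement of two vertices is compared with the frequency 1/3.\<close>
  define good where "good X F \<pi> \<longleftrightarrow> F \<subseteq> (X \<rightarrow>\<^sub>E C) \<and> cl X C \<subseteq> F \<and> 2 * card F = 3 * 2 ^ card X \<and>
     (\<forall>y\<in>X. \<forall>z\<in>X. if \<pi> y = \<pi> z then card F < 3 * card {c \<in> F. c y = c z}
                         else 3 * card {c \<in> F. c y = c z} < card F)" for X F and \<pi> :: "'a \<Rightarrow> bool"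
  have step: "\<exists>F' \<pi>'. good (insert w X) F' \<pi>'"
    if X: "finite X" "w \<notin> X" "p \<in> X" "E p w" "good X F \<pi>" for X F \<pi> w p
  proof -
    have F: "F \<subseteq> (X \<rightarrow>\<^sub>E C)" "cl X C \<subseteq> F" "2 * card F = 3 * 2 ^ card X"
      and Fg: "\<And>y z. y \<in> X \<Longrightarrow> z \<in> X \<Longrightarrow> if \<pi> y = \<pi> z then card F < 3 * card {c \<in> F. c y = c z}
                         else 3 * card {c \<in> F. c y = c z} < card F"
      using X(5) unfolding good_def by auto
    have fF: "finite F" using F(1) X(1) fC finite_PiE finite_subset by metis
    have fw: "f w = undefined" if "f \<in> F" for f
      using that F(1) X(2) by (auto simp: PiE_iff extensional_def)
    let ?h = "\<lambda>(f,i). f(w := i)"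
    have inj: "inj_on ?h (SIGMA f:F. C)"
    proof (rule inj_onI, clarify)
      fix f i g j assume fg: "f \<in> F" "g \<in> F" "f(w := i) = g(w := j)"
      have "f w = g w" using fw[OF fg(1)] fw[OF fg(2)] by metis
      then have "f = g" using fg(3) by (metis fun_upd_triv fun_upd_upd)
      moreover have "i = j" using fg(3) by (metis fun_upd_same)
      ultimately show "f = g \<and> i = j" by blast
    qed
    define Q where "Q H = (SIGMA f:H. C - {f p})" for H
    have vC: "f v \<in> C" if "f \<in> F" "v \<in> X" for f v using that F(1) by (auto simp: PiE_iff)
    have cQ: "card (?h ` Q H) = 2 * card H" if "H \<subseteq> F" for H
    proof -
      have "card (?h ` Q H) = card (Q H)"
        by (rule card_image, rule inj_on_subset[OF inj]) (use that in \<open>auto simp: Q_def\<close>)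
      also have "\<dots> = (\<Sum>f\<in>H. card (C - {f p}))"
        unfolding Q_def using that fF finite_subset fC by (intro card_SigmaI) auto
      also have "\<dots> = (\<Sum>f\<in>H. 2)"
        by (rule sum.cong) (use vC X that assms(4) in \<open>auto simp: card_Diff_singleton\<close>)
      finally show ?thesis by simp
    qed
    define F' where "F' = ?h ` Q F"
    let ?\<pi> = "\<pi>(w := \<not> \<pi> p)"
    have cF': "card F' = 2 * card F" unfolding F'_def by (rule cQ) simp
    have s1: "card {c \<in> F'. c y = c z} = 2 * card {c \<in> F. c y = c z}" if yz: "y \<in> X" "z \<in> X" for y z
    proof -
      have "y \<noteq> w" "z \<noteq> w" using yz X(2) by auto
      then have "{c \<in> F'. c y = c z} = ?h ` Q {c \<in> F. c y = c z}" unfolding F'_def Q_def by force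
      then show ?thesis using cQ[of "{c \<in> F. c y = c z}"] by simp
    qed
    have s2: "card {c \<in> F'. c w = c z} = card F - card {c \<in> F. c p = c z}" if z: "z \<in> X" for z
    proof -
      let ?k = "\<lambda>f. f(w := f z)"
      let ?H = "F - {c \<in> F. c p = c z}"
      have zw: "z \<noteq> w" "p \<noteq> w" using z X by auto
      have "{c \<in> F'. c w = c z} = ?k ` ?H"
      proof (intro set_eqI iffI)
        fix c assume "c \<in> {c \<in> F'. c w = c z}"
        then have c: "c \<in> F'" "c w = c z" by simp_all
        then obtain t where t: "t \<in> Q F" "c = ?h t" unfolding F'_def by blast
        obtain f i where "t = (f, i)" by (cases t)
        then have fi: "f \<in> F" "i \<in> C - {f p}" "c = f(w := i)" "c w = c z" using t c unfolding Q_def by auto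
        then have "i = f z" using zw by simp
        then show "c \<in> ?k ` ?H" using fi by auto
      next
        fix c assume "c \<in> ?k ` ?H"
        then obtain f where f: "f \<in> F" "f p \<noteq> f z" "c = f(w := f z)" by auto
        then have "(f, f z) \<in> Q F" unfolding Q_def using vC[OF f(1) z] by auto
        then have "?h (f, f z) \<in> F'" unfolding F'_def by (rule imageI)
        then show "c \<in> {c \<in> F'. c w = c z}" using f zw by simp
      qed
      moreover have "inj_on ?k ?H"
      proof (rule inj_onI)
        fix f g assume fg: "f \<in> ?H" "g \<in> ?H" "?k f = ?k g"
        have "f \<in> F" "g \<in> F" using fg(1,2) by simp_all
        then have "f w = g w" using fw[of f] fw[of g] by metis
        then show "f = g" using fg(3) by (metis fun_upd_triv fun_upd_upd)
      qed
      ultimately have "card {c \<in> F'. c w = c z} = card ?H" by (simp add: card_image)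
      then show ?thesis using fF by (simp add: card_Diff_subset)
    qed
    have sw: "{c \<in> F'. c z = c w} = {c \<in> F'. c w = c z}" for z by auto
    have le: "card {c \<in> F. c p = c z} \<le> card F" for z using fF by (intro card_mono) auto
    have "good (insert w X) F' ?\<pi>" unfolding good_def
    proof (intro conjI ballI)
      show "F' \<subseteq> (insert w X \<rightarrow>\<^sub>E C)"
      proof
        fix c assume "c \<in> F'"
        then obtain t where t: "t \<in> Q F" "c = ?h t" unfolding F'_def by blast
        obtain f i where "t = (f, i)" by (cases t)
        then have fi: "f \<in> F" "i \<in> C" "c = f(w := i)" using t unfolding Q_def by auto
        have "f \<in> X \<rightarrow>\<^sub>E C" using fi(1) F(1) by blast
        then show "c \<in> insert w X \<rightarrow>\<^sub>E C" unfolding fi(3) using fi(2) by (auto simp: PiE_iff extensional_def)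
      qed
      show "cl (insert w X) C \<subseteq> F'"
      proof
        fix c assume c: "c \<in> cl (insert w X) C"
        have "restrict c X \<in> F" using cl_restrict[OF c, of X] F(2) by blast
        moreover have "c w \<in> C" "c w \<noteq> c p" using cl_val[OF c] cl_edge[OF c, of w p] X by auto
        ultimately have "(restrict c X, c w) \<in> Q F" unfolding Q_def using X(3) by simp
        then have "?h (restrict c X, c w) \<in> F'" unfolding F'_def by (rule imageI)
        moreover have "?h (restrict c X, c w) = c"
          using cl_ext[OF c] X(2) by (auto simp: fun_eq_iff restrict_def)
        ultimately show "c \<in> F'" by simp
      qed
      show "2 * card F' = 3 * 2 ^ card (insert w X)" using cF' F(3) X(1,2) by simp
      fix y z assume yz: "y \<in> insert w X" "z \<in> insert w X"
      have pos: "0 < card F" using F(3) by (cases "card F") auto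
      consider "y = w" "z = w" | "y = w" "z \<in> X" | "y \<in> X" "z = w" | "y \<in> X" "z \<in> X" using yz by blast
      then show "if ?\<pi> y = ?\<pi> z then card F' < 3 * card {c \<in> F'. c y = c z}
                 else 3 * card {c \<in> F'. c y = c z} < card F'"
      proof cases
        case 1 then show ?thesis using cF' pos by simp
      next
        case 2
        have zw: "z \<noteq> w" using 2 X by auto
        show ?thesis using Fg[OF X(3) 2(2)] s2[OF 2(2)] cF' 2 zw le[of z] by (auto split: if_splits)
      next
        case 3
        have zw: "y \<noteq> w" using 3 X by auto
        show ?thesis using Fg[OF X(3) 3(1)] s2[OF 3(1)] sw[of y] cF' 3 zw le[of y] by (auto split: if_splits)
      next
        case 4
        then have "y \<noteq> w" "z \<noteq> w" using X by auto
        then show ?thesis using Fg[OF 4] s1[OF 4] cF' by (auto split: if_splits)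
      qed
    qed
    then show ?thesis by blast
  qed
  have grow: "\<exists>F \<pi>. good D F \<pi>" if "cov D X" "\<exists>F \<pi>. good X F \<pi>" for X
    using that
  proof (induction "card (D - X)" arbitrary: X rule: less_induct)
    case less
    show ?case
    proof (cases "X = D")
      case True then show ?thesis using less by blast
    next
      case False
      have XD: "X \<subseteq> D" using cov_subset[OF less(2)] .
      obtain p w where pw: "p \<in> X" "w \<in> D" "w \<notin> X" "E p w" using cov_grow[OF less(2) False] by blast
      have "card (D - insert w X) < card (D - X)"
        by (rule psubset_card_mono) (use assms(1) pw in auto)
      moreover have "cov D (insert w X)" by (rule cov_mono[OF less(2)]) (use pw XD in auto)
      moreover have "\<exists>F \<pi>. good (insert w X) F \<pi>"
        using step[OF finite_subset[OF XD assms(1)] pw(3,1,4)] less(3) by blast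
      ultimately show ?thesis using less(1) by blast
    qed
  qed
  obtain a where a: "a \<in> D" "cov D {a}" using assms(2) unfolding conn_def by blast
  have "good {a} ({a} \<rightarrow>\<^sub>E C) (\<lambda>_. True)"
    unfolding good_def using assms(4) fC by (auto simp: card_PiE cl_def)
  then obtain F \<pi> where g: "good D F \<pi>" using grow[OF a(2)] by blast
  have "\<exists>u\<in>D. \<exists>v\<in>D. E u v \<and> \<pi> u = \<pi> v"
  proof (rule ccontr)
    assume n: "\<not> (\<exists>u\<in>D. \<exists>v\<in>D. E u v \<and> \<pi> u = \<pi> v)"
    have "col D 2" unfolding col_def
      by (rule exI[of _ "\<lambda>v. if \<pi> v then 1 else 0"]) (use n in auto)
    then show False using assms by blast
  qed
  then obtain u v where uv: "u \<in> D" "v \<in> D" "E u v" "\<pi> u = \<pi> v" by blast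
  have "F \<subseteq> (D \<rightarrow>\<^sub>E C)" "finite (D \<rightarrow>\<^sub>E C)" using g assms(1) fC unfolding good_def by (simp_all add: finite_PiE)
  then have fF: "finite F" by (rule finite_subset)
  have "if \<pi> u = \<pi> v then card F < 3 * card {c \<in> F. c u = c v} else 3 * card {c \<in> F. c u = c v} < card F"
    using g uv(1,2) unfolding good_def by simp
  then have "card F < 3 * card {c \<in> F. c u = c v}" using uv(4) by simp
  moreover have "cl D C \<subseteq> F - {c \<in> F. c u = c v}" using g cl_edge uv unfolding good_def by blast
  then have "P D C \<le> card F - card {c \<in> F. c u = c v}"
    unfolding P_def using fF card_mono[of "F - {c \<in> F. c u = c v}" "cl D C"] by (simp add: card_Diff_subset)
  moreover have "2 * card F = 3 * 2 ^ card D" using g unfolding good_def by blast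
  moreover have "card {c \<in> F. c u = c v} \<le> card F" using fF by (intro card_mono) auto
  ultimately show ?thesis by linarith
qed

end

context qgraph
begin

text \<open>Since \<open>V\<close> is critical, one side of the cut forces \<open>a\<close> and \<open>b\<close> to agree in every \<open>q\<close>-coloring and the
  other side forces them to differ. The colorings with \<open>c a = c b\<close> are counted on \<open>Y\<close> with \<open>a\<close> and \<open>b\<close>
  merged, the others on \<open>X\<close> with the edge \<open>ab\<close> added; both graphs are smaller and not \<open>q\<close>-colorable.\<close>

lemma P_less_two_cut_side:
  assumes q3: "3 \<le> q" and V: "crit V q" and ab: "a \<in> V" "b \<in> V" "a \<noteq> b" "\<not> E a b"
    and XY: "X \<union> Y = V - {a,b}" "X \<inter> Y = {}" "X \<noteq> {}" "Y \<noteq> {}" "\<forall>u\<in>X. \<forall>v\<in>Y. \<not> E u v"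
    and C: "card C = Suc q"
    and nodiff: "\<not> (\<exists>c::'a \<Rightarrow> nat. (\<forall>v\<in>X \<union> {a,b}. c v < q) \<and>
          (\<forall>u\<in>X \<union> {a,b}. \<forall>v\<in>X \<union> {a,b}. E u v \<longrightarrow> c u \<noteq> c v) \<and> c a \<noteq> c b)"
    and nosame: "\<not> (\<exists>c::'a \<Rightarrow> nat. (\<forall>v\<in>Y \<union> {a,b}. c v < q) \<and>
          (\<forall>u\<in>Y \<union> {a,b}. \<forall>v\<in>Y \<union> {a,b}. E u v \<longrightarrow> c u \<noteq> c v) \<and> c a = c b)"
    and IH: "\<And>E' (V'::'a set). ugraph E' \<Longrightarrow> finite V' \<Longrightarrow> card V' < card V \<Longrightarrow> ugraph.conn E' V' \<Longrightarrow>
          \<not> ugraph.col E' V' q \<Longrightarrow> ugraph.P E' V' C \<le> fact (Suc q) * q ^ (card V' - Suc q)"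
  shows "P V C < fact (Suc q) * q ^ (card V - Suc q)"
proof -
  have fV: "finite V" using V unfolding crit_def by blast
  have fC: "finite C" using C card.infinite by force
  have "finite (X \<union> Y)" using XY(1) fV by simp
  then have fXY: "finite X" "finite Y" by simp_all
  have cV: "conn V" using crit_conn[OF V] q3 by simp
  have abn: "a \<notin> X" "b \<notin> X" "a \<notin> Y" "b \<notin> Y" using XY(1) by blast+
  have Veq: "V = X \<union> Y \<union> {a,b}" using XY(1) ab by blast
  have n: "card V = card X + card Y + 2"
    unfolding Veq using fXY XY(2) abn ab by (simp add: card_Un_disjoint)
  let ?X = "X \<union> {a,b}" and ?Y = "Y \<union> {a,b}"
  have cX: "card ?X = card X + 2" "card ?Y = card Y + 2" using fXY abn ab by auto
  interpret m: ugraph "merge E a b" by (rule ugraph_merge[OF ab(4)])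
  interpret e: qgraph "add_edge E a b" q
    by (intro qgraph.intro qgraph_axioms.intro ugraph_add_edge ab(3) q2)
  have YE: "u \<in> ?Y" if "u \<in> V" "v \<in> Y" "E u v" for u v using that XY(5) unfolding Veq by blast
  have mY: "m.conn (?Y - {b})"
  proof (rule m.conn_root[of _ a], rule m.covI)
    fix Z assume Z: "{a} \<subseteq> Z" "Z \<subset> ?Y - {b}"
    then have "Z \<union> X \<union> {b} \<subset> V" "Z \<union> X \<union> {b} \<noteq> {}" using abn XY(2) ab unfolding Veq by auto
    then obtain u v where uv: "u \<in> Z \<union> X \<union> {b}" "v \<in> V" "v \<notin> Z \<union> X \<union> {b}" "E u v"
      using conn_edge[OF cV] by meson
    have vY: "v \<in> Y" using uv Z unfolding Veq by auto
    then have "u \<notin> X" using XY(5) uv by blast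
    then have "u \<in> Z \<or> u = b" using uv by blast
    then show "\<exists>u\<in>Z. \<exists>v\<in>?Y - {b} - Z. merge E a b u v"
    proof
      assume "u \<in> Z" then show ?thesis using uv vY abn by (intro bexI[of _ u] bexI[of _ v]) (auto simp: merge_def)
    next
      assume "u = b" then show ?thesis using uv vY abn Z by (intro bexI[of _ a] bexI[of _ v]) (auto simp: merge_def)
    qed
  qed (use abn ab in auto)
  have mcol: "\<not> m.col (?Y - {b}) q"
  proof
    assume "m.col (?Y - {b}) q"
    then have "\<exists>c::'a \<Rightarrow> nat. (\<forall>v\<in>?Y. c v < q) \<and> (\<forall>u\<in>?Y. \<forall>v\<in>?Y. E u v \<longrightarrow> c u \<noteq> c v) \<and> c a = c b"
      by (intro merge_col) (use ab in auto)
    then show False using nosame by simp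
  qed
  have cYb: "card (?Y - {b}) = card Y + 1" using cX ab fXY by simp
  have "card (?Y - {b}) < card V" using cYb n by simp
  then have mP: "m.P (?Y - {b}) C \<le> fact (Suc q) * q ^ (card Y + 1 - Suc q)"
    using IH[OF m.ugraph_axioms _ _ mY mcol] fXY unfolding cYb by blast
  have Yge: "q < card Y + 1" using m.ncol_card[OF _ mcol] fXY cYb by simp
  have same: "card {c \<in> cl V C. c a = c b} \<le> fact (Suc q) * q ^ (card Y + 1 - Suc q) * q ^ card X"
  proof -
    let ?F = "{c \<in> cl ?Y C. c a = c b}"
    have YV: "?Y \<subseteq> V" unfolding Veq by auto
    have "{c \<in> cl V C. c a = c b} \<subseteq> {c \<in> cl V C. restrict c ?Y \<in> ?F}"
      using cl_restrict[OF _ YV] by auto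
    then have "card {c \<in> cl V C. c a = c b} \<le> card {c \<in> cl V C. restrict c ?Y \<in> ?F}"
      by (intro card_mono) (use finite_cl[OF fV fC] in auto)
    also have "\<dots> \<le> card ?F * (card C - 1) ^ card (V - ?Y)"
    proof (rule card_extend[OF fV fC])
      show "cov V ?Y" by (rule conn_cov[OF cV YV]) simp
    qed auto
    also have "V - ?Y = X" using abn XY(2) unfolding Veq by auto
    also have "card C - 1 = q" using C by simp
    also have "card ?F * q ^ card X \<le> fact (Suc q) * q ^ (card Y + 1 - Suc q) * q ^ card X"
    proof (rule mult_le_mono1)
      have "card ?F \<le> m.P (?Y - {b}) C" by (rule P_merge) (use fXY fC ab in auto)
      then show "card ?F \<le> fact (Suc q) * q ^ (card Y + 1 - Suc q)" using mP by linarith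
    qed
    finally show ?thesis .
  qed
  have ecl: "{c \<in> cl S C. c a \<noteq> c b} = e.cl S C" if "a \<in> S" "b \<in> S" for S
    unfolding cl_def e.cl_def using that by (auto simp: add_edge_def E_irr)
  have eX: "e.conn ?X"
  proof (rule e.conn_root[of _ a], rule e.covI)
    fix Z assume Z: "{a} \<subseteq> Z" "Z \<subset> ?X"
    show "\<exists>u\<in>Z. \<exists>v\<in>?X - Z. add_edge E a b u v"
    proof (cases "b \<in> Z")
      case False then show ?thesis using Z by (intro bexI[of _ a] bexI[of _ b]) (auto simp: add_edge_def)
    next
      case True
      have "Z \<union> Y \<subset> V" "Z \<union> Y \<noteq> {}" using Z True XY(2) abn unfolding Veq by auto
      then obtain u v where uv: "u \<in> Z \<union> Y" "v \<in> V" "v \<notin> Z \<union> Y" "E u v" using conn_edge[OF cV] by meson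
      have "v \<in> X" using uv Z True unfolding Veq by auto
      then have "u \<in> Z" using uv XY(5) E_sym by blast
      then show ?thesis using uv \<open>v \<in> X\<close> by (intro bexI[of _ u] bexI[of _ v]) (auto simp: add_edge_def)
    qed
  qed auto
  have ecol: "\<not> e.col ?X q"
  proof
    assume "e.col ?X q"
    then obtain c :: "'a \<Rightarrow> nat" where c: "\<forall>v\<in>?X. c v < q" "\<forall>u\<in>?X. \<forall>v\<in>?X. add_edge E a b u v \<longrightarrow> c u \<noteq> c v"
      unfolding e.col_def by blast
    have "c a \<noteq> c b" using c(2) by (auto simp: add_edge_def)
    moreover have "\<forall>u\<in>?X. \<forall>v\<in>?X. E u v \<longrightarrow> c u \<noteq> c v" using c(2) unfolding add_edge_def by blast
    ultimately show False using nodiff c(1) by blast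
  qed
  have "card ?X < card V" using cX n XY(4) fXY by (simp add: card_gt_0_iff)
  then have eP: "e.P ?X C \<le> fact (Suc q) * q ^ (card X + 2 - Suc q)"
    using IH[OF e.ugraph_axioms _ _ eX ecol] fXY unfolding cX(1) by blast
  have Xge: "q < card X + 2" using e.ncol_card[OF _ ecol] fXY cX by simp
  \<comment> \<open>By symmetry a fixed pair of distinct colors on \<open>a\<close> and
    \<open>b\<close> receives at most the share \<open>1 / (q * (q + 1))\<close> of the colorings of
    this side with the edge \<open>ab\<close>. Those are estimated by the color class of an
    arbitrary \<open>v\<close> in \<open>Y\<close> and the forest bound; the exponent 3 comes from
    the degree of \<open>v\<close>, which is at least \<open>q\<close>.\<close>
  have ext: "real (card {g \<in> cl ?Y C. g a = i \<and> g b = j}) \<le> real q ^ card Y * (x ^ 3 + r)"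
    if ij: "i \<in> C" "j \<in> C" "i \<noteq> j" for i j
  proof -
    obtain v where v: "v \<in> Y" using XY(4) by blast
    let ?S = "?Y - {v}" and ?A = "e.Nb ?Y {v}"
    have vab: "v \<noteq> a" "v \<noteq> b" "v \<in> V" using v abn unfolding Veq by auto
    \<comment> \<open>In the connected set \<open>V - {v}\<close> the two vertices may be joined
      through \<open>X\<close> only; the edge \<open>ab\<close> replaces this connection.\<close>
    have eS: "e.conn ?S"
    proof (rule e.conn_root[of _ a], rule e.covI)
      fix Z assume Z: "{a} \<subseteq> Z" "Z \<subset> ?S"
      show "\<exists>u\<in>Z. \<exists>w\<in>?S - Z. add_edge E a b u w"
      proof (cases "b \<in> Z")
        case False then show ?thesis using Z vab by (intro bexI[of _ a] bexI[of _ b]) (auto simp: add_edge_def)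
      next
        case True
        have sub: "Z \<union> X \<subset> V - {v}" "Z \<union> X \<noteq> {}" using Z True XY(2) abn v unfolding Veq by auto
        then have "conn (V - {v})" using crit_conn_Diff1[OF V vab(3)] by blast
        from conn_edge[OF this sub] obtain u w
          where uw: "u \<in> Z \<union> X" "w \<in> V - {v}" "w \<notin> Z \<union> X" "E u w" by blast
        have wY: "w \<in> Y" using uw Z True unfolding Veq by auto
        then have "u \<in> Z" using uw XY(5) by blast
        then show ?thesis using uw wY by (intro bexI[of _ u] bexI[of _ w]) (auto simp: add_edge_def)
      qed
    qed (use vab in auto)
    have "Nb V {v} \<subseteq> ?A" using YE[OF _ v] E_sym unfolding Nb_def e.Nb_def by (auto simp: add_edge_def)
    then have A3: "3 \<le> card ?A"
      using crit_degree[OF V vab(3)] q3 card_mono[of ?A "Nb V {v}"] fXY by (auto simp: e.Nb_def)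
    have AS: "?A \<subseteq> ?S" unfolding e.Nb_def using e.E_irr by auto
    have "?A \<noteq> {}" using A3 by auto
    then obtain u where u: "u \<in> ?A" by blast
    have "e.Ph ?S ?A {} \<le> e.x ^ (card {u} - 1) * (e.x ^ Suc (card (?A - {u})) + e.r)"
      by (rule e.Ph_conn_bound) (use fXY eS e.conn_singleton u AS in auto)
    moreover have "Suc (card (?A - {u})) = card ?A"
      by (rule card_Suc_Diff1) (use u fXY in \<open>auto simp: e.Nb_def\<close>)
    moreover have "e.x ^ (card {u} - 1) = 1" by simp
    ultimately have "e.Ph ?S ?A {} \<le> e.x ^ card ?A + e.r" by (simp only: mult_1_left)
    also have "\<dots> \<le> e.x ^ 3 + e.r" using e.x_pow_anti[OF A3] by simp
    finally have Ph: "e.Ph ?S ?A {} \<le> x ^ 3 + r" unfolding e.x_def e.r_def x_def r_def .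
    have "real (e.P ?Y C) \<le> (real q + 1) * 1 * real q ^ (card ?Y - 1) * e.Ph ?S ?A {}"
    proof (rule e.P_class_le)
      fix I i assume "i \<in> C"
      then have "card (C - {i}) = q" using C fC by simp
      then show "real (e.P (?Y - {v} - I) (C - {i})) \<le> 1 * (real q ^ card (?Y - {v} - I) * e.om (?Y - {v} - I))"
        using e.P_rank_le[of "?Y - {v} - I" "C - {i}"] fXY by simp
    qed (use fXY v C in auto)
    also have "\<dots> \<le> (real q + 1) * 1 * real q ^ (card ?Y - 1) * (x ^ 3 + r)"
      using Ph by (intro mult_left_mono) auto
    finally have 1: "real (e.P ?Y C) \<le> (real q + 1) * (real q * (real q ^ card Y * (x ^ 3 + r)))"
      using cX by simp
    have "card C * (card C - 1) * card {g \<in> cl ?Y C. g a = i \<and> g b = j} \<le> e.P ?Y C"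
      using card_two_values[of ?Y C a b i j] fXY fC ij ecl[of ?Y] unfolding e.P_def by simp
    then have "real (Suc q * q * card {g \<in> cl ?Y C. g a = i \<and> g b = j}) \<le> real (e.P ?Y C)"
      using C by (simp only: of_nat_le_iff) simp
    then have "(real q + 1) * (real q * real (card {g \<in> cl ?Y C. g a = i \<and> g b = j})) \<le> real (e.P ?Y C)"
      by (simp add: algebra_simps)
    with 1 have "(real q + 1) * (real q * real (card {g \<in> cl ?Y C. g a = i \<and> g b = j}))
       \<le> (real q + 1) * (real q * (real q ^ card Y * (x ^ 3 + r)))" by linarith
    then show ?thesis using q3 by (simp add: mult_le_cancel_left_pos)
  qed
  have diff: "real (card {c \<in> cl V C. c a \<noteq> c b}) \<le>
      real (fact (Suc q) * q ^ (card X + 2 - Suc q)) * (real q ^ card Y * (x ^ 3 + r))"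
  proof -
    let ?H = "{c \<in> cl ?X C. c a \<noteq> c b}"
    let ?J = "\<lambda>f. {g \<in> cl ?Y C. g a = f a \<and> g b = (f b::nat)}"
    let ?h = "\<lambda>c. (restrict c ?X, restrict c ?Y)"
    have fH: "finite ?H" "\<And>f. finite (?J f)" using finite_cl fXY fC by auto
    have sub: "?X \<subseteq> V" "?Y \<subseteq> V" unfolding Veq by auto
    have "inj_on ?h {c \<in> cl V C. c a \<noteq> c b}"
    proof (rule inj_onI)
      fix c d assume cd: "c \<in> {c \<in> cl V C. c a \<noteq> c b}" "d \<in> {c \<in> cl V C. c a \<noteq> c b}" "?h c = ?h d"
      show "c = d"
      proof (rule cl_eqI[of c V C d])
        fix v assume "v \<in> V"
        then have "v \<in> ?X \<or> v \<in> ?Y" unfolding Veq by blast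
        then show "c v = d v" using cd(3) restrict_eqD[of c ?X d v] restrict_eqD[of c ?Y d v] by auto
      qed (use cd in auto)
    qed
    moreover have "?h ` {c \<in> cl V C. c a \<noteq> c b} \<subseteq> (SIGMA f:?H. ?J f)"
      using cl_restrict[OF _ sub(1)] cl_restrict[OF _ sub(2)] by auto
    ultimately have "card {c \<in> cl V C. c a \<noteq> c b} \<le> card (SIGMA f:?H. ?J f)"
      using fH by (intro card_inj_on_le) auto
    also have "\<dots> = (\<Sum>f\<in>?H. card (?J f))" using fH by (simp add: card_SigmaI)
    finally have "real (card {c \<in> cl V C. c a \<noteq> c b}) \<le> (\<Sum>f\<in>?H. real (card (?J f)))"
      by (metis (no_types, lifting) of_nat_le_iff of_nat_sum sum.cong)
    also have "\<dots> \<le> (\<Sum>f\<in>?H. real q ^ card Y * (x ^ 3 + r))"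
      by (rule sum_mono, rule ext) (auto intro: cl_val)
    also have "\<dots> = real (card ?H) * (real q ^ card Y * (x ^ 3 + r))" by simp
    also have "\<dots> \<le> real (fact (Suc q) * q ^ (card X + 2 - Suc q)) * (real q ^ card Y * (x ^ 3 + r))"
    proof (rule mult_right_mono)
      show "real (card ?H) \<le> real (fact (Suc q) * q ^ (card X + 2 - Suc q))"
        using eP ecl[of ?X] unfolding e.P_def by (simp only: of_nat_le_iff) simp
    qed (use x_pos r_pos in auto)
    finally show ?thesis .
  qed
  let ?K = "real (fact (Suc q)) * real q ^ (card V - Suc q)"
  \<comment> \<open>The two kinds of colorings contribute the shares \<open>r\<close> and
    \<open>x ^ 3 + r\<close> of the bound, so this makes their sum less than
    \<open>r + x = 1\<close>. It amounts to \<open>x * (1 + x) > 1\<close>, which is 10/9 for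
    \<open>q = 3\<close> and would fail for \<open>q = 2\<close>.\<close>
  have "x ^ 3 + r < x"
  proof -
    have "x * (1 + x) > 1"
    proof -
      have "r \<le> 1/3" using q3 unfolding r_def by (auto simp: field_simps)
      then have "2/3 \<le> x" using xr by linarith
      then have "2/3 * (1 + 2/3) \<le> x * (1 + x)" by (intro mult_mono) auto
      then show ?thesis by simp
    qed
    then have "r * 1 < r * (x * (1 + x))" using r_pos by (intro mult_strict_left_mono)
    moreover have "x - x ^ 3 = r * (x * (1 + x))" unfolding x_def by (simp add: algebra_simps power3_eq_cube)
    ultimately show ?thesis by simp
  qed
  have "cl V C = {c \<in> cl V C. c a = c b} \<union> {c \<in> cl V C. c a \<noteq> c b}" by blast
  then have "P V C = card ({c \<in> cl V C. c a = c b} \<union> {c \<in> cl V C. c a \<noteq> c b})" unfolding P_def by (rule arg_cong)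
  also have "\<dots> \<le> card {c \<in> cl V C. c a = c b} + card {c \<in> cl V C. c a \<noteq> c b}" by (rule card_Un_le)
  finally have "real (P V C) \<le> real (card {c \<in> cl V C. c a = c b} + card {c \<in> cl V C. c a \<noteq> c b})"
    by (simp only: of_nat_le_iff)
  then have "real (P V C) \<le> real (card {c \<in> cl V C. c a = c b}) + real (card {c \<in> cl V C. c a \<noteq> c b})"
    by (simp only: of_nat_add)
  also have "real (card {c \<in> cl V C. c a = c b}) \<le> ?K * r"
  proof -
    \<comment> \<open>The vertex lost in merging lowers the exponent by one, hence the factor
      \<open>r\<close>.\<close>
    have e: "card V - Suc q = Suc (card Y + 1 - Suc q + card X)" using n Yge by simp
    have "real (card {c \<in> cl V C. c a = c b}) \<le> real (fact (Suc q) * q ^ (card Y + 1 - Suc q) * q ^ card X)"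
      using same by (simp only: of_nat_le_iff)
    also have "\<dots> = ?K * r" unfolding e r_def using q3 by (simp add: power_add)
    finally show ?thesis .
  qed
  also have "real (card {c \<in> cl V C. c a \<noteq> c b}) \<le> ?K * (x ^ 3 + r)"
  proof -
    have e: "card V - Suc q = (card X + 2 - Suc q) + card Y" using n Xge by simp
    show ?thesis using diff unfolding e by (simp add: power_add mult.assoc)
  qed
  also have "?K * r + ?K * (x ^ 3 + r) < ?K * r + ?K * x"
  proof (intro add_strict_left_mono mult_strict_left_mono \<open>x ^ 3 + r < x\<close>)
    show "0 < ?K" using q3 by (intro mult_pos_pos) (simp_all del: fact_Suc)
  qed
  also have "?K * r + ?K * x = ?K" using xr by (simp add: distrib_left[symmetric] add.commute)
  finally have "real (P V C) < real (fact (Suc q) * q ^ (card V - Suc q))" by simp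
  then show ?thesis by (simp only: of_nat_less_iff)
qed

text \<open>By criticality each side has a coloring with \<open>q\<close> colors, and no coloring of
  one side can be glued to one of the other. Hence each side has a fixed answer to whether
  \<open>a\<close> and \<open>b\<close> agree, and the two answers are opposite; in particular
  \<open>a\<close> and \<open>b\<close> are distinct and not adjacent.\<close>

lemma P_less_two_cut:
  assumes q3: "3 \<le> q" and V: "crit V q" and ab: "a \<in> V" "b \<in> V" "V - {a,b} \<noteq> {}" "\<not> conn (V - {a,b})"
    and C: "card C = Suc q"
    and IH: "\<And>E' (V'::'a set). ugraph E' \<Longrightarrow> finite V' \<Longrightarrow> card V' < card V \<Longrightarrow> ugraph.conn E' V' \<Longrightarrow>
          \<not> ugraph.col E' V' q \<Longrightarrow> ugraph.P E' V' C \<le> fact (Suc q) * q ^ (card V' - Suc q)"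
  shows "P V C < fact (Suc q) * q ^ (card V - Suc q)"
proof -
  obtain X where X: "X \<subset> V - {a,b}" "X \<noteq> {}" "\<not> (\<exists>u\<in>X. \<exists>w\<in>V - {a,b} - X. E u w)"
    using connI[OF ab(3)] ab(4) by blast
  define Y where "Y = V - {a,b} - X"
  have XY: "X \<union> Y = V - {a,b}" "X \<inter> Y = {}" "X \<noteq> {}" "Y \<noteq> {}" "\<forall>u\<in>X. \<forall>v\<in>Y. \<not> E u v"
    using X unfolding Y_def by auto
  have YX: "Y \<union> X = V - {a,b}" "Y \<inter> X = {}" "Y \<noteq> {}" "X \<noteq> {}" "\<forall>u\<in>Y. \<forall>v\<in>X. \<not> E u v"
  proof -
    show "Y \<union> X = V - {a,b}" "Y \<inter> X = {}" "Y \<noteq> {}" "X \<noteq> {}"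
      using XY(1-4) by (simp_all add: Un_commute Int_commute)
    show "\<forall>u\<in>Y. \<forall>v\<in>X. \<not> E u v" using XY(5) E_sym by metis
  qed
  define pr where "pr S c \<longleftrightarrow> (\<forall>v\<in>S \<union> {a,b}. c v < q) \<and> (\<forall>u\<in>S \<union> {a,b}. \<forall>v\<in>S \<union> {a,b}. E u v \<longrightarrow> c u \<noteq> (c v::nat))" for S c
  have glue: "\<not> ((c a = c b) = (d a = d b))" if "pr X c" "pr Y d" for c d
  proof
    assume eq: "(c a = c b) = (d a = d b)"
    have "col (X \<union> Y \<union> {a,b}) q"
      by (rule col_glue[of X Y a b c q d]) (use that eq XY(5) in \<open>auto simp: pr_def\<close>)
    moreover have "X \<union> Y \<union> {a,b} = V" using XY(1) ab by blast
    ultimately show False using V unfolding crit_def by simp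
  qed
  have "X \<union> {a,b} \<subset> V" "Y \<union> {a,b} \<subset> V" using XY ab by blast+
  then have "col (X \<union> {a,b}) q" "col (Y \<union> {a,b}) q" using crit_subset_col[OF V] by blast+
  then obtain c d where cd: "pr X c" "pr Y d" unfolding pr_def col_def by blast
  have abE: "a \<noteq> b" "\<not> E a b"
  proof -
    show "a \<noteq> b" using glue[OF cd] by auto
    show "\<not> E a b"
    proof
      assume "E a b"
      then have "c a \<noteq> c b" "d a \<noteq> d b" using cd unfolding pr_def by auto
      then show False using glue[OF cd] by simp
    qed
  qed
  show ?thesis
  proof (cases "c a = c b")
    case True
    then have d: "d a \<noteq> d b" using glue[OF cd] by simp
    have "\<not> (\<exists>c. pr X c \<and> c a \<noteq> c b)" "\<not> (\<exists>c. pr Y c \<and> c a = c b)"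
      using glue[OF _ cd(2)] glue[OF cd(1)] d True by blast+
    then show ?thesis
      by (intro P_less_two_cut_side[OF q3 V ab(1,2) abE XY C _ _ IH]) (auto simp: pr_def)
  next
    case False
    then have d: "d a = d b" using glue[OF cd] by simp
    have "\<not> (\<exists>c. pr Y c \<and> c a \<noteq> c b)" "\<not> (\<exists>c. pr X c \<and> c a = c b)"
      using glue[OF _ cd(2)] glue[OF cd(1)] d False by blast+
    then show ?thesis
      by (intro P_less_two_cut_side[OF q3 V ab(1,2) abE YX C _ _ IH]) (auto simp: pr_def)
  qed
qed

end

section \<open>Critical sets without cuts of two vertices\<close>

context qgraph
begin

text \<open>\<open>K\<close> is a component of \<open>N\<close>, so its only neighbours in what is
  left lie in \<open>T\<close>, and the forced set is \<open>Nb T K\<close>. Both ways of adding up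
  the losses, \<open>Ph_absorb_all\<close> and \<open>Ph_absorb_all_loss\<close>, iterate this
  step.\<close>

lemma Ph_absorb_block:
  assumes "finite T" "finite N" "T \<inter> N = {}" "cov T A" "N \<noteq> {}"
  obtains K where "K \<subseteq> N" "conn K" "\<forall>u\<in>K. \<forall>y\<in>N - K. \<not> E u y" "card N = card (N - K) + card K" "1 \<le> card K"
    "Ph (T \<union> N) (A \<union> N) {} \<le> x ^ card K * Ph (T \<union> (N - K)) (A \<union> (N - K)) {} + x ^ (card K - 1) * r * (r ^ card (Nb T K) * om A)"
proof -
  obtain z where z: "z \<in> N" using assms(5) by blast
  define K where "K = rch N {z}"
  have KN: "K \<subseteq> N" unfolding K_def by (rule rch_subset)
  have cK: "conn K" unfolding K_def by (rule conn_rch[OF z])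
  have cl: "\<forall>u\<in>K. \<forall>y\<in>N - K. \<not> E u y" unfolding K_def using rch_closed[of "{z}" N] z by blast
  have fK: "finite K" using KN assms(2) finite_subset by blast
  let ?N = "N - K"
  have cd: "card N = card ?N + card K"
    using card_Un_disjoint[of ?N K] fK assms(2) KN by (simp add: Un_absorb2 Diff_partition Int_commute)
  have c1: "1 \<le> card K" using conn_nonempty[OF cK] fK by (simp add: Suc_le_eq card_gt_0_iff)
  have AT: "A \<subseteq> T" by (rule cov_subset[OF assms(4)])
  have fA: "finite A" using AT assms(1) finite_subset by blast
  have e: "T \<union> N = T \<union> ?N \<union> K" "A \<union> N = A \<union> ?N \<union> K" using KN by auto
  have "Ph (T \<union> N) (A \<union> N) {} \<le> x ^ card K * Ph (T \<union> ?N) (A \<union> ?N) {} + x ^ (card K - 1) * r * Ph (T \<union> ?N) (A \<union> ?N) ({} \<union> Nb (T \<union> ?N) K)"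
    unfolding e by (rule Ph_absorb) (use assms fK cK AT KN in auto)
  also have "Nb (T \<union> ?N) K = Nb T K" using cl unfolding Nb_def by blast
  also have "Ph (T \<union> ?N) (A \<union> ?N) ({} \<union> Nb T K) \<le> r ^ card (Nb T K) * om A"
  proof -
    have "Ph (T \<union> ?N) (A \<union> ?N) ({} \<union> Nb T K) \<le> r ^ card ({} \<union> Nb T K) * om (A \<union> ?N)"
      by (rule Ph_le_om) (use assms cov_Un[OF assms(4) cov_self] in \<open>auto simp: Nb_def\<close>)
    also have "\<dots> \<le> r ^ card ({} \<union> Nb T K) * om A"
      by (intro mult_left_mono om_mono) (use fA assms r_pow_pos in \<open>auto intro: less_imp_le\<close>)
    finally show ?thesis by simp
  qed
  finally have "Ph (T \<union> N) (A \<union> N) {} \<le> x ^ card K * Ph (T \<union> ?N) (A \<union> ?N) {} + x ^ (card K - 1) * r * (r ^ card (Nb T K) * om A)"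
    using x_pow_pos r_pos by (simp add: mult_left_mono less_imp_le)
  then show ?thesis using that KN cK cl cd c1 by blast
qed

text \<open>A multiplicative account. Each component of \<open>N\<close> has two neighbours to be
  forced into \<open>I\<close>, so its loss carries the factor \<open>r * r\<close>. The bound is a
  mean of 1 and \<open>r * r\<close> and reproduces itself, since
  \<open>x ^ s + x ^ (s - 1) * r = x ^ (s - 1)\<close> is at most one.\<close>

lemma Ph_absorb_all:
  assumes "finite T" "finite N" "T \<inter> N = {}" "cov T A"
    and "\<And>K. K \<subseteq> N \<Longrightarrow> conn K \<Longrightarrow> \<forall>u\<in>K. \<forall>y\<in>N - K. \<not> E u y \<Longrightarrow> 2 \<le> card (Nb T K)"
  shows "Ph (T \<union> N) (A \<union> N) {} \<le> om A * (x ^ card N + r\<^sup>2 * (1 - x ^ card N))"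
  using assms(2,3,5)
proof (induction "card N" arbitrary: N rule: less_induct)
  case less
  show ?case
  proof (cases "N = {}")
    case True then show ?thesis using Ph_le_om0[OF assms(1,4)] by simp
  next
    case False
    obtain K where K: "K \<subseteq> N" "conn K" "\<forall>u\<in>K. \<forall>y\<in>N - K. \<not> E u y" "card N = card (N - K) + card K" "1 \<le> card K"
      "Ph (T \<union> N) (A \<union> N) {} \<le> x ^ card K * Ph (T \<union> (N - K)) (A \<union> (N - K)) {} + x ^ (card K - 1) * r * (r ^ card (Nb T K) * om A)"
      using Ph_absorb_block[OF assms(1) less(2,3) assms(4) False] by blast
    let ?N = "N - K" and ?m = "card (N - K)" and ?s = "card K"
    have "Ph (T \<union> ?N) (A \<union> ?N) {} \<le> om A * (x ^ ?m + r\<^sup>2 * (1 - x ^ ?m))"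
    proof (rule less(1))
      show "?m < card N" using K by linarith
      show "finite ?N" "T \<inter> ?N = {}" using less by auto
      fix K' assume K': "K' \<subseteq> ?N" "conn K'" "\<forall>u\<in>K'. \<forall>y\<in>?N - K'. \<not> E u y"
      have "\<forall>u\<in>K'. \<forall>y\<in>N - K'. \<not> E u y" using K' K(3) E_sym by blast
      then show "2 \<le> card (Nb T K')" using less(4)[of K'] K' by blast
    qed
    then have 1: "x ^ ?s * Ph (T \<union> ?N) (A \<union> ?N) {} \<le> x ^ ?s * (om A * (x ^ ?m + r\<^sup>2 * (1 - x ^ ?m)))"
      using x_pow_pos by (simp add: mult_left_mono less_imp_le)
    have "r ^ card (Nb T K) \<le> r ^ 2" by (rule r_pow_anti) (rule less(4)[OF K(1-3)])
    then have 2: "x ^ (?s - 1) * r * (r ^ card (Nb T K) * om A) \<le> x ^ (?s - 1) * r * (r ^ 2 * om A)"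
      using x_pow_pos r_pos om_pos by (intro mult_left_mono mult_right_mono) (auto intro: less_imp_le)
    have "Ph (T \<union> N) (A \<union> N) {} \<le> om A * (x ^ (?s + ?m) + r\<^sup>2 * (x ^ ?s - x ^ (?s + ?m) + x ^ (?s - 1) * r))"
      using K(6) 1 2 by (simp add: algebra_simps power_add)
    also have "x ^ ?s + x ^ (?s - 1) * r = x ^ (?s - 1)"
    proof -
      obtain j where "?s = Suc j" using K(5) by (cases ?s) auto
      then have "x ^ ?s + x ^ (?s - 1) * r = x ^ j * (x + r)" by (simp add: algebra_simps)
      then show ?thesis using xr \<open>?s = Suc j\<close> by simp
    qed
    then have "om A * (x ^ (?s + ?m) + r\<^sup>2 * (x ^ ?s - x ^ (?s + ?m) + x ^ (?s - 1) * r)) \<le> om A * (x ^ (?s + ?m) + r\<^sup>2 * (1 - x ^ (?s + ?m)))"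
      using om_pos[of A] x_pow_le1[of "?s - 1"] by (intro mult_left_mono add_left_mono) auto
    finally show ?thesis using K(4) by (simp add: add.commute)
  qed
qed

text \<open>An additive account: the loss of a block is charged to its vertices at the rate
  \<open>l\<close>, and further factors \<open>x\<close> and \<open>om A\<close>, being at most one,
  are dropped from the losses.\<close>

lemma Ph_absorb_all_loss:
  fixes l :: real
  assumes "finite T" "finite N" "T \<inter> N = {}" "cov T A" "0 \<le> l"
    and "\<And>K. K \<subseteq> N \<Longrightarrow> conn K \<Longrightarrow> \<forall>u\<in>K. \<forall>y\<in>N - K. \<not> E u y \<Longrightarrow>
        x ^ (card K - 1) * r * r ^ card (Nb T K) < l * card K"
  shows "Ph (T \<union> N) (A \<union> N) {} \<le> x ^ card N * Ph T A {} + l * card N"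
    and "N \<noteq> {} \<Longrightarrow> Ph (T \<union> N) (A \<union> N) {} < x ^ card N * Ph T A {} + l * card N"
proof -
  have "Ph (T \<union> N) (A \<union> N) {} \<le> x ^ card N * Ph T A {} + l * card N \<and>
    (N \<noteq> {} \<longrightarrow> Ph (T \<union> N) (A \<union> N) {} < x ^ card N * Ph T A {} + l * card N)"
    using assms(2,3,6)
  proof (induction "card N" arbitrary: N rule: less_induct)
    case less
    show ?case
    proof (cases "N = {}")
      case True then show ?thesis by simp
    next
      case False
      obtain K where K: "K \<subseteq> N" "conn K" "\<forall>u\<in>K. \<forall>y\<in>N - K. \<not> E u y" "card N = card (N - K) + card K" "1 \<le> card K"
        "Ph (T \<union> N) (A \<union> N) {} \<le> x ^ card K * Ph (T \<union> (N - K)) (A \<union> (N - K)) {} + x ^ (card K - 1) * r * (r ^ card (Nb T K) * om A)"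
        using Ph_absorb_block[OF assms(1) less(2,3) assms(4) False] by blast
      let ?N = "N - K" and ?m = "card (N - K)" and ?s = "card K"
      have IH: "Ph (T \<union> ?N) (A \<union> ?N) {} \<le> x ^ ?m * Ph T A {} + l * ?m"
      proof -
        have a: "?m < card N" using K by linarith
        have b: "finite ?N" "T \<inter> ?N = {}" using less by auto
        have "x ^ (card K' - 1) * r * r ^ card (Nb T K') < l * card K'"
          if K': "K' \<subseteq> ?N" "conn K'" "\<forall>u\<in>K'. \<forall>y\<in>?N - K'. \<not> E u y" for K'
        proof -
          have "\<forall>u\<in>K'. \<forall>y\<in>N - K'. \<not> E u y" using K' K(3) E_sym by blast
          then show ?thesis using less(4)[of K'] K' by blast
        qed
        then show ?thesis using less(1)[OF a b] by blast
      qed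
      have 1: "x ^ ?s * Ph (T \<union> ?N) (A \<union> ?N) {} \<le> x ^ ?s * (x ^ ?m * Ph T A {}) + l * ?m"
      proof -
        have "x ^ ?s * Ph (T \<union> ?N) (A \<union> ?N) {} \<le> x ^ ?s * (x ^ ?m * Ph T A {} + l * ?m)"
          using IH x_pow_pos by (simp add: mult_left_mono less_imp_le)
        also have "\<dots> = x ^ ?s * (x ^ ?m * Ph T A {}) + x ^ ?s * (l * ?m)" by (rule distrib_left)
        also have "x ^ ?s * (l * ?m) \<le> 1 * (l * ?m)"
          using x_pow_le1[of ?s] assms(5) by (intro mult_right_mono mult_nonneg_nonneg) auto
        finally show ?thesis by simp
      qed
      have "x ^ (?s - 1) * r * (r ^ card (Nb T K) * om A) \<le> x ^ (?s - 1) * r * (r ^ card (Nb T K) * 1)"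
        using om_le1[of A] x_pow_pos[of "?s - 1"] r_pow_pos[of "card (Nb T K)"] r_pos
        by (intro mult_left_mono) (auto intro: less_imp_le)
      also have "\<dots> < l * ?s" using less(4)[OF K(1-3)] by simp
      finally have 2: "x ^ (?s - 1) * r * (r ^ card (Nb T K) * om A) < l * ?s" .
      have "Ph (T \<union> N) (A \<union> N) {} < x ^ ?s * (x ^ ?m * Ph T A {}) + l * ?m + l * ?s"
        using K(6) 1 2 by linarith
      also have "\<dots> = x ^ card N * Ph T A {} + l * card N"
        using K(4) by (simp add: power_add algebra_simps)
      finally show ?thesis by simp
    qed
  qed
  then show "Ph (T \<union> N) (A \<union> N) {} \<le> x ^ card N * Ph T A {} + l * card N"
    and "N \<noteq> {} \<Longrightarrow> Ph (T \<union> N) (A \<union> N) {} < x ^ card N * Ph T A {} + l * card N" by auto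
qed

text \<open>Bernoulli's inequality, since \<open>1 - (q - 1) * r = r\<close>.\<close>

lemma r_le_x_pow: "r \<le> x ^ (q - 1)"
proof -
  have "1 + real (q - 1) * (- r) \<le> (1 + (- r)) ^ (q - 1)"
    by (rule Bernoulli_inequality) (use r_le in simp)
  moreover have "1 + real (q - 1) * (- r) = r" using q2 unfolding r_def by (simp add: of_nat_diff field_simps)
  ultimately show ?thesis unfolding x_def by simp
qed

text \<open>Provides the hypothesis of \<open>Ph_absorb_all_loss\<close> with the rate
  \<open>x ^ (q - 1) * r ^ 3\<close>, for a block of \<open>s\<close> vertices with \<open>e\<close>
  neighbours; \<open>q \<le> e + s\<close> will come from the minimum degree. With
  \<open>t = q - s\<close> and \<open>x = (q - 1) * r\<close> it reduces to
  \<open>r ^ (e - 2) < s * x ^ t\<close>.\<close>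

lemma block_loss_less:
  assumes "4 \<le> q" "1 \<le> s" "s \<le> q - 1" "2 \<le> e" "q \<le> e + s"
  shows "x ^ (s - 1) * r * r ^ e < x ^ (q - 1) * r ^ 3 * real s"
proof -
  obtain j where j: "q = 4 + j" using assms(1) le_Suc_ex by blast
  define t where "t = q - s"
  have t: "1 \<le> t" "q - 1 = (s - 1) + t" "t \<le> e" unfolding t_def using assms by auto
  have xq: "x = (real q - 1) * r" unfolding x_def r_def using q2 by (simp add: field_simps)
  have rq: "r * real q = 1" unfolding r_def using q2 by simp
  have "r ^ (e - 2) < real s * x ^ t"
  proof (cases "t = 1")
    case True
    then have s: "real s = real q - 1" unfolding t_def using assms by (simp add: of_nat_diff)
    have "real q < (real q - 1) * (real q - 1)"
    proof -
      have "2 * (real q - 1) \<le> (real q - 1) * (real q - 1)" using assms(1) by (intro mult_right_mono) auto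
      then show ?thesis using assms(1) by simp
    qed
    then have "r * real q < r * ((real q - 1) * (real q - 1))" using r_pos by (rule mult_strict_left_mono)
    then have "1 < real s * x ^ t" unfolding rq s True xq by (simp add: mult_ac)
    then show ?thesis using r_pos r_le power_le_one[of r "e - 2"] by linarith
  next
    case False
    then have t2: "2 \<le> t" using t by simp
    have key: "real q ^ 2 < real s * (real q - 1) ^ t"
    proof (cases "t = 2")
      case True
      then have s: "real s = real q - 2" unfolding t_def using assms by (simp add: of_nat_diff)
      \<comment> \<open>The narrowest case: for \<open>q = 4\<close> it reads 16 < 18, and for
        \<open>q = 3\<close> the inequality is false.\<close>
      show ?thesis unfolding s True j by (simp add: power2_eq_square algebra_simps add_pos_nonneg)
    next
      case False
      have "real q ^ 2 < (real q - 1) ^ 3"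
        unfolding j by (simp add: power2_eq_square power3_eq_cube algebra_simps add_pos_nonneg)
      also have "\<dots> \<le> (real q - 1) ^ t" using False t2 assms by (intro power_increasing) auto
      also have "\<dots> \<le> real s * (real q - 1) ^ t" using assms by simp
      finally show ?thesis .
    qed
    have "r ^ (e - 2) \<le> r ^ (t - 2)" using t by (intro r_pow_anti) simp
    also have "\<dots> = r ^ t * real q ^ 2"
    proof -
      have "r ^ t = r ^ (t - 2) * r ^ 2" using power_add[of r "t - 2" 2] unfolding le_add_diff_inverse2[OF t2] .
      moreover have "r ^ 2 * real q ^ 2 = 1" using rq by (simp add: power_mult_distrib[symmetric])
      ultimately show ?thesis by simp
    qed
    also have "\<dots> < r ^ t * (real s * (real q - 1) ^ t)" using key r_pow_pos by (intro mult_strict_left_mono)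
    also have "\<dots> = real s * x ^ t" unfolding xq by (simp add: power_mult_distrib)
    finally show ?thesis .
  qed
  then have "x ^ (s - 1) * r ^ 3 * r ^ (e - 2) < x ^ (s - 1) * r ^ 3 * (real s * x ^ t)"
    using x_pow_pos r_pos by (intro mult_strict_left_mono mult_pos_pos) auto
  moreover have "x ^ (s - 1) * r * r ^ e = x ^ (s - 1) * r ^ 3 * r ^ (e - 2)"
  proof -
    obtain f where "e = 2 + f" using assms(4) le_Suc_ex by blast
    then show ?thesis by (simp add: power_add power2_eq_square power3_eq_cube)
  qed
  ultimately have "x ^ (s - 1) * r * r ^ e < x ^ (s - 1) * r ^ 3 * (real s * x ^ t)" by argo
  then show ?thesis unfolding t(2) power_add by (simp add: mult_ac)
qed

end

section \<open>The neighbourhood of a vertex in a 3-connected critical set\<close>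

locale crit3 = qgraph E q for E :: "'a \<Rightarrow> 'a \<Rightarrow> bool" and q +
  fixes V :: "'a set"
  assumes V: "crit V q" and q3: "3 \<le> q"
    and nonclique: "\<exists>u\<in>V. \<exists>v\<in>V. u \<noteq> v \<and> \<not> E u v"
    and no2: "a \<in> V \<Longrightarrow> b \<in> V \<Longrightarrow> conn (V - {a,b})"
begin

definition M :: "'a \<Rightarrow> 'a set" where "M v = Nb V {v}"
definition R :: "'a \<Rightarrow> 'a set" where "R v = V - {v} - M v"

lemma fV: "finite V"
  using V unfolding crit_def by blast

lemma connV: "conn V"
  using crit_conn[OF V] q3 by simp

lemma M_iff: "u \<in> M v \<longleftrightarrow> u \<in> V \<and> E v u"
  unfolding M_def Nb_def by auto

lemma R_iff: "u \<in> R v \<longleftrightarrow> u \<in> V \<and> u \<noteq> v \<and> \<not> E v u"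
  by (auto simp: R_def M_iff)

lemma MR: "v \<in> V \<Longrightarrow> V - {v} = R v \<union> M v" "R v \<inter> M v = {}" "v \<notin> M v" "v \<notin> R v"
  unfolding R_def using M_iff E_irr by auto

lemma fM: "finite (M v)" and fR: "finite (R v)"
  using fV finite_subset[of "M v" V] finite_subset[of "R v" V] M_iff R_iff by auto

lemma deg: "v \<in> V \<Longrightarrow> q \<le> card (M v)"
  unfolding M_def by (rule crit_degree[OF V])

lemma R_neighbour: assumes "v \<in> V" "w \<in> R v" shows "\<exists>y\<in>R v. E w y"
proof -
  have "\<not> Nb V {w} \<subseteq> Nb V {v}" by (rule crit_neighbours[OF V]) (use assms R_iff in auto)
  then obtain y where y: "y \<in> V" "E w y" "\<not> E v y" unfolding Nb_def by auto
  then have "y \<noteq> v" using assms(2) R_iff E_sym by blast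
  then show ?thesis using y R_iff by blast
qed

lemma sep2:
  assumes "a \<in> V" "b \<in> V" "X \<subseteq> V - {a,b}" "X \<noteq> {}" "V - {a,b} - X \<noteq> {}"
  shows "\<exists>u\<in>X. \<exists>v\<in>V - {a,b} - X. E u v"
proof -
  have "X \<subset> V - {a,b}" using assms by blast
  from conn_edge[OF no2[OF assms(1,2)] this assms(4)] show ?thesis by blast
qed

text \<open>If \<open>K\<close> had at most one neighbour in \<open>R v\<close>, that vertex
  together with \<open>v\<close> would cut \<open>K\<close> off; \<open>rest\<close> ensures that
  something remains on the other side. The second bound is the degree of any vertex of
  \<open>K\<close>, whose neighbours are \<open>v\<close>, other vertices of \<open>K\<close>, and
  \<open>Nb (R v) K\<close>.\<close>

lemma block_nb:
  assumes v: "v \<in> V" and K: "K \<subseteq> M v" "K \<noteq> {}" "\<forall>u\<in>K. \<forall>y\<in>M v - K. \<not> E u y"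
    and rest: "M v - K \<noteq> {} \<or> 2 \<le> card (R v)"
  shows "2 \<le> card (Nb (R v) K)" "q \<le> card (Nb (R v) K) + card K"
proof -
  let ?N = "Nb (R v) K"
  have fN: "finite ?N" using fR unfolding Nb_def by simp
  have NR: "?N \<subseteq> R v" unfolding Nb_def by blast
  show "2 \<le> card ?N"
  proof (rule ccontr)
    assume "\<not> 2 \<le> card ?N"
    then have "card ?N \<le> Suc 0" by simp
    then have one: "\<forall>a\<in>?N. \<forall>b\<in>?N. a = b" using card_le_Suc0_iff_eq[OF fN] by blast
    \<comment> \<open>If \<open>K\<close> has no neighbour in \<open>R v\<close>, the default
      \<open>w = v\<close> reduces the cut to the single vertex \<open>v\<close>.\<close>
    define w where "w = (if ?N = {} then v else (SOME a. a \<in> ?N))"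
    have w: "?N \<subseteq> {w}" "w \<in> V" "w = v \<or> w \<in> R v"
    proof -
      have "w \<in> ?N" if "?N \<noteq> {}" using that unfolding w_def by (simp add: some_in_eq)
      then show "?N \<subseteq> {w}" "w = v \<or> w \<in> R v" using one NR unfolding w_def by auto
      then show "w \<in> V" using v R_iff by auto
    qed
    have KV: "K \<subseteq> V - {v,w}" using K(1) w(3) M_iff R_iff E_irr by blast
    have "V - {v,w} - K \<noteq> {}"
    proof (cases "M v - K = {}")
      case False
      then obtain m where "m \<in> M v" "m \<notin> K" by blast
      then have "m \<in> V - {v,w} - K" using w(3) M_iff R_iff E_irr by blast
      then show ?thesis by blast
    next
      case True
      then have "\<not> R v \<subseteq> {w}" using rest card_mono[of "{w}" "R v"] by auto
      then obtain m where "m \<in> R v" "m \<noteq> w" by blast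
      then have "m \<in> V - {v,w} - K" using K(1) M_iff R_iff by blast
      then show ?thesis by blast
    qed
    from sep2[OF v w(2) KV K(2) this] obtain u y where uy: "u \<in> K" "y \<in> V - {v,w} - K" "E u y" by blast
    then have "y \<notin> M v" using K(3) by blast
    then have "y \<in> R v" using uy(2) R_iff M_iff by blast
    then have "y \<in> ?N" using uy unfolding Nb_def by blast
    then show False using w(1) uy(2) by blast
  qed
  obtain z where z: "z \<in> K" using K(2) by blast
  have fK: "finite K" using K(1) fM finite_subset by blast
  have "M z \<subseteq> {v} \<union> (K - {z}) \<union> ?N"
  proof
    fix y assume "y \<in> M z"
    then have y: "y \<in> V" "E z y" using M_iff by auto
    show "y \<in> {v} \<union> (K - {z}) \<union> ?N"
    proof (cases "y \<in> R v")
      case True then show ?thesis using y z unfolding Nb_def by blast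
    next
      case False
      then have "y = v \<or> y \<in> M v" using y R_iff M_iff by blast
      then show ?thesis using K(3) z y E_irr by blast
    qed
  qed
  then have "card (M z) \<le> card ({v} \<union> (K - {z}) \<union> ?N)" using fK fN by (intro card_mono) auto
  also have "\<dots> \<le> card ({v} \<union> (K - {z})) + card ?N" by (rule card_Un_le)
  also have "\<dots> \<le> card {v} + card (K - {z}) + card ?N" using card_Un_le[of "{v}" "K - {z}"] by simp
  also have "\<dots> = card K + card ?N" using card_Suc_Diff1[OF fK z] by simp
  finally have "card (M z) \<le> card K + card ?N" .
  moreover have "q \<le> card (M z)" by (rule deg) (use z K(1) M_iff in blast)
  ultimately show "q \<le> card ?N + card K" by linarith
qed

text \<open>\<open>X\<close> is a largest connected set among those contained in some \<open>R v\<close>.\<close>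

lemma exists_root:
  "\<exists>v X u. v \<in> V \<and> X \<subseteq> R v \<and> conn X \<and> u \<in> M v \<and> (\<exists>y\<in>X. E u y) \<and> (\<forall>y\<in>R v - X. E u y) \<and>
     (\<forall>y\<in>X. \<forall>z\<in>R v - X. \<not> E y z)"
proof -
  let ?F = "{X. \<exists>v\<in>V. X \<subseteq> R v \<and> conn X}"
  have "?F \<subseteq> Pow V" using R_iff by blast
  then have fF: "finite ?F" using fV by (meson finite_Pow_iff finite_subset)
  obtain a b where "a \<in> V" "b \<in> V" "a \<noteq> b" "\<not> E a b" using nonclique by blast
  then have "b \<in> R a" using R_iff by blast
  then have "{b} \<in> ?F" using \<open>a \<in> V\<close> conn_singleton by blast
  then have "?F - {} \<noteq> {}" by blast
  from ex_max_on_Diff[OF this fF, of card] obtain X where X: "X \<in> ?F" and mx: "\<forall>Y\<in>?F. card Y \<le> card X" by auto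
  then obtain v where v: "v \<in> V" "X \<subseteq> R v" "conn X" by blast
  have fX: "finite X" using v fR finite_subset by blast
  have big: False if "y \<notin> X" "z \<in> X" "E z y" "w \<in> V" "insert y X \<subseteq> R w" for y z w
  proof -
    have "conn (insert y X)" using conn_insert[OF v(3) that(2,3)] .
    then have "insert y X \<in> ?F" using that by blast
    then have "card (insert y X) \<le> card X" using mx by blast
    then show False using that fX by simp
  qed
  have sep: "\<forall>y\<in>X. \<forall>z\<in>R v - X. \<not> E y z" using big[OF _ _ _ v(1)] v(2) by blast
  have "X \<subset> V" using v R_iff by blast
  from conn_edge[OF connV this conn_nonempty[OF v(3)]] obtain y u where yu: "y \<in> X" "u \<in> V" "u \<notin> X" "E y u" by blast
  have uM: "u \<in> M v"
  proof -
    have "u \<notin> R v" using sep yu by blast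
    moreover have "u \<noteq> v" using yu v(2) R_iff E_sym by blast
    ultimately show ?thesis using yu R_iff M_iff by blast
  qed
  \<comment> \<open>Otherwise \<open>R z\<close> would contain the connected set
    \<open>insert u X\<close>, which is larger than \<open>X\<close>.\<close>
  have "E u z" if z: "z \<in> R v - X" for z
  proof (rule ccontr)
    assume n: "\<not> E u z"
    have "insert u X \<subseteq> R z"
    proof
      fix t assume "t \<in> insert u X"
      then consider "t = u" | "t \<in> X" by blast
      then show "t \<in> R z"
      proof cases
        case 1 then show ?thesis using n yu(2) uM z E_sym R_iff M_iff by blast
      next
        case 2
        then have "\<not> E t z" using sep z by blast
        then have "\<not> E z t" using E_sym by blast
        then show ?thesis using 2 z v(2) R_iff by blast
      qed
    qed
    then show False using big[OF yu(3,1,4)] z R_iff by blast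
  qed
  then show ?thesis using v uM yu E_sym sep by blast
qed

text \<open>The component \<open>K\<close> of \<open>u\<close> inside \<open>M v\<close> covers all
  of \<open>R v\<close>: the set \<open>X\<close> through \<open>y0\<close>, everything else
  directly from \<open>u\<close>. Only the remaining neighbours \<open>N\<close> have to be
  absorbed. If the degree exceeds \<open>q\<close>, there is room for all losses. If it equals
  \<open>q\<close>, the basic estimate already gives \<open>x ^ (q - 1)\<close> without any loss, so
  a gain of \<open>x * r * r\<close> must be found in \<open>R v\<close> to pay for
  \<open>N\<close>.\<close>

lemma Ph_less_general:
  assumes q4: "4 \<le> q"
  shows "\<exists>v\<in>V. Ph (V - {v}) (Nb V {v}) {} < x ^ (q - 1)"
proof -
  obtain v X u where v: "v \<in> V" "X \<subseteq> R v" "conn X" "u \<in> M v" "\<exists>y\<in>X. E u y" "\<forall>y\<in>R v - X. E u y"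
     "\<forall>y\<in>X. \<forall>z\<in>R v - X. \<not> E y z" using exists_root by blast
  obtain y0 where y0: "y0 \<in> X" "E u y0" using v(5) by blast
  define K where "K = rch (M v) {u}"
  have K: "u \<in> K" "K \<subseteq> M v" "conn K"
    unfolding K_def using rch_base[of "{u}" "M v"] v(4) rch_subset conn_rch[OF v(4)] by auto
  have Kcl: "\<forall>a\<in>K. \<forall>b\<in>M v - K. \<not> E a b" unfolding K_def using rch_closed[of "{u}" "M v"] v(4) by blast
  define T where "T = R v \<union> K"
  define N where "N = M v - K"
  have fT: "finite T" "finite N" "finite K" unfolding T_def N_def using fR fM K(2) finite_subset[OF K(2)] by auto
  have TN: "T \<inter> N = {}" "T \<union> N = V - {v}" "K \<union> N = Nb V {v}"
    unfolding T_def N_def using MR(1)[OF v(1)] MR(2)[of v] K(2) unfolding M_def by blast+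
  have KT: "K \<subseteq> T" unfolding T_def by blast
  have covT: "cov T K"
  proof (rule covI[OF KT])
    fix Z assume Z: "K \<subseteq> Z" "Z \<subset> T"
    then obtain t where t: "t \<in> R v" "t \<notin> Z" unfolding T_def by blast
    show "\<exists>a\<in>Z. \<exists>b\<in>T - Z. E a b"
    proof (cases "R v - X \<subseteq> Z")
      case False
      then obtain s where "s \<in> R v - X" "s \<notin> Z" by blast
      then show ?thesis using v(6) Z(1) K(1) unfolding T_def by blast
    next
      case True
      then have tX: "t \<in> X" using t by blast
      show ?thesis
      proof (cases "y0 \<in> Z")
        case False then show ?thesis using y0 Z(1) K(1) v(2) unfolding T_def by blast
      next
        case True
        then have "Z \<inter> X \<subset> X" "Z \<inter> X \<noteq> {}" using tX t y0 by auto
        from conn_edge[OF v(3) this] obtain a b where "a \<in> Z \<inter> X" "b \<in> X" "b \<notin> Z \<inter> X" "E a b" by blast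
        then show ?thesis using v(2) unfolding T_def by blast
      qed
    qed
  qed
  obtain y1 where y1: "y1 \<in> R v" "E y0 y1" using R_neighbour[OF v(1)] y0 v(2) by blast
  have R2: "2 \<le> card (R v)"
  proof -
    have "y0 \<noteq> y1" using y1 E_irr by auto
    moreover have "{y0,y1} \<subseteq> R v" using y0 y1 v(2) by blast
    ultimately show ?thesis using card_mono[OF fR, of "{y0,y1}" v] by simp
  qed
  have blk: "2 \<le> card (Nb T L)" "q \<le> card (Nb T L) + card L"
    if L: "L \<subseteq> N" "conn L" "\<forall>a\<in>L. \<forall>b\<in>N - L. \<not> E a b" for L
  proof -
    have c: "\<forall>a\<in>L. \<forall>b\<in>M v - L. \<not> E a b" using L Kcl E_sym unfolding N_def by blast
    have LM: "L \<subseteq> M v" using L unfolding N_def by blast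
    have "Nb (R v) L \<subseteq> Nb T L" unfolding Nb_def T_def by blast
    then have "card (Nb (R v) L) \<le> card (Nb T L)" using fT by (intro card_mono) (auto simp: Nb_def)
    then show "2 \<le> card (Nb T L)" "q \<le> card (Nb T L) + card L"
      using block_nb[OF v(1) LM conn_nonempty[OF L(2)] c] R2 by auto
  qed
  have dK: "card K + card N = card (M v)" unfolding N_def using K(2) fT(3) fM by (simp add: card_Diff_subset card_mono)
  have K1: "1 \<le> card K" using K(1) fT(3) by (metis One_nat_def Suc_leI card_gt_0_iff empty_iff)
  have omK: "om K \<le> x ^ (card K - 1)" by (rule om_conn[OF K(3)])
  show ?thesis
  proof (cases "card (M v) = q")
    case False
    then have d: "q + 1 \<le> card (M v)" using deg[OF v(1)] by simp
    have "Ph (V - {v}) (Nb V {v}) {} \<le> om K * (x ^ card N + r\<^sup>2 * (1 - x ^ card N))"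
      using Ph_absorb_all[OF fT(1,2) TN(1) covT blk(1)] TN by simp
    also have "\<dots> \<le> x ^ (card K - 1) * (x ^ card N + r\<^sup>2 * (1 - x ^ card N))"
      using omK x_pow_pos[of "card N"] x_pow_le1[of "card N"] by (intro mult_right_mono) auto
    also have "\<dots> = x ^ (card K - 1) * x ^ card N * (1 - r\<^sup>2) + r\<^sup>2 * x ^ (card K - 1)" by (simp add: algebra_simps)
    also have "x ^ (card K - 1) * x ^ card N = x ^ (card (M v) - 1)" using dK K1 by (simp add: power_add[symmetric])
    also have "x ^ (card (M v) - 1) * (1 - r\<^sup>2) + r\<^sup>2 * x ^ (card K - 1) \<le> x ^ q * (1 - r\<^sup>2) + r\<^sup>2 * 1"
    proof (intro add_mono mult_right_mono mult_left_mono)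
      show "x ^ (card (M v) - 1) \<le> x ^ q" using d by (intro x_pow_anti) simp
      show "0 \<le> 1 - r\<^sup>2" using r_pos r_le power_le_one[of r 2] by simp
    qed (use x_pow_le1 in auto)
    \<comment> \<open>Because of \<open>x ^ (q - 1) = x ^ q + x ^ (q - 1) * r\<close> and
      \<open>r_le_x_pow\<close>, the right-hand side is at least \<open>x ^ q + r * r\<close>; the
      term \<open>- r * r * x ^ q\<close> makes the inequality strict.\<close>
    also have "\<dots> < x ^ (q - 1)"
    proof -
      have e: "x ^ (q - 1) = x ^ q + x ^ (q - 1) * r"
      proof -
        have "x ^ q = x ^ (q - 1) * x" using q3 power_add[of x "q - 1" 1] by simp
        then show ?thesis using xr by (metis distrib_left mult.right_neutral)
      qed
      have "r\<^sup>2 * (1 - x ^ q) < r\<^sup>2 * 1" using x_pow_pos[of q] r_pos by (intro mult_strict_left_mono) auto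
      also have "r\<^sup>2 * 1 \<le> x ^ (q - 1) * r" using r_le_x_pow r_pos by (simp add: power2_eq_square)
      finally show ?thesis using e by (simp add: algebra_simps)
    qed
    finally show ?thesis using v(1) by blast
  next
    case True
    have gain: "Ph T K {} \<le> (1 - x * r\<^sup>2) * om K"
    proof (cases "R v = X")
      case False
      \<comment> \<open>Two adjacent vertices of \<open>R v - X\<close> form a triangle with
        \<open>u\<close>, which gives the gain.\<close>
      then obtain s where s: "s \<in> R v - X" using v(2) by blast
      obtain t where t: "t \<in> R v" "E s t" using R_neighbour[OF v(1)] s by blast
      then have tX: "t \<in> R v - X" using v(7) s E_sym by blast
      have u1: "E u s" "E u t" using v(6) s tX by auto
      have notK: "s \<notin> K" "t \<notin> K" using s t K(2) MR(2)[of v] by blast+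
      have st: "s \<noteq> t" using t E_irr by auto
      show ?thesis
      proof (rule Ph_gain[OF fT(1) covT K(1), of s t "{u,t}"])
        have "conn (insert t {u})" by (rule conn_insert[OF conn_singleton, of u]) (use u1 in auto)
        then show "conn {u,t}" by (simp add: insert_commute)
      qed (use s t u1 notK st K(1) in \<open>auto simp: T_def Nb_def\<close>)
    next
      case Xeq: True
      \<comment> \<open>Now \<open>R v\<close> is connected. A second contact \<open>y2\<close> of
        \<open>K\<close> closes a cycle through \<open>y0\<close>: from a neighbour \<open>a\<close>
        of \<open>y0\<close> through the component \<open>Z\<close> of \<open>y2\<close> in
        \<open>R v - {y0}\<close> to \<open>k2\<close> in \<open>K\<close>.\<close>
      have "2 \<le> card (Nb (R v) K)"
        by (rule block_nb(1)[OF v(1) K(2) _ Kcl]) (use K(1) R2 in auto)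
      then have "\<not> Nb (R v) K \<subseteq> {y0}" using card_mono[of "{y0}" "Nb (R v) K"] by auto
      then obtain y2 k2 where y2: "y2 \<in> R v" "y2 \<noteq> y0" "k2 \<in> K" "E k2 y2" unfolding Nb_def by blast
      define Z where "Z = rch (R v - {y0}) {y2}"
      have bZ: "{y2} \<subseteq> R v - {y0}" using y2 by blast
      have Z: "y2 \<in> Z" "Z \<subseteq> R v - {y0}" "conn Z"
        unfolding Z_def using rch_base[OF bZ] rch_subset conn_rch[of y2 "R v - {y0}"] y2 by auto
      have "Z \<subset> X" "Z \<noteq> {}" using Z y0 Xeq by auto
      from conn_edge[OF v(3) this] obtain a b where ab: "a \<in> Z" "b \<in> X" "b \<notin> Z" "E a b" by blast
      have by0: "b = y0" using rch_closed[OF bZ, of a b] ab Xeq unfolding Z_def by blast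
      have ak: "a \<notin> K" "y0 \<notin> K" using ab(1) Z(2) y0 v(2) K(2) MR(2)[of v] by blast+
      show ?thesis
      proof (rule Ph_gain[OF fT(1) covT K(1), of y0 a "insert k2 Z"])
        show "conn (insert k2 Z)" by (rule conn_insert[OF Z(3,1)]) (rule E_sym[OF y2(4)])
        show "insert k2 Z \<subseteq> T - {y0}" using Z y2(3) ak unfolding T_def by blast
        show "insert k2 Z \<inter> (K \<union> Nb T {y0} - {a}) \<noteq> {}" using y2(3) ak by blast
        show "a \<in> Nb T {y0}" using ab by0 Z E_sym unfolding Nb_def T_def by blast
      qed (use y0 ak ab v(2) in \<open>auto simp: T_def\<close>)
    qed
    \<comment> \<open>At most \<open>q - 1\<close> vertices are absorbed, and
      \<open>r * (q - 1) = x\<close>, so at this rate the total loss is at most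
      \<open>x ^ (q - 1) * (x * r * r)\<close>, the amount gained.\<close>
    let ?l = "x ^ (q - 1) * r ^ 3"
    have l0: "0 \<le> ?l" using x_pow_pos r_pos by (intro mult_nonneg_nonneg less_imp_le) auto
    have loss: "x ^ (card L - 1) * r * r ^ card (Nb T L) < ?l * card L"
      if L: "L \<subseteq> N" "conn L" "\<forall>a\<in>L. \<forall>b\<in>N - L. \<not> E a b" for L
    proof (rule block_loss_less[OF q4])
      have fL: "finite L" using L(1) fT(2) finite_subset by blast
      show "1 \<le> card L" using conn_nonempty[OF L(2)] fL by (simp add: Suc_le_eq card_gt_0_iff)
      have "card L \<le> card N" using L(1) fT(2) by (rule card_mono[rotated])
      then show "card L \<le> q - 1" using dK K1 True by linarith
    qed (use blk[OF L] in auto)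
    have base: "x ^ card N * Ph T K {} \<le> x ^ (q - 1) * (1 - x * r\<^sup>2)"
    proof -
      have nn: "0 \<le> 1 - x * r\<^sup>2"
      proof -
        have "r\<^sup>2 \<le> 1" using r_pos r_le by (intro power_le_one) auto
        then have "x * r\<^sup>2 \<le> 1 * 1" using x_pos x_less by (intro mult_mono) auto
        then show ?thesis by simp
      qed
      have "x ^ card N * Ph T K {} \<le> x ^ card N * ((1 - x * r\<^sup>2) * x ^ (card K - 1))"
      proof (rule mult_left_mono)
        show "Ph T K {} \<le> (1 - x * r\<^sup>2) * x ^ (card K - 1)"
          using gain mult_left_mono[OF omK nn] by linarith
      qed (use x_pow_pos in \<open>auto intro: less_imp_le\<close>)
      also have "\<dots> = x ^ (card N + (card K - 1)) * (1 - x * r\<^sup>2)" by (simp add: power_add)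
      also have "card N + (card K - 1) = q - 1" using dK K1 True by linarith
      finally show ?thesis .
    qed
    have lN: "?l * card N \<le> x ^ (q - 1) * (x * r\<^sup>2)"
    proof -
      have "real (card N) \<le> real q - 1" using dK K1 True by linarith
      then have "r * card N \<le> r * (real q - 1)" using r_pos by (intro mult_left_mono) auto
      also have "\<dots> = x" unfolding x_def r_def using q2 by (simp add: field_simps)
      finally have "x ^ (q - 1) * r\<^sup>2 * (r * card N) \<le> x ^ (q - 1) * r\<^sup>2 * x"
        using x_pow_pos by (intro mult_left_mono mult_nonneg_nonneg) (auto intro: less_imp_le)
      then show ?thesis by (simp add: power2_eq_square power3_eq_cube algebra_simps)
    qed
    have sum: "x ^ (q - 1) * (1 - x * r\<^sup>2) + x ^ (q - 1) * (x * r\<^sup>2) = x ^ (q - 1)" by (simp add: algebra_simps)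
    have pos: "0 < x ^ (q - 1) * (x * r\<^sup>2)" using x_pow_pos x_pos r_pos by simp
    have "Ph (V - {v}) (Nb V {v}) {} < x ^ (q - 1)"
    proof (cases "N = {}")
      case True
      then have "Ph (V - {v}) (Nb V {v}) {} = Ph T K {}" using TN by simp
      also have "\<dots> \<le> x ^ (q - 1) * (1 - x * r\<^sup>2)" using base True by simp
      finally show ?thesis using sum pos by linarith
    next
      case False
      have "Ph (V - {v}) (Nb V {v}) {} < x ^ card N * Ph T K {} + ?l * card N"
        using Ph_absorb_all_loss(2)[OF fT(1,2) TN(1) covT l0 loss False] TN by simp
      then show ?thesis using base lN sum by linarith
    qed
    then show ?thesis using v(1) by blast
  qed
qed

end

section \<open>Four colors\<close>

context crit3
begin

lemma exists_induced_path: "\<exists>v\<in>V. \<exists>a\<in>M v. \<exists>b\<in>M v. a \<noteq> b \<and> \<not> E a b"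
proof -
  obtain u w where uw: "u \<in> V" "w \<in> V" "u \<noteq> w" "\<not> E u w" using nonclique by blast
  have "w \<notin> insert u (M u)" using uw M_iff by simp
  moreover have "M u \<subseteq> V" unfolding M_def Nb_def by blast
  ultimately have "insert u (M u) \<subset> V" using uw by blast
  from conn_edge[OF connV this] obtain s t where st: "s \<in> insert u (M u)" "t \<in> V" "t \<notin> insert u (M u)" "E s t" by blast
  then have t: "\<not> E u t" "t \<noteq> u" using M_iff by auto
  then have "s \<in> M u" using st by blast
  then have "s \<in> V" "E s u" using M_iff E_sym by auto
  then have "u \<in> M s" "t \<in> M s" using st uw M_iff by auto
  moreover have "u \<noteq> t" using t by simp
  ultimately show ?thesis using t(1) \<open>s \<in> V\<close> by (intro bexI[of _ s] bexI[of _ u] bexI[of _ t]) auto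
qed

text \<open>The cubic case of Brooks' theorem: two non-adjacent neighbours of a vertex are merged, and
  no critical subgraph of the result can have minimum degree three.\<close>

lemma exists_degree_four:
  assumes q: "q = 3"
  shows "\<exists>v\<in>V. 4 \<le> card (M v)"
proof (rule ccontr)
  assume "\<not> ?thesis"
  then have d3: "card (M v) \<le> 3" if "v \<in> V" for v using that by force
  obtain v a b where v: "v \<in> V" "a \<in> M v" "b \<in> M v" "a \<noteq> b" "\<not> E a b" using exists_induced_path by blast
  have ab: "a \<in> V" "b \<in> V" "a \<noteq> v" "b \<noteq> v" using v M_iff E_irr by auto
  interpret m: ugraph "merge E a b" by (rule ugraph_merge[OF v(5)])
  have "\<not> m.col (V - {v} - {b}) 3"
  proof
    assume "m.col (V - {v} - {b}) 3"
    then have "\<exists>c::'a \<Rightarrow> nat. (\<forall>u\<in>V - {v}. c u < 3) \<and> (\<forall>u\<in>V - {v}. \<forall>w\<in>V - {v}. E u w \<longrightarrow> c u \<noteq> c w) \<and> c a = c b"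
      by (intro merge_col) (use ab v in auto)
    then obtain c :: "'a \<Rightarrow> nat" where c: "\<forall>u\<in>V - {v}. c u < 3"
      "\<forall>u\<in>V - {v}. \<forall>w\<in>V - {v}. E u w \<longrightarrow> c u \<noteq> c w" "c a = c b" by blast
    have "c ` M v = c ` (M v - {b})"
    proof -
      have "c b \<in> c ` (M v - {b})" unfolding c(3)[symmetric] by (rule imageI) (use v in blast)
      then show ?thesis by blast
    qed
    then have "card (c ` M v) \<le> card (M v - {b})" using fM by (simp add: card_image_le)
    also have "\<dots> < card (M v)" by (rule card_Diff1_less[OF fM v(3)])
    also have "\<dots> \<le> 3" by (rule d3[OF v(1)])
    finally have "card (c ` Nb V {v}) < 3" unfolding M_def .
    then have "col V 3" by (rule col_insert[OF fV c(1,2)])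
    then show False using V q unfolding crit_def by simp
  qed
  then obtain H where H: "H \<subseteq> V - {v} - {b}" "m.crit H 3" using m.crit_exists[of "V - {v} - {b}" 3] fV by auto
  \<comment> \<open>For \<open>z\<close> other than \<open>a\<close>, merging does not raise the
    degree, as a neighbour \<open>b\<close> is merely replaced by \<open>a\<close>. If a neighbour
    \<open>s\<close> is missing from \<open>H\<close>, at most two are left, against
    \<open>crit_degree\<close>.\<close>
  have small: False if z: "z \<in> H" "z \<noteq> a" "s \<in> M z" "s \<notin> H" "s \<noteq> b" for z s
  proof -
    have zV: "z \<in> V" using z H by blast
    let ?f = "\<lambda>y. if y = b then a else y"
    have "m.Nb H {z} \<subseteq> ?f ` (M z - {s})"
    proof
      fix t assume "t \<in> m.Nb H {z}"
      then have t: "t \<in> H" "merge E a b z t" unfolding m.Nb_def by auto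
      have tV: "t \<in> V" "t \<noteq> b" using t H by auto
      from t(2) z(2) consider "E z t" | "t = a" "E b z" unfolding merge_def by blast
      then show "t \<in> ?f ` (M z - {s})"
      proof cases
        case 1
        then have "t \<in> M z - {s}" using t(1) z(4) tV M_iff by blast
        then show ?thesis using tV(2) by (intro image_eqI[of _ _ t]) auto
      next
        case 2
        then have "b \<in> M z - {s}" using z(5) ab M_iff E_sym by blast
        then show ?thesis using 2 by (intro image_eqI[of _ _ b]) auto
      qed
    qed
    then have "card (m.Nb H {z}) \<le> card (?f ` (M z - {s}))" using fM by (intro card_mono) auto
    also have "\<dots> \<le> card (M z - {s})" using fM by (intro card_image_le) auto
    also have "\<dots> < card (M z)" by (rule card_Diff1_less[OF fM z(3)])
    finally show False using m.crit_degree[OF H(2) z(1)] d3[OF zV] by linarith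
  qed
  let ?W = "V - {a,b}"
  have "H \<subseteq> {a}"
  proof (rule ccontr)
    assume "\<not> H \<subseteq> {a}"
    \<comment> \<open>The connected set \<open>V - {a,b}\<close> contains \<open>v\<close>, which is
      not in \<open>H\<close>. An edge across the border of \<open>H\<close> produces a vertex
      excluded by \<open>small\<close>.\<close>
    then have "?W - H \<subset> ?W" using H by blast
    moreover have "v \<in> ?W - H" using v ab H by blast
    then have "?W - H \<noteq> {}" by blast
    ultimately obtain s z where sz: "s \<in> ?W - H" "z \<in> ?W" "z \<notin> ?W - H" "E s z"
      using conn_edge[OF no2[OF ab(1,2)]] by meson
    then have "s \<in> M z" using M_iff E_sym by blast
    then show False using small[of z s] sz by blast
  qed
  then have "m.col H 3" unfolding m.col_def
    by (intro exI[of _ "\<lambda>_. 0"]) (use m.E_irr in auto)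
  then show False using H(2) unfolding m.crit_def by blast
qed

lemma card_le2_pair: "S \<subseteq> V \<Longrightarrow> card S \<le> 2 \<Longrightarrow> \<exists>a\<in>V. \<exists>b\<in>V. S \<subseteq> {a,b}"
proof -
  assume S: "S \<subseteq> V" "card S \<le> 2"
  have fS: "finite S" using S fV finite_subset by blast
  obtain v where v: "v \<in> V" using conn_nonempty[OF connV] by blast
  consider "card S = 0" | "card S = 1" | "card S = 2" using S(2) by linarith
  then show ?thesis
  proof cases
    case 1 then show ?thesis using fS v by auto
  next
    case 2 then show ?thesis using S(1) by (metis card_1_singletonE insert_subset subset_insertI)
  next
    case 3 then show ?thesis using S(1) by (metis card_2_iff insert_subset order_refl)
  qed
qed

text \<open>With at most two neighbours in \<open>M v\<close>, these would separate \<open>L\<close>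
  from \<open>v\<close>.\<close>

lemma region_nb:
  assumes v: "v \<in> V" and L: "L \<subseteq> R v" "L \<noteq> {}" "\<forall>u\<in>L. \<forall>y\<in>R v - L. \<not> E u y"
  shows "3 \<le> card (Nb (M v) L)"
proof (rule ccontr)
  assume "\<not> 3 \<le> card (Nb (M v) L)"
  then have "card (Nb (M v) L) \<le> 2" by simp
  moreover have "Nb (M v) L \<subseteq> V" unfolding Nb_def using M_iff by blast
  ultimately obtain a b where "a \<in> V" "b \<in> V" "Nb (M v) L \<subseteq> {a,b}" using card_le2_pair by blast
  \<comment> \<open>The pair may contain \<open>v\<close> or vertices of \<open>L\<close>; whatever
    is not in \<open>Nb (M v) L\<close> is replaced by some neighbour \<open>m\<close> of
    \<open>v\<close>.\<close>
  obtain a' b' where ab: "a' \<in> V" "b' \<in> V" "Nb (M v) L \<subseteq> {a',b'}" "a' \<notin> L" "b' \<notin> L" "a' \<noteq> v" "b' \<noteq> v"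
  proof -
    obtain m where m: "m \<in> M v" using deg[OF v] q3 by fastforce
    have mL: "m \<in> V" "m \<notin> L" "m \<noteq> v" using m M_iff L(1) R_iff E_irr by blast+
    have nL: "t \<notin> L \<and> t \<noteq> v \<and> t \<in> V" if "t \<in> Nb (M v) L" for t
      using that L(1) MR(2,3)[of v] M_iff unfolding Nb_def by blast
    let ?a = "if a \<in> Nb (M v) L then a else m" and ?b = "if b \<in> Nb (M v) L then b else m"
    show ?thesis
      by (rule that[of ?a ?b]) (use mL nL \<open>Nb (M v) L \<subseteq> {a,b}\<close> in auto)
  qed
  have "L \<subseteq> V - {a',b'}" using L(1) ab R_iff by blast
  moreover have "v \<in> V - {a',b'} - L" using v ab L(1) MR(4)[of v] by blast
  ultimately obtain u y where uy: "u \<in> L" "y \<in> V - {a',b'} - L" "E u y"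
    using sep2[OF ab(1,2) _ L(2)] by blast
  have "y \<noteq> v" using uy(1,3) L(1) R_iff E_sym by blast
  moreover have "y \<notin> R v" using L(3) uy by blast
  ultimately have "y \<in> M v" using uy(2) R_iff M_iff by blast
  then have "y \<in> Nb (M v) L" using uy unfolding Nb_def by blast
  then show False using ab(3) uy(2) by blast
qed

text \<open>A part of \<open>R v\<close> not reached from \<open>B\<close> would have all its
  neighbours in \<open>M v - B\<close>, too few for \<open>region_nb\<close>.\<close>

lemma cov_roots:
  assumes v: "v \<in> V" and B: "B \<subseteq> M v" "card (M v - B) \<le> 2"
  shows "cov (R v \<union> B) B"
proof (rule covI, simp)
  fix Z assume Z: "B \<subseteq> Z" "Z \<subset> R v \<union> B"
  let ?L = "R v - Z"
  show "\<exists>u\<in>Z. \<exists>w\<in>R v \<union> B - Z. E u w"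
  proof (rule ccontr)
    assume n: "\<not> (\<exists>u\<in>Z. \<exists>w\<in>R v \<union> B - Z. E u w)"
    have "3 \<le> card (Nb (M v) ?L)"
    proof (rule region_nb[OF v])
      show "?L \<noteq> {}" using Z by blast
      show "\<forall>u\<in>?L. \<forall>y\<in>R v - ?L. \<not> E u y" using n E_sym by blast
    qed blast
    moreover have "Nb (M v) ?L \<subseteq> M v - B"
    proof
      fix t assume t: "t \<in> Nb (M v) ?L"
      then obtain w where "w \<in> ?L" "E w t" unfolding Nb_def by blast
      then have "t \<notin> B" using n Z(1) E_sym by blast
      then show "t \<in> M v - B" using t unfolding Nb_def by blast
    qed
    then have "card (Nb (M v) ?L) \<le> card (M v - B)" using fM by (intro card_mono) auto
    ultimately show False using B(2) by linarith
  qed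
qed

text \<open>A vertex of \<open>M v\<close> that does not separate \<open>V - {v, b}\<close>: a smallest piece cut off by the other
  neighbours of \<open>v\<close> would avoid \<open>M v\<close> and thus be separated by two vertices.\<close>

lemma exists_noncut:
  assumes v: "v \<in> V" and b: "b \<in> M v"
  shows "\<exists>c\<in>M v - {b}. conn (V - {v,b} - {c})"
proof (rule ccontr)
  assume n: "\<not> ?thesis"
  let ?H = "V - {v,b}"
  have bV: "b \<in> V" using b M_iff by blast
  have cH: "conn ?H" by (rule no2[OF v bV])
  define pc where "pc c D \<longleftrightarrow> c \<in> M v - {b} \<and> D \<subseteq> ?H - {c} \<and> D \<noteq> {} \<and> ?H - {c} - D \<noteq> {} \<and>
     (\<forall>u\<in>D. \<forall>y\<in>?H - {c} - D. \<not> E u y)" for c D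
  have ex: "\<exists>D. pc c D" if c: "c \<in> M v - {b}" for c
  proof -
    have "\<not> conn (?H - {c})" using n c by blast
    moreover have "?H - {c} \<noteq> {}"
    proof
      assume "?H - {c} = {}"
      then have "V \<subseteq> {v,b,c}" by blast
      then have "card V \<le> card {v,b,c}" by (intro card_mono) auto
      also have "\<dots> \<le> 3" by (simp add: card_insert_if)
      finally show False using ncol_card[of V q] V q3 unfolding crit_def by simp
    qed
    ultimately obtain X where "X \<subset> ?H - {c}" "X \<noteq> {}" "\<not> (\<exists>u\<in>X. \<exists>y\<in>?H - {c} - X. E u y)"
      using connI[of "?H - {c}"] by blast
    then show ?thesis unfolding pc_def using c by (intro exI[of _ X]) blast
  qed
  define md where "md = (LEAST n. \<exists>c D. pc c D \<and> card D = n)"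
  have "card (M v - {b}) \<noteq> 0" using deg[OF v] q3 b fM by simp
  then obtain c0 where "c0 \<in> M v - {b}" by (metis card.empty equals0I)
  then have "\<exists>n c D. pc c D \<and> card D = n" using ex by blast
  then have "\<exists>c D. pc c D \<and> card D = md" unfolding md_def by (rule LeastI_ex)
  then obtain c D where cD: "pc c D" "card D = md" by blast
  have min: "md \<le> card D'" if "pc c' D'" for c' D' unfolding md_def by (rule Least_le) (use that in blast)
  have D: "c \<in> M v - {b}" "D \<subseteq> ?H - {c}" "D \<noteq> {}" "?H - {c} - D \<noteq> {}" "\<forall>u\<in>D. \<forall>y\<in>?H - {c} - D. \<not> E u y"
    using cD(1) unfolding pc_def by auto
  have fD: "finite D" using D(2) fV finite_subset[of D V] by blast
  have cHin: "c \<in> ?H" using D(1) M_iff E_irr by blast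
  \<comment> \<open>Suppose \<open>D\<close> contains a neighbour \<open>c'\<close> of
    \<open>v\<close>. What lies outside \<open>D\<close> is connected through \<open>c\<close> and
    avoids \<open>c'\<close>, so it is on one side of the partition obtained by deleting
    \<open>c'\<close>. The other side is inside \<open>D - {c'}\<close> and contradicts
    minimality.\<close>
  have Dno: "D \<inter> M v = {}"
  proof (rule ccontr)
    assume "D \<inter> M v \<noteq> {}"
    then obtain c' where c': "c' \<in> D" "c' \<in> M v" by blast
    then have c'b: "c' \<in> M v - {b}" using D(2) by blast
    obtain D' where D': "pc c' D'" using ex[OF c'b] by blast
    let ?W = "?H - D"
    have "cov ?W {c}"
    proof (rule covI)
      show "{c} \<subseteq> ?W" using cHin D(2) by blast
      fix Z assume Z: "{c} \<subseteq> Z" "Z \<subset> ?W"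
      have "Z \<union> D \<subset> ?H" "Z \<union> D \<noteq> {}" using Z D(2) by blast+
      from conn_edge[OF cH this] obtain u y where uy: "u \<in> Z \<union> D" "y \<in> ?H" "y \<notin> Z \<union> D" "E u y" by blast
      have "y \<in> ?H - {c} - D" using uy Z by blast
      then have "u \<notin> D" using D(5) uy(4) by blast
      then show "\<exists>u\<in>Z. \<exists>y\<in>?W - Z. E u y" using uy by blast
    qed
    then have cW: "conn ?W" by (rule conn_root)
    have WH: "?W \<subseteq> ?H - {c'}" using c' by blast
    have sm: False if P: "P \<subseteq> ?H - {c'}" "P \<noteq> {}" "?H - {c'} - P \<noteq> {}" "\<forall>u\<in>P. \<forall>y\<in>?H - {c'} - P. \<not> E u y" "P \<inter> ?W = {}" for P
    proof -
      have "pc c' P" unfolding pc_def using c'b P by blast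
      then have "md \<le> card P" by (rule min)
      moreover have "P \<subseteq> D - {c'}" using P(1,5) by blast
      then have "card P \<le> card (D - {c'})" using fD by (intro card_mono) auto
      moreover have "card (D - {c'}) < card D" by (rule card_Diff1_less[OF fD c'(1)])
      ultimately show False using cD(2) by linarith
    qed
    have D'p: "D' \<subseteq> ?H - {c'}" "D' \<noteq> {}" "?H - {c'} - D' \<noteq> {}" "\<forall>u\<in>D'. \<forall>y\<in>?H - {c'} - D'. \<not> E u y"
      using D' unfolding pc_def by auto
    show False
    proof (cases "D' \<inter> ?W = {}")
      case True then show False using sm[OF D'p] by blast
    next
      case False
      have "?W \<subseteq> D'"
      proof (rule ccontr)
        assume "\<not> ?W \<subseteq> D'"
        then have "D' \<inter> ?W \<subset> ?W" by blast
        from conn_edge[OF cW this False] obtain u y where "u \<in> D' \<inter> ?W" "y \<in> ?W" "y \<notin> D' \<inter> ?W" "E u y" by blast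
        then show False using D'p(4) WH by blast
      qed
      let ?P = "?H - {c'} - D'"
      show False
      proof (rule sm[of ?P])
        show "?H - {c'} - ?P \<noteq> {}" using D'p(1,2) by blast
        show "\<forall>u\<in>?P. \<forall>y\<in>?H - {c'} - ?P. \<not> E u y" using D'p(4) E_sym by blast
        show "?P \<inter> ?W = {}" using \<open>?W \<subseteq> D'\<close> by blast
      qed (use D'p(3) in auto)
    qed
  qed
  have DR: "D \<subseteq> R v" using D(2) Dno R_iff M_iff by blast
  \<comment> \<open>Since \<open>D\<close> contains no neighbour of \<open>v\<close>, the two
    vertices \<open>b\<close> and \<open>c\<close> separate it from \<open>v\<close>.\<close>
  have "D \<subseteq> V - {b,c}" using D(2) by blast
  moreover have "v \<in> V - {b,c} - D" using v b D(1,2) MR(3)[of v] by blast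
  ultimately obtain u y where uy: "u \<in> D" "y \<in> V - {b,c} - D" "E u y"
    using sep2[OF bV _ _ D(3), of c] cHin by blast
  have "y \<noteq> v" using uy DR R_iff E_sym by blast
  then have "y \<in> ?H - {c} - D" using uy by blast
  then show False using D(5) uy by blast
qed

end

section \<open>Estimates around a vertex of degree at least four for \<open>q = 3\<close>\<close>

locale crit4 = crit3 E q V for E :: "'a \<Rightarrow> 'a \<Rightarrow> bool" and q V +
  assumes q_eq: "q = 3"
begin

lemma rx: "r = 1/3" "x = 2/3"
  unfolding x_def r_def using q_eq by simp_all

lemma Ph_W:
  assumes "finite S" "cov S A" "finite W" "n \<le> card W"
  shows "Ph S A W \<le> (1/3) ^ n * om A"
proof -
  have "Ph S A W \<le> r ^ card W * om A" by (rule Ph_le_om) (use assms in auto)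
  also have "\<dots> \<le> r ^ n * om A" using r_pow_anti[OF assms(4)] om_pos[of A] by (intro mult_right_mono) auto
  finally show ?thesis unfolding rx .
qed

lemma nb_minus:
  assumes "z \<in> V" "v \<in> V" "E z v"
  shows "2 \<le> card (Nb (V - {v}) {z})"
proof -
  have "Nb (V - {v}) {z} = M z - {v}" using M_iff unfolding Nb_def by blast
  moreover have "v \<in> M z" using assms M_iff by blast
  ultimately show ?thesis using deg[OF assms(1)] fM q_eq by simp
qed

text \<open>\<open>S\<close> contains all neighbours of \<open>a\<close> and \<open>b\<close> other
  than \<open>v\<close>. By minimum degree there are two for each, and by
  \<open>crit_neighbours\<close> the vertex \<open>a\<close> has one that \<open>b\<close>
  lacks.\<close>

lemma nb_union:
  assumes "v \<in> V" "a \<in> M v" "b \<in> M v" "a \<noteq> b" "\<not> E a b" "finite S"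
    and "(V - {v,a,b}) \<inter> (Nb V {a} \<union> Nb V {b}) \<subseteq> S" "S \<subseteq> V - {v,a,b}"
  shows "2 \<le> card (Nb S {a})" "2 \<le> card (Nb S {b})" "3 \<le> card (Nb S {a} \<union> Nb S {b})"
proof -
  have V': "a \<in> V" "b \<in> V" "E a v" "E b v" using assms M_iff E_sym by auto
  have ba: "\<not> E b a" using assms E_sym by blast
  have "Nb S {a} = Nb (V - {v}) {a}" "Nb S {b} = Nb (V - {v}) {b}"
    using assms(5,7,8) ba E_irr unfolding Nb_def by blast+
  then show 2: "2 \<le> card (Nb S {a})" "2 \<le> card (Nb S {b})"
    using nb_minus[OF V'(1) assms(1) V'(3)] nb_minus[OF V'(2) assms(1) V'(4)] by auto
  have "\<not> Nb V {a} \<subseteq> Nb V {b}" by (rule crit_neighbours[OF V]) (use V' assms in auto)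
  then obtain y where y: "y \<in> V" "E a y" "\<not> E b y" unfolding Nb_def by auto
  then have "y \<noteq> v" "y \<noteq> a" "y \<noteq> b" using V'(4) assms(5) E_irr by auto
  then have "y \<in> Nb S {a} - Nb S {b}" using y assms(7) unfolding Nb_def by blast
  then have "Nb S {b} \<subset> Nb S {a} \<union> Nb S {b}" by blast
  then have "card (Nb S {b}) < card (Nb S {a} \<union> Nb S {b})"
    by (rule psubset_card_mono[rotated]) (use assms(6) in \<open>auto simp: Nb_def\<close>)
  then show "3 \<le> card (Nb S {a} \<union> Nb S {b})" using 2 by linarith
qed

text \<open>Two absorptions produce four sums, in which nothing, one of the neighbour sets, or both
  are forced. The last three contribute
  \<open>2 * (2/9) * (1/9) + (1/9) * (1/27) = 13/243\<close>.\<close>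

lemma absorb_two:
  assumes v: "v \<in> V" and ab: "a \<in> M v" "b \<in> M v" "a \<noteq> b" "\<not> E a b"
    and S: "finite S" "cov S A" "a \<notin> S" "b \<notin> S"
    and nb: "(V - {v,a,b}) \<inter> (Nb V {a} \<union> Nb V {b}) \<subseteq> S" "S \<subseteq> V - {v,a,b}"
  shows "Ph (insert a (insert b S)) (insert a (insert b A)) {} \<le> 4/9 * Ph S A {} + 13/243 * om A"
proof -
  have AS: "A \<subseteq> S" using cov_subset[OF S(2)] .
  let ?W1 = "Nb S {a}" and ?W2 = "Nb S {b}"
  have fW: "finite ?W1" "finite ?W2" using S(1) unfolding Nb_def by auto
  have e: "Nb (insert b S) {a} = ?W1" using ab(4) unfolding Nb_def by auto
  have w: "2 \<le> card ?W1" "2 \<le> card ?W2" "3 \<le> card (?W1 \<union> ?W2)"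
    using nb_union[OF v ab S(1) nb] by auto
  have "Ph (insert a (insert b S)) (insert a (insert b A)) {} \<le> x * Ph (insert b S) (insert b A) {} + r * Ph (insert b S) (insert b A) ({} \<union> Nb (insert b S) {a})"
    by (rule Ph_absorb1) (use S AS ab in auto)
  also have "\<dots> = 2/3 * Ph (insert b S) (insert b A) {} + 1/3 * Ph (insert b S) (insert b A) ?W1"
    unfolding rx e by simp
  finally have 0: "Ph (insert a (insert b S)) (insert a (insert b A)) {} \<le> 2/3 * Ph (insert b S) (insert b A) {} + 1/3 * Ph (insert b S) (insert b A) ?W1" .
  have 1: "Ph (insert b S) (insert b A) X \<le> 2/3 * Ph S A X + 1/3 * Ph S A (X \<union> ?W2)" for X
    using Ph_absorb1[OF S(1,4) AS, of X] unfolding rx by simp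
  have 2: "Ph S A ?W2 \<le> 1/9 * om A" "Ph S A ?W1 \<le> 1/9 * om A" "Ph S A (?W1 \<union> ?W2) \<le> 1/27 * om A"
    using Ph_W[OF S(1,2) fW(2) w(2)] Ph_W[OF S(1,2) fW(1) w(1)] Ph_W[OF S(1,2) _ w(3)] fW
    by (simp_all add: power2_eq_square power3_eq_cube)
  show ?thesis using 0 1[of "{}"] 1[of ?W1] 2 by simp
qed

text \<open>An edge inside \<open>M v\<close> serves as the connected set \<open>B\<close>, and
  absorbing one root \<open>b\<close> gives \<open>2/3 * 34/81 + 1/3 * 1/9 = 77/243\<close>. If
  there is no such edge, two roots are absorbed, with \<open>exists_noncut\<close> keeping the rest
  connected; then \<open>4/9 * 17/27 + 13/243\<close> is exactly 1/3.\<close>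

lemma Ph_le_third_degree_five:
  assumes v: "v \<in> V" and d: "5 \<le> card (M v)"
  shows "Ph (V - {v}) (M v) {} \<le> 1/3"
proof (cases "\<exists>m\<in>M v. \<exists>m'\<in>M v. E m m'")
  case True
  then obtain m m' where m: "m \<in> M v" "m' \<in> M v" "E m m'" by blast
  have mm: "m \<noteq> m'" using m E_irr by auto
  obtain b where b: "b \<in> M v" "b \<noteq> m" "b \<noteq> m'"
  proof -
    have "\<not> M v \<subseteq> {m,m'}" using d card_mono[of "{m,m'}" "M v"] mm by auto
    then show ?thesis using that by blast
  qed
  have bV: "b \<in> V" "E b v" "b \<noteq> v" using b M_iff E_sym E_irr by auto
  let ?S = "V - {v,b}" and ?A = "M v - {b}" and ?B = "{m,m'}"
  have cS: "conn ?S" by (rule no2[OF v bV(1)])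
  have AS: "?A \<subseteq> ?S" using M_iff E_irr by blast
  have BA: "?B \<subseteq> ?A" using m b by blast
  have fS: "finite ?S" using fV by simp
  have covS: "cov ?S ?A" by (rule conn_cov[OF cS AS]) (use BA in blast)
  have cB: "conn ?B" using conn_insert[OF conn_singleton, of m m m'] m(3) by (simp add: insert_commute)
  have cA: "card (?A - ?B) = card (M v) - 3"
  proof -
    have "?A - ?B = M v - {b,m,m'}" by blast
    then show ?thesis using fM m b mm by (simp add: card_Diff_subset)
  qed
  have "Ph ?S ?A {} \<le> x ^ (card ?B - 1) * (x ^ Suc (card (?A - ?B)) + r)"
    by (rule Ph_conn_bound[OF fS cS cB BA AS])
  also have "\<dots> = 2/3 * (x ^ Suc (card (?A - ?B)) + 1/3)" using mm unfolding rx by simp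
  also have "x ^ Suc (card (?A - ?B)) \<le> x ^ 3" by (rule x_pow_anti) (use cA d in simp)
  finally have 1: "Ph ?S ?A {} \<le> 34/81" unfolding rx by (simp add: power3_eq_cube)
  have "2 \<le> card (Nb (V - {v}) {b})" by (rule nb_minus[OF bV(1) v bV(2)])
  moreover have "Nb (V - {v}) {b} = Nb ?S {b}" using E_irr unfolding Nb_def by blast
  ultimately have 2: "Ph ?S ?A (Nb ?S {b}) \<le> 1/9"
    using Ph_W[OF fS covS, of "Nb ?S {b}" 2] om_le1[of ?A] fS unfolding Nb_def by (simp add: power2_eq_square)
  have "Ph (insert b ?S) (insert b ?A) {} \<le> x * Ph ?S ?A {} + r * Ph ?S ?A ({} \<union> Nb ?S {b})"
    by (rule Ph_absorb1[OF fS _ AS]) simp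
  moreover have "insert b ?S = V - {v}" "insert b ?A = M v" using b bV by auto
  ultimately have "Ph (V - {v}) (M v) {} \<le> 2/3 * Ph ?S ?A {} + 1/3 * Ph ?S ?A (Nb ?S {b})" unfolding rx by simp
  then show ?thesis using 1 2 by simp
next
  case False
  obtain b where b: "b \<in> M v" using d by fastforce
  obtain c where c: "c \<in> M v" "c \<noteq> b" "conn (V - {v,b} - {c})" using exists_noncut[OF v b] by blast
  let ?S = "V - {v,b,c}" and ?A = "M v - {b,c}"
  have Seq: "V - {v,b} - {c} = ?S" by blast
  have cS: "conn ?S" using c(3) unfolding Seq .
  have bc: "\<not> E b c" "b \<in> V" "c \<in> V" "b \<noteq> v" "c \<noteq> v" using False b c M_iff E_irr by auto
  have AS: "?A \<subseteq> ?S" using M_iff E_irr by blast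
  have fS: "finite ?S" using fV by simp
  have cA: "card ?A = card (M v) - 2" using b c fM by (simp add: card_Diff_subset)
  then have A3: "3 \<le> card ?A" using d by simp
  then have "?A \<noteq> {}" by (metis card.empty not_numeral_le_zero)
  then obtain a where a: "a \<in> ?A" by blast
  have covS: "cov ?S ?A" by (rule conn_cov[OF cS AS]) (use a in blast)
  have "Ph ?S ?A {} \<le> x ^ (card {a} - 1) * (x ^ Suc (card (?A - {a})) + r)"
    by (rule Ph_conn_bound[OF fS cS conn_singleton _ AS]) (use a in blast)
  moreover have "Suc (card (?A - {a})) = card ?A" by (rule card_Suc_Diff1) (use fM a in auto)
  moreover have "x ^ (card {a} - 1) = 1" by simp
  ultimately have "Ph ?S ?A {} \<le> x ^ card ?A + r" by (simp only: mult_1_left)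
  moreover have "x ^ card ?A \<le> x ^ 3" by (rule x_pow_anti[OF A3])
  ultimately have 1: "Ph ?S ?A {} \<le> 17/27" unfolding rx by (simp add: power3_eq_cube)
  have "Ph (insert b (insert c ?S)) (insert b (insert c ?A)) {} \<le> 4/9 * Ph ?S ?A {} + 13/243 * om ?A"
    by (rule absorb_two[OF v b c(1) c(2)[symmetric] bc(1) fS covS]) auto
  moreover have "insert b (insert c ?S) = V - {v}" "insert b (insert c ?A) = M v" using b c bc by auto
  ultimately have "Ph (V - {v}) (M v) {} \<le> 4/9 * Ph ?S ?A {} + 13/243 * om ?A" by simp
  then show ?thesis using 1 om_le1[of ?A] by simp
qed

text \<open>The ends of the edge cover \<open>R v\<close> by \<open>cov_roots\<close> and have
  \<open>om\<close> at most 2/3. If the other two neighbours are not adjacent,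
  \<open>absorb_two\<close> gives 242/729, just below 243/729; if they are, absorbing them as one
  block gives 76/243.\<close>

lemma Ph_le_third_degree_four_edge:
  assumes v: "v \<in> V" and d: "card (M v) = 4" and m: "m \<in> M v" "m' \<in> M v" "E m m'"
  shows "Ph (V - {v}) (M v) {} \<le> 1/3"
proof -
  have mm: "m \<noteq> m'" using m E_irr by auto
  let ?B = "{m,m'}"
  have "card (M v - ?B) = 2" using d m mm fM by (simp add: card_Diff_subset)
  then obtain z1 z2 where z: "M v - ?B = {z1,z2}" "z1 \<noteq> z2" by (meson card_2_iff)
  have zM: "z1 \<in> M v" "z2 \<in> M v" "z1 \<notin> ?B" "z2 \<notin> ?B" using z by blast+
  let ?T = "R v \<union> ?B"
  have fT: "finite ?T" using fR by simp
  have covT: "cov ?T ?B" by (rule cov_roots[OF v]) (use m z in auto)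
  have cB: "conn ?B" using conn_insert[OF conn_singleton, of m m m'] m(3) by (simp add: insert_commute)
  have omB: "om ?B \<le> 2/3" using om_conn[OF cB] mm unfolding rx by simp
  have PhT: "Ph ?T ?B {} \<le> 2/3" using Ph_le_om0[OF fT covT] omB by linarith
  have zT: "z1 \<notin> ?T" "z2 \<notin> ?T" using zM MR(2)[of v] by blast+
  have Meq: "M v = {m,m',z1,z2}" using z(1) m by blast
  have Veq: "V - {v} = insert z1 (insert z2 ?T)" using MR(1)[OF v] unfolding Meq by blast
  show ?thesis
  proof (cases "E z1 z2")
    case False
    have "Ph (insert z1 (insert z2 ?T)) (insert z1 (insert z2 ?B)) {} \<le> 4/9 * Ph ?T ?B {} + 13/243 * om ?B"
      by (rule absorb_two[OF v zM(1,2) z(2) False fT covT zT])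
        (use MR(1)[OF v] Meq zT R_iff m M_iff E_irr in blast)+
    moreover have "insert z1 (insert z2 ?B) = M v" unfolding Meq by blast
    ultimately have "Ph (V - {v}) (M v) {} \<le> 4/9 * Ph ?T ?B {} + 13/243 * om ?B" unfolding Veq by simp
    then show ?thesis using PhT omB by simp
  next
    case True
    let ?K = "{z1,z2}"
    have cK: "conn ?K" using conn_insert[OF conn_singleton, of z1 z1 z2] True by (simp add: insert_commute)
    \<comment> \<open>With fewer neighbours, \<open>v\<close> and the possible single neighbour
      \<open>w\<close> would cut off the block; \<open>w = v\<close> if there is none.\<close>
    have "2 \<le> card (Nb ?T ?K)"
    proof (rule ccontr)
      assume "\<not> 2 \<le> card (Nb ?T ?K)"
      then have c1: "card (Nb ?T ?K) \<le> Suc 0" by simp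
      have fN: "finite (Nb ?T ?K)" using fT unfolding Nb_def by simp
      then have one: "\<forall>a\<in>Nb ?T ?K. \<forall>b\<in>Nb ?T ?K. a = b" using c1 card_le_Suc0_iff_eq by blast
      have TV: "?T \<subseteq> V - {v}" using MR(1)[OF v] m by blast
      define w where "w = (if Nb ?T ?K = {} then v else (SOME a. a \<in> Nb ?T ?K))"
      have wN: "w \<in> Nb ?T ?K" if "Nb ?T ?K \<noteq> {}" using that unfolding w_def by (simp add: some_in_eq)
      have w: "Nb ?T ?K \<subseteq> {w}" using one wN by blast
      have wv: "w = v \<or> w \<in> ?T"
      proof (cases "Nb ?T ?K = {}")
        case True then show ?thesis unfolding w_def by simp
      next
        case False then show ?thesis using wN unfolding Nb_def by blast
      qed
      have KV: "?K \<subseteq> V - {v,w}" using zM zT wv M_iff E_irr by blast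
      have "m \<in> V - {v,w} - ?K \<or> m' \<in> V - {v,w} - ?K"
        using m mm zM M_iff E_irr by blast
      then have ne: "V - {v,w} - ?K \<noteq> {}" by blast
      have "w \<in> V" using wv TV v by blast
      from sep2[OF v this KV _ ne] obtain u y where uy: "u \<in> ?K" "y \<in> V - {v,w} - ?K" "E u y" by blast
      have "y \<in> ?T" using uy(2) Veq by blast
      then have "y \<in> Nb ?T ?K" using uy unfolding Nb_def by blast
      then show False using w uy(2) by blast
    qed
    then have 1: "Ph ?T ?B (Nb ?T ?K) \<le> 2/27"
      using Ph_W[OF fT covT, of "Nb ?T ?K" 2] omB fT unfolding Nb_def by (simp add: power2_eq_square)
    have "Ph (?T \<union> ?K) (?B \<union> ?K) {} \<le> x ^ card ?K * Ph ?T ?B {} + x ^ (card ?K - 1) * r * Ph ?T ?B ({} \<union> Nb ?T ?K)"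
      by (rule Ph_absorb) (use fT zT cK in auto)
    moreover have "?T \<union> ?K = V - {v}" "?B \<union> ?K = M v" using Veq Meq by blast+
    ultimately have "Ph (V - {v}) (M v) {} \<le> 4/9 * Ph ?T ?B {} + 2/9 * Ph ?T ?B (Nb ?T ?K)"
      using z(2) unfolding rx by (simp add: power2_eq_square)
    then show ?thesis using PhT 1 by simp
  qed
qed

text \<open>Since \<open>M v\<close> is independent, a 2-coloring of \<open>R v\<close> would give a
  3-coloring of \<open>V\<close>, with \<open>v\<close> sharing a color of \<open>R v\<close>. So
  \<open>R v\<close> contains a critical set for two colors, and \<open>Ph_cycle\<close> gives
  \<open>1 - 2/27 = 25/27\<close> at the root. Absorbing the other three neighbours yields
  \<open>8/27 * 25/27 + 3 * 4/27 * 1/9 + 3 * 2/27 * 1/27 + 1/27 * 1/27\<close>, which is exactly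
  1/3.\<close>

lemma Ph_le_third_degree_four_root:
  assumes v: "v \<in> V" and d: "card (M v) = 4" and ind: "\<forall>m\<in>M v. \<forall>m'\<in>M v. \<not> E m m'"
    and u: "u \<in> M v" "cov (R v \<union> {u}) {u}"
  shows "Ph (V - {v}) (M v) {} \<le> 1/3"
proof -
  let ?T = "R v \<union> {u}"
  have fT: "finite ?T" using fR by simp
  have ncol: "\<not> col (R v) 2"
  proof
    assume "col (R v) 2"
    then obtain c :: "'a \<Rightarrow> nat" where c: "\<forall>y\<in>R v. c y < 2" "\<forall>y\<in>R v. \<forall>z\<in>R v. E y z \<longrightarrow> c y \<noteq> c z" unfolding col_def by blast
    have "V - M v = insert v (R v)" using MR(1)[OF v] MR(2,3)[of v] v by blast
    moreover have "col (insert v (R v)) 2" unfolding col_def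
    proof (intro exI[of _ "c(v := 0)"] conjI ballI impI)
      fix y z assume yz: "y \<in> insert v (R v)" "z \<in> insert v (R v)" "E y z"
      then have "y \<noteq> v" "z \<noteq> v" using R_iff E_sym E_irr by blast+
      then show "(c(v := 0)) y \<noteq> (c(v := 0)) z" using c(2) yz by auto
    qed (use c(1) in auto)
    ultimately have "col (V - M v) 2" by simp
    moreover have "indep (M v)" using ind unfolding indep_def .
    ultimately have "col V (Suc 2)" using col_indep by blast
    then show False using V q_eq unfolding crit_def by (simp add: numeral_3_eq_3)
  qed
  obtain Y where Y: "Y \<subseteq> R v" "crit Y 2" using crit_exists[OF fR ncol] by blast
  have Y3: "3 \<le> card Y" using ncol_card[of Y 2] Y(2) unfolding crit_def by simp
  have g: "Ph ?T {u} {} \<le> (1 - x * r\<^sup>2) * om {u}"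
  proof (rule Ph_cycle[OF fT u(2), of Y])
    show "conn Y" by (rule crit_conn[OF Y(2)]) simp
    fix w assume w: "w \<in> Y"
    have "Y - {w} \<noteq> {}"
    proof
      assume "Y - {w} = {}"
      then have "Y \<subseteq> {w}" by blast
      then have "card Y \<le> card {w}" by (rule card_mono[rotated]) simp
      then show False using Y3 by simp
    qed
    then show "conn (Y - {w})" by (rule crit_conn_Diff1[OF Y(2) w])
  next
    have "Y \<inter> {u} \<subseteq> {u}" by blast
    then have "card (Y \<inter> {u}) \<le> card {u}" by (rule card_mono[rotated]) simp
    then show "card (Y \<inter> {u}) \<le> 1" by simp
  qed (use Y Y3 in auto)
  have om1: "om {u} \<le> 1" by (rule om_le1)
  have "(1 - x * r\<^sup>2) * om {u} \<le> 25/27" using om1 unfolding rx by (simp add: power2_eq_square)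
  then have g': "Ph ?T {u} {} \<le> 25/27" using g by linarith
  have "card (M v - {u}) = 3" using d u fM by simp
  then obtain z1 z2 z3 where z: "M v - {u} = {z1,z2,z3}" "z1 \<noteq> z2" "z1 \<noteq> z3" "z2 \<noteq> z3" by (metis card_3_iff)
  have zM: "z1 \<in> M v" "z2 \<in> M v" "z3 \<in> M v" "z1 \<noteq> u" "z2 \<noteq> u" "z3 \<noteq> u" using z by blast+
  have Meq: "M v = {u,z1,z2,z3}" using z(1) u(1) by blast
  have zT: "z1 \<notin> ?T" "z2 \<notin> ?T" "z3 \<notin> ?T" using zM MR(2)[of v] by blast+
  have Veq: "V - {v} = insert z3 (insert z2 (insert z1 ?T))" using MR(1)[OF v] unfolding Meq by blast
  have nz: "\<not> E z1 z2" "\<not> E z1 z3" "\<not> E z2 z3" "\<not> E z3 z1" "\<not> E z3 z2" "\<not> E z2 z1" using ind zM by auto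
  let ?W1 = "Nb ?T {z1}" and ?W2 = "Nb ?T {z2}" and ?W3 = "Nb ?T {z3}"
  have fW: "finite ?W1" "finite ?W2" "finite ?W3" using fT unfolding Nb_def by auto
  have TV: "?T \<subseteq> V - {v}" using Veq by blast
  have nT: "(V - {v,a,b}) \<inter> (Nb V {a} \<union> Nb V {b}) \<subseteq> ?T" "?T \<subseteq> V - {v,a,b}" if "a \<in> {z1,z2,z3}" "b \<in> {z1,z2,z3}" for a b
  proof
    fix y assume y: "y \<in> (V - {v,a,b}) \<inter> (Nb V {a} \<union> Nb V {b})"
    have am: "a \<in> M v" "b \<in> M v" using that zM by blast+
    have yV: "y \<in> V" "y \<noteq> v" "E a y \<or> E b y" using y unfolding Nb_def by auto
    then have "y \<notin> M v" using ind am by blast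
    then show "y \<in> ?T" using yV M_iff R_iff by blast
  next
    show "?T \<subseteq> V - {v,a,b}" using TV that zT by blast
  qed
  have w12: "2 \<le> card ?W1" "2 \<le> card ?W2" "3 \<le> card (?W1 \<union> ?W2)"
    using nb_union[OF v zM(1,2) z(2) nz(1) fT nT] by auto
  have w13: "2 \<le> card ?W3" "3 \<le> card (?W1 \<union> ?W3)"
    using nb_union[OF v zM(1,3) z(3) nz(2) fT nT] by auto
  have w23: "3 \<le> card (?W2 \<union> ?W3)"
    using nb_union[OF v zM(2,3) z(4) nz(3) fT nT] by auto
  have w123: "3 \<le> card (?W3 \<union> ?W2 \<union> ?W1)"
  proof -
    have "card (?W2 \<union> ?W3) \<le> card (?W3 \<union> ?W2 \<union> ?W1)" using fW by (intro card_mono) auto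
    then show ?thesis using w23 by linarith
  qed
  have PW: "Ph ?T {u} W \<le> (1/3) ^ n" if "finite W" "n \<le> card W" for W n
  proof -
    have "Ph ?T {u} W \<le> (1/3) ^ n * om {u}" by (rule Ph_W[OF fT u(2) that])
    also have "\<dots> \<le> (1/3) ^ n * 1" using om1 by (intro mult_left_mono) auto
    finally show ?thesis by simp
  qed
  let ?S1 = "insert z1 ?T" and ?A1 = "insert z1 {u}"
  let ?S2 = "insert z2 ?S1" and ?A2 = "insert z2 ?A1"
  have e2: "Nb ?S1 {z2} = ?W2" using nz unfolding Nb_def by auto
  have e3: "Nb ?S2 {z3} = ?W3" using nz unfolding Nb_def by auto
  have s1: "Ph ?S1 ?A1 X \<le> 2/3 * Ph ?T {u} X + 1/3 * Ph ?T {u} (X \<union> ?W1)" for X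
    using Ph_absorb1[OF fT zT(1), of "{u}" X] unfolding rx by simp
  have s2: "Ph ?S2 ?A2 X \<le> 2/3 * Ph ?S1 ?A1 X + 1/3 * Ph ?S1 ?A1 (X \<union> ?W2)" for X
    using Ph_absorb1[of ?S1 z2 ?A1 X] fT zT z(2) unfolding rx e2 by auto
  have s3: "Ph (insert z3 ?S2) (insert z3 ?A2) {} \<le> 2/3 * Ph ?S2 ?A2 {} + 1/3 * Ph ?S2 ?A2 ?W3"
    using Ph_absorb1[of ?S2 z3 ?A2 "{}"] fT zT z(3,4) unfolding rx e3 by auto
  have b: "Ph ?T {u} ?W1 \<le> 1/9" "Ph ?T {u} ?W2 \<le> 1/9" "Ph ?T {u} ?W3 \<le> 1/9"
    "Ph ?T {u} (?W2 \<union> ?W1) \<le> 1/27" "Ph ?T {u} (?W3 \<union> ?W1) \<le> 1/27" "Ph ?T {u} (?W3 \<union> ?W2) \<le> 1/27"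
    "Ph ?T {u} (?W3 \<union> ?W2 \<union> ?W1) \<le> 1/27"
    using PW[of ?W1 2] PW[of ?W2 2] PW[of ?W3 2] PW[of "?W2 \<union> ?W1" 3] PW[of "?W3 \<union> ?W1" 3] PW[of "?W3 \<union> ?W2" 3]
      PW[of "?W3 \<union> ?W2 \<union> ?W1" 3] fW w12 w13 w23 w123
    by (simp_all add: Un_commute power2_eq_square power3_eq_cube)
  have "Ph ?S1 ?A1 {} \<le> 2/3 * (25/27) + 1/3 * (1/9)" using s1[of "{}"] g' b by simp
  moreover have "Ph ?S1 ?A1 ?W2 \<le> 2/3 * (1/9) + 1/3 * (1/27)" using s1[of ?W2] b by simp
  moreover have "Ph ?S1 ?A1 ?W3 \<le> 2/3 * (1/9) + 1/3 * (1/27)" using s1[of ?W3] b by simp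
  moreover have "Ph ?S1 ?A1 (?W3 \<union> ?W2) \<le> 2/3 * (1/27) + 1/3 * (1/27)" using s1[of "?W3 \<union> ?W2"] b by simp
  ultimately have "Ph (insert z3 ?S2) (insert z3 ?A2) {} \<le> 1/3"
    using s3 s2[of "{}"] s2[of ?W3] by simp
  moreover have "insert z3 ?A2 = M v" unfolding Meq by blast
  ultimately show ?thesis unfolding Veq by simp
qed

text \<open>Each neighbour \<open>u\<close> of \<open>v\<close> misses some union \<open>L u\<close>
  of components of \<open>R v\<close>. By \<open>region_nb\<close> the other three neighbours all
  touch it, so the sets \<open>L u\<close> are disjoint, and every neighbour of \<open>v\<close> has
  three neighbours in \<open>R v\<close>. Forced sets of size three make the losses small
  enough.\<close>

lemma Ph_le_third_degree_four_no_root: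
  assumes v: "v \<in> V" and d: "card (M v) = 4"
    and n: "\<And>u. u \<in> M v \<Longrightarrow> \<not> cov (R v \<union> {u}) {u}"
  shows "Ph (V - {v}) (M v) {} \<le> 1/3"
proof -
  define cl' where "cl' L \<longleftrightarrow> L \<subseteq> R v \<and> L \<noteq> {} \<and> (\<forall>a\<in>L. \<forall>y\<in>R v - L. \<not> E a y)" for L
  have "\<exists>L. cl' L \<and> (\<forall>y\<in>L. \<not> E u y)" if u: "u \<in> M v" for u
  proof -
    obtain Z where Z: "{u} \<subseteq> Z" "Z \<subset> R v \<union> {u}" "\<not> (\<exists>a\<in>Z. \<exists>y\<in>R v \<union> {u} - Z. E a y)"
      using covI[of "{u}" "R v \<union> {u}"] n[OF u] by blast
    have "cl' (R v - Z)" unfolding cl'_def using Z E_sym by blast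
    moreover have "\<forall>y\<in>R v - Z. \<not> E u y" using Z by blast
    ultimately show ?thesis by blast
  qed
  then obtain L where L: "\<And>u. u \<in> M v \<Longrightarrow> cl' (L u) \<and> (\<forall>y\<in>L u. \<not> E u y)" by metis
  have nbL: "3 \<le> card (Nb (M v) B)" if "cl' B" for B
    using region_nb[OF v] that unfolding cl'_def by blast
  \<comment> \<open>\<open>B\<close> has three neighbours in the four-element set
    \<open>M v\<close>, and \<open>u\<close> is not among them.\<close>
  have hit: "\<exists>y\<in>B. E b y" if "cl' B" "u \<in> M v" "\<forall>y\<in>B. \<not> E u y" "b \<in> M v" "b \<noteq> u" for B u b
  proof (rule ccontr)
    assume nb: "\<not> (\<exists>y\<in>B. E b y)"
    have "Nb (M v) B \<subseteq> M v - {u,b}"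
    proof
      fix t assume t: "t \<in> Nb (M v) B"
      then obtain w where "w \<in> B" "E w t" unfolding Nb_def by blast
      then have "t \<noteq> u" "t \<noteq> b" using that(3) nb E_sym by blast+
      then show "t \<in> M v - {u,b}" using t unfolding Nb_def by blast
    qed
    then have "card (Nb (M v) B) \<le> card (M v - {u,b})" using fM by (intro card_mono) auto
    also have "\<dots> = 2" using that d fM by (simp add: card_Diff_subset)
    finally show False using nbL[OF that(1)] by simp
  qed
  have disj: "L a \<inter> L b = {}" if ab: "a \<in> M v" "b \<in> M v" "a \<noteq> b" for a b
  proof (rule ccontr)
    assume ne: "L a \<inter> L b \<noteq> {}"
    have "cl' (L a \<inter> L b)" using L[OF ab(1)] L[OF ab(2)] ne unfolding cl'_def by blast
    from hit[OF this ab(1) _ ab(2)] show False using L[OF ab(1)] L[OF ab(2)] ab(3) by blast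
  qed
  obtain u1 where u1: "u1 \<in> M v" using d by fastforce
  have "card (M v - {u1}) = 3" using d u1 fM by simp
  then obtain u2 u3 u4 where z: "M v - {u1} = {u2,u3,u4}" "u2 \<noteq> u3" "u2 \<noteq> u4" "u3 \<noteq> u4" by (metis card_3_iff)
  have uM: "u2 \<in> M v" "u3 \<in> M v" "u4 \<in> M v" "u2 \<noteq> u1" "u3 \<noteq> u1" "u4 \<noteq> u1" using z by blast+
  have Meq: "M v = {u1,u2,u3,u4}" using z(1) u1 by blast
  have get: "\<exists>y\<in>L a. E b y" if "a \<in> M v" "b \<in> M v" "a \<noteq> b" for a b
    using hit[of "L a" a b] L[OF that(1)] that by blast
  have LR: "L a \<subseteq> R v" if "a \<in> M v" for a using L[OF that] unfolding cl'_def by blast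
  have three: "3 \<le> card (Nb S {b})" if b: "b \<in> M v" and S: "R v \<subseteq> S" "finite S" for b S
  proof -
    have "card (M v - {b}) = 3" using d b fM by simp
    then obtain a1 a2 a3 where a: "M v - {b} = {a1,a2,a3}" "a1 \<noteq> a2" "a1 \<noteq> a3" "a2 \<noteq> a3" by (metis card_3_iff)
    have aM: "a1 \<in> M v" "a2 \<in> M v" "a3 \<in> M v" "a1 \<noteq> b" "a2 \<noteq> b" "a3 \<noteq> b" using a by blast+
    obtain y1 y2 y3 where y: "y1 \<in> L a1" "E b y1" "y2 \<in> L a2" "E b y2" "y3 \<in> L a3" "E b y3"
      using get[OF aM(1) b aM(4)] get[OF aM(2) b aM(5)] get[OF aM(3) b aM(6)] by blast
    have "y1 \<noteq> y2" "y1 \<noteq> y3" "y2 \<noteq> y3"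
      using y disj[OF aM(1,2) a(2)] disj[OF aM(1,3) a(3)] disj[OF aM(2,3) a(4)] by blast+
    then have "card {y1,y2,y3} = 3" by simp
    moreover have "{y1,y2,y3} \<subseteq> Nb S {b}" using y LR aM S unfolding Nb_def by blast
    ultimately show ?thesis using card_mono[of "Nb S {b}" "{y1,y2,y3}"] S unfolding Nb_def by simp
  qed
  have notR: "u1 \<notin> R v" "u2 \<notin> R v" "u3 \<notin> R v" "u4 \<notin> R v" using u1 uM MR(2)[of v] by blast+
  let ?X = "rch (R v \<union> {u1}) {u1}"
  have X: "u1 \<in> ?X" "?X \<subseteq> R v \<union> {u1}" "cov ?X {u1}"
    using rch_base[of "{u1}" "R v \<union> {u1}"] rch_subset cov_rch[of "{u1}" "R v \<union> {u1}"] by auto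
  have fX: "finite ?X" using X(2) fR finite_subset by blast
  \<comment> \<open>The component of \<open>y\<close> in \<open>R v\<close> lies in
    \<open>L a\<close>. It is missed by \<open>a\<close>, hence touched by
    \<open>u1\<close>.\<close>
  have inX: "y \<in> ?X" if y: "y \<in> L a" "a \<in> M v" "a \<noteq> u1" for y a
  proof -
    let ?B = "rch (R v) {y}"
    have yR: "y \<in> R v" using y LR by blast
    have B: "y \<in> ?B" "?B \<subseteq> R v" "conn ?B"
      using rch_base[of "{y}" "R v"] rch_subset conn_rch[OF yR] yR by auto
    have clB: "\<forall>b\<in>?B. \<forall>t\<in>R v - ?B. \<not> E b t" using rch_closed[of "{y}" "R v"] yR by blast
    have BL: "?B \<subseteq> L a"
    proof (rule ccontr)
      assume "\<not> ?B \<subseteq> L a"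
      then have "?B \<inter> L a \<subset> ?B" "?B \<inter> L a \<noteq> {}" using B y by auto
      from conn_edge[OF B(3) this] obtain s t where "s \<in> ?B \<inter> L a" "t \<in> ?B" "t \<notin> ?B \<inter> L a" "E s t" by blast
      then show False using L[OF y(2)] B(2) unfolding cl'_def by blast
    qed
    have "cl' ?B" unfolding cl'_def using B clB by blast
    then obtain t where t: "t \<in> ?B" "E u1 t" using hit[of ?B a u1] L[OF y(2)] BL y u1 by blast
    have "cov ?B {t}" by (rule conn_cov[OF B(3)]) (use t in auto)
    then have "cov ({u1} \<union> ?B) ({u1} \<union> {t})" by (rule cov_Un[OF cov_self])
    moreover have "cov ({u1} \<union> {t}) {u1}" using cov_insert_adj[OF cov_self, of u1 "{u1}" t] t(2) by (simp add: insert_commute)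
    ultimately have "cov ({u1} \<union> ?B) {u1}" by (rule cov_trans)
    then have "{u1} \<union> ?B \<subseteq> ?X" by (rule rch_max[rotated]) (use B in blast)
    then show ?thesis using B by blast
  qed
  have two: "2 \<le> card (Nb ?X {u2})"
  proof -
    obtain y3 y4 where y: "y3 \<in> L u3" "E u2 y3" "y4 \<in> L u4" "E u2 y4"
      using get[OF uM(2,1)] get[OF uM(3,1)] z by blast
    have "y3 \<noteq> y4" using y disj[OF uM(2,3) z(4)] by blast
    moreover have "{y3,y4} \<subseteq> Nb ?X {u2}" using y inX uM unfolding Nb_def by blast
    ultimately show ?thesis using card_mono[of "Nb ?X {u2}" "{y3,y4}"] fX unfolding Nb_def by simp
  qed
  have u2X: "u2 \<notin> ?X" using X(2) notR uM by blast
  have 1: "Ph (insert u2 ?X) (insert u2 {u1}) {} \<le> 2/3 + 1/27"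
  proof -
    have "Ph ?X {u1} {} \<le> 1" using Ph_le_om0[OF fX X(3)] om_le1[of "{u1}"] by linarith
    moreover have "Ph ?X {u1} (Nb ?X {u2}) \<le> 1/9"
      using Ph_W[OF fX X(3) _ two] om_le1[of "{u1}"] fX unfolding Nb_def by (simp add: power2_eq_square)
    ultimately show ?thesis using Ph_absorb1[OF fX u2X, of "{u1}" "{}"] X(1) unfolding rx by simp
  qed
  let ?Sb = "R v \<union> {u1,u2}"
  have fSb: "finite ?Sb" using fR by simp
  have covb: "cov ?Sb {u1,u2}"
  proof (rule cov_roots[OF v])
    have "M v - {u1,u2} = {u3,u4}" using Meq z uM by blast
    then show "card (M v - {u1,u2}) \<le> 2" using z by simp
  qed (use u1 uM in auto)
  \<comment> \<open>The part of \<open>R v\<close> out of reach of \<open>u1\<close> is covered by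
    \<open>u2\<close> and is trimmed away, so the estimate on the smaller set carries over.\<close>
  have "Ph ?Sb {u1,u2} {} \<le> Ph (insert u2 ?X) {u1,u2} {}"
  proof (rule Ph_remove[OF fSb])
    show "cov ?Sb (insert u2 ?X)" by (rule cov_mono[OF covb]) (use X in auto)
  qed (use X in auto)
  then have 2: "Ph ?Sb {u1,u2} {} \<le> 19/27" using 1 by (simp add: insert_commute)
  have 3: "Ph (insert u3 ?Sb) (insert u3 {u1,u2}) {} \<le> 2/3 * (19/27) + 1/81"
  proof -
    have "3 \<le> card (Nb ?Sb {u3})" by (rule three[OF uM(2)]) (use fSb in auto)
    then have "Ph ?Sb {u1,u2} (Nb ?Sb {u3}) \<le> 1/27"
      using Ph_W[OF fSb covb, of "Nb ?Sb {u3}" 3] om_le1[of "{u1,u2}"] fSb unfolding Nb_def by (simp add: power3_eq_cube)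
    moreover have "u3 \<notin> ?Sb" using notR uM z by blast
    ultimately show ?thesis using Ph_absorb1[OF fSb, of u3 "{u1,u2}" "{}"] 2 unfolding rx by simp
  qed
  let ?Sa = "insert u3 ?Sb" and ?Aa = "insert u3 {u1,u2}"
  have fSa: "finite ?Sa" using fSb by simp
  have cova: "cov ?Sa ?Aa"
    using cov_Un[OF cov_self[of "{u3}"] covb] unfolding insert_is_Un[of u3 ?Sb] insert_is_Un[of u3 "{u1,u2}"] .
  have "3 \<le> card (Nb ?Sa {u4})" by (rule three[OF uM(3)]) (use fSa in auto)
  then have "Ph ?Sa ?Aa (Nb ?Sa {u4}) \<le> 1/27"
    using Ph_W[OF fSa cova, of "Nb ?Sa {u4}" 3] om_le1[of ?Aa] fSa unfolding Nb_def by (simp add: power3_eq_cube)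
  moreover have "u4 \<notin> ?Sa" using notR uM z by blast
  \<comment> \<open>The right-hand side is \<open>76/243 + 2/243 + 3/243 = 1/3\<close>.\<close>
  ultimately have "Ph (insert u4 ?Sa) (insert u4 ?Aa) {} \<le> 2/3 * (2/3 * (19/27) + 1/81) + 1/81"
    using Ph_absorb1[OF fSa, of u4 ?Aa "{}"] 3 unfolding rx by auto
  moreover have "insert u4 ?Sa = V - {v}" using MR(1)[OF v] unfolding Meq by blast
  moreover have "insert u4 ?Aa = M v" unfolding Meq by blast
  ultimately show ?thesis by simp
qed

lemma Ph_le_third: "\<exists>v\<in>V. Ph (V - {v}) (Nb V {v}) {} \<le> 1/3"
proof -
  obtain v where v: "v \<in> V" "4 \<le> card (M v)" using exists_degree_four[OF q_eq] by blast
  have "Ph (V - {v}) (M v) {} \<le> 1/3"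
  proof (cases "5 \<le> card (M v)")
    case True then show ?thesis using Ph_le_third_degree_five v by blast
  next
    case False
    then have d: "card (M v) = 4" using v by simp
    show ?thesis
    proof (cases "\<exists>m\<in>M v. \<exists>m'\<in>M v. E m m'")
      case True then show ?thesis using Ph_le_third_degree_four_edge[OF v(1) d] by blast
    next
      case False
      then have ind: "\<forall>m\<in>M v. \<forall>m'\<in>M v. \<not> E m m'" by blast
      show ?thesis
      proof (cases "\<exists>u\<in>M v. cov (R v \<union> {u}) {u}")
        case True then show ?thesis using Ph_le_third_degree_four_root[OF v(1) d ind] by blast
      next
        case False then show ?thesis using Ph_le_third_degree_four_no_root[OF v(1) d] by blast
      qed
    qed
  qed
  then show ?thesis using v unfolding M_def by blast
qed

end

section \<open>The bound and the case of equality\<close>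

context qgraph
begin

text \<open>Both inductions enter as hypotheses: \<open>IH\<close> ranges over all edge relations,
  because cuts of two vertices change the graph, while \<open>low\<close> concerns the same graph
  with one color less.\<close>

lemma crit_nonclique_less:
  assumes q3: "3 \<le> q" and V: "crit V q" and nc: "\<exists>u\<in>V. \<exists>v\<in>V. u \<noteq> v \<and> \<not> E u v" and C: "card C = Suc q"
    and IH: "\<And>E' (V'::'a set). ugraph E' \<Longrightarrow> finite V' \<Longrightarrow> card V' < card V \<Longrightarrow> ugraph.conn E' V' \<Longrightarrow>
          \<not> ugraph.col E' V' q \<Longrightarrow> ugraph.P E' V' C \<le> fact (Suc q) * q ^ (card V' - Suc q)"
    and low: "\<And>D C'. 4 \<le> q \<Longrightarrow> finite D \<Longrightarrow> conn D \<Longrightarrow> \<not> col D (q - 1) \<Longrightarrow> card C' = q \<Longrightarrow>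
          P D C' \<le> fact q * (q - 1) ^ (card D - q)"
  shows "P V C < fact (Suc q) * q ^ (card V - Suc q)"
proof (cases "\<forall>a\<in>V. \<forall>b\<in>V. conn (V - {a,b})")
  case False
  then obtain a b where ab: "a \<in> V" "b \<in> V" "\<not> conn (V - {a,b})" by blast
  have fV: "finite V" using V unfolding crit_def by blast
  have "q < card V" using ncol_card V unfolding crit_def by blast
  moreover have "card {a,b} \<le> 2" by (cases "a = b") auto
  ultimately have "V - {a,b} \<noteq> {}" using q3 card_mono[of "{a,b}" V] by auto
  then show ?thesis by (rule P_less_two_cut[OF q3 V ab(1,2) _ ab(3) C IH])
next
  case True
  have fV: "finite V" and ncV: "\<not> col V q" using V unfolding crit_def by auto
  have qV: "Suc q \<le> card V" using ncol_card[OF fV ncV] by simp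
  have ncol: "\<not> col (V - {v} - I) (q - 1)" if "v \<in> V" "I \<subseteq> V - {v} - Nb V {v}" "indep I" for v I
  proof
    assume "col (V - {v} - I) (q - 1)"
    moreover have "V - {v} - I = V - insert v I" by blast
    moreover have "indep (insert v I)"
      using that E_irr E_sym unfolding indep_def Nb_def by blast
    ultimately have "col V (Suc (q - 1))" using col_indep[of "insert v I" V "q - 1"] by simp
    then show False using ncV q3 by simp
  qed
  have cd: "card (C - {i}) = q" if "i \<in> C" for i using that C by simp
  have no2: "conn (V - {a,b})" if "a \<in> V" "b \<in> V" for a b using True that by simp
  interpret crit3 E q V
    by unfold_locales (rule V q3 nc | erule (1) no2)+
  show ?thesis
  proof (cases "q = 3")
    case True
    interpret crit4 E q V by unfold_locales (rule True)
    obtain v where v: "v \<in> V" "Ph (V - {v}) (Nb V {v}) {} \<le> 1/3" using Ph_le_third by blast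
    \<comment> \<open>The factor 2/3 is the quotient of \<open>2 ^ card D\<close> by the number
      \<open>3 * 2 ^ (card D - 1)\<close> of colorings of a spanning tree of
      \<open>D\<close>.\<close>
    have "real (P V C) < (real q + 1) * (2/3) * real q ^ (card V - 1) * Ph (V - {v}) (Nb V {v}) {}"
    proof (rule P_class_less[OF fV v(1) C])
      fix I i assume I: "I \<subseteq> V - {v} - Nb V {v}" "indep I" and i: "i \<in> C"
      let ?X = "V - {v} - I"
      have fX: "finite ?X" using fV by simp
      obtain D where D: "D \<subseteq> ?X" "conn D" "\<not> col D (q - 1)"
        "real (P ?X (C - {i})) \<le> real (P D (C - {i})) / (real q * (real q - 1) ^ (card D - 1)) * (real q ^ card ?X * om ?X)"
        using P_component_le[OF fX cd[OF i] ncol[OF v(1) I]] by blast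
      have fD: "finite D" using D(1) fX finite_subset by blast
      have "P D (C - {i}) < 2 ^ card D"
        using P_three_less[OF fD D(2)] D(3) cd[OF i] True by simp
      then have "real (P D (C - {i})) < 2 ^ card D" by (metis of_nat_less_iff of_nat_numeral of_nat_power)
      moreover have "(2::real) ^ card D = 2 * 2 ^ (card D - 1)"
        using ncol_card[OF fD D(3)] by (metis not_less_zero not_gr_zero power_eq_if)
      ultimately have "real (P D (C - {i})) / (real q * (real q - 1) ^ (card D - 1)) < 2/3"
        using True by (simp add: divide_simps)
      moreover have "0 < real q ^ card ?X * om ?X" using q3 om_pos by simp
      ultimately have "real (P D (C - {i})) / (real q * (real q - 1) ^ (card D - 1)) * (real q ^ card ?X * om ?X)
          < 2/3 * (real q ^ card ?X * om ?X)" by (rule mult_strict_right_mono)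
      then show "real (P ?X (C - {i})) < 2/3 * (real q ^ card ?X * om ?X)" using D(4) by linarith
    qed simp
    also have "\<dots> \<le> (real q + 1) * (2/3) * real q ^ (card V - 1) * (1/3)"
      using v(2) by (intro mult_left_mono) auto
    also have "\<dots> = 24 * 3 ^ (card V - 4)"
    proof -
      have "card V - 1 = (card V - 4) + 3" using qV True by simp
      then have "real q ^ (card V - 1) = real q ^ (card V - 4) * real q ^ 3" by (simp only: power_add)
      then show ?thesis using True by simp
    qed
    also have "\<dots> = real (24 * 3 ^ (card V - 4))" by simp
    finally have "P V C < 24 * 3 ^ (card V - 4)" by (simp only: of_nat_less_iff)
    moreover have "fact (Suc q) = (24::nat)" using True by (simp add: fact_numeral)
    ultimately show ?thesis using True by simp
  next
    case False
    then have q4: "4 \<le> q" using q3 by simp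
    obtain v where v: "v \<in> V" "Ph (V - {v}) (Nb V {v}) {} < x ^ (q - 1)" using Ph_less_general[OF q4] by blast
    \<comment> \<open>The quotient of the bound \<open>fact q * (q - 1) ^ (card D - q)\<close> by
      \<open>q * (q - 1) ^ (card D - 1)\<close>; it does not depend on \<open>D\<close>.\<close>
    define k where "k = fact (q - 1) / (real q - 1) ^ (q - 1)"
    have k0: "0 < k" unfolding k_def using q4 by simp
    have "real (P V C) \<le> (real q + 1) * k * real q ^ (card V - 1) * Ph (V - {v}) (Nb V {v}) {}"
    proof (rule P_class_le[OF fV v(1) C])
      fix I i assume I: "I \<subseteq> V - {v} - Nb V {v}" "indep I" and i: "i \<in> C"
      let ?X = "V - {v} - I"
      have fX: "finite ?X" using fV by simp
      obtain D where D: "D \<subseteq> ?X" "conn D" "\<not> col D (q - 1)"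
        "real (P ?X (C - {i})) \<le> real (P D (C - {i})) / (real q * (real q - 1) ^ (card D - 1)) * (real q ^ card ?X * om ?X)"
        using P_component_le[OF fX cd[OF i] ncol[OF v(1) I]] by blast
      have fD: "finite D" using D(1) fX finite_subset by blast
      have qD: "q \<le> card D" using ncol_card[OF fD D(3)] q3 by simp
      have "P D (C - {i}) \<le> fact q * (q - 1) ^ (card D - q)" by (rule low[OF q4 fD D(2,3) cd[OF i]])
      then have "real (P D (C - {i})) \<le> real (fact q * (q - 1) ^ (card D - q))" by (simp only: of_nat_le_iff)
      also have "\<dots> = fact q * (real q - 1) ^ (card D - q)" using q4 by (simp add: of_nat_diff)
      also have "\<dots> = k * (real q * (real q - 1) ^ (card D - 1))"
      proof -
        have "card D - 1 = (card D - q) + (q - 1)" using qD q4 by simp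
        then have "(real q - 1) ^ (card D - 1) = (real q - 1) ^ (card D - q) * (real q - 1) ^ (q - 1)"
          by (simp only: power_add)
        moreover have "fact q = real q * fact (q - 1)" using q4 by (simp add: fact_reduce)
        ultimately show ?thesis unfolding k_def using q4 by simp
      qed
      finally have "real (P D (C - {i})) / (real q * (real q - 1) ^ (card D - 1)) \<le> k"
        using q4 by (simp add: pos_divide_le_eq)
      moreover have "0 \<le> real q ^ card ?X * om ?X" using om_pos[of ?X] by simp
      ultimately have "real (P D (C - {i})) / (real q * (real q - 1) ^ (card D - 1)) * (real q ^ card ?X * om ?X)
          \<le> k * (real q ^ card ?X * om ?X)" by (rule mult_right_mono)
      then show "real (P ?X (C - {i})) \<le> k * (real q ^ card ?X * om ?X)" using D(4) by linarith
    qed (use k0 in simp)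
    also have "\<dots> < (real q + 1) * k * real q ^ (card V - 1) * x ^ (q - 1)"
      using v(2) k0 q4 by (intro mult_strict_left_mono) auto
    also have "\<dots> = (real q + 1) * fact (q - 1) * real q * real q ^ (card V - Suc q)"
    proof -
      have "card V - 1 = (card V - Suc q) + 1 + (q - 1)" using qV q4 by simp
      then have "real q ^ (card V - 1) = real q ^ (card V - Suc q) * real q * real q ^ (q - 1)"
        by (simp only: power_add power_one_right)
      moreover have "k * x ^ (q - 1) * real q ^ (q - 1) = fact (q - 1)"
        unfolding k_def x_def' using q4 by (simp add: power_divide)
      moreover have "(real q + 1) * k * (a * real q * b) * c = (real q + 1) * (k * c * b) * real q * a" for a b c
        by (simp only: mult_ac)
      ultimately show ?thesis by (simp only:)
    qed
    also have "\<dots> = real (fact (Suc q) * q ^ (card V - Suc q))"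
    proof -
      have "fact q = real q * fact (q - 1)" using q4 by (simp add: fact_reduce)
      then show ?thesis by (simp add: algebra_simps)
    qed
    finally show ?thesis by (simp only: of_nat_less_iff)
  qed
qed

end

section \<open>Cliques and the two nested inductions\<close>

context ugraph
begin

definition clique :: "'a set \<Rightarrow> bool" where
  "clique K \<longleftrightarrow> (\<forall>u\<in>K. \<forall>v\<in>K. u \<noteq> v \<longrightarrow> E u v)"

lemma P_clique:
  assumes "finite K" "clique K" "card C = card K" "finite C"
  shows "P K C = fact (card K)"
proof -
  have "cl K C = {f \<in> K \<rightarrow>\<^sub>E C. inj_on f K}"
    using assms(2) E_irr unfolding cl_def clique_def inj_on_def by blast
  then have "P K C = prod ((-) (card K)) {0..<card K}"
    unfolding P_def using card_inj_on_subset_funcset[OF assms(1,4) order_refl] assms(3) by simp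
  then show ?thesis by (simp add: fact_prod_rev)
qed

lemma crit_clique_card:
  assumes "crit K m" "clique K" shows "card K = Suc m"
proof (rule ccontr)
  assume a: "card K \<noteq> Suc m"
  have f: "finite K" "\<not> col K m" using assms unfolding crit_def by auto
  have m: "m < card K" using ncol_card[OF f] .
  then obtain v where v: "v \<in> K" using f by fastforce
  have cv: "card (K - {v}) = card K - 1" using v f by simp
  obtain c where c: "\<forall>u\<in>K - {v}. c u < m" "\<forall>u\<in>K - {v}. \<forall>w\<in>K - {v}. E u w \<longrightarrow> c u \<noteq> (c w::nat)"
    using assms(1) v unfolding crit_def col_def by blast
  have "inj_on c (K - {v})" using c(2) assms(2) unfolding inj_on_def clique_def by blast
  then have "card (K - {v}) \<le> card {..<m}" using c(1) by (intro card_inj_on_le[of c]) auto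
  then show False using a m cv by simp
qed

end

text \<open>The outer induction on \<open>q\<close> serves the components left by a color class, the
  inner one on \<open>card V\<close> serves cuts of two vertices. The edge relation has to vary in
  the inner induction, since merging and added edges change it.\<close>

theorem P_le:
  fixes E :: "'a \<Rightarrow> 'a \<Rightarrow> bool"
  assumes "3 \<le> q" "ugraph E" "finite V" "ugraph.conn E V" "\<not> ugraph.col E V q" "card C = Suc q"
  shows "ugraph.P E V C \<le> fact (Suc q) * q ^ (card V - Suc q)"
  using assms
proof (induction q arbitrary: E V C rule: less_induct)
  case (less q)
  note IHq = less.IH
  show ?case using less.prems(2-5)
  proof (induction "card V" arbitrary: E V rule: less_induct)
    case (less V E)
    interpret ugraph E by fact
    interpret qgraph E q using \<open>3 \<le> q\<close> by unfold_locales simp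
    have fC: "finite C" using \<open>card C = Suc q\<close> card.infinite by force
    obtain H where H: "H \<subseteq> V" "crit H q" using crit_exists less.prems by blast
    have fH: "finite H" "\<not> col H q" using H(2) unfolding crit_def by auto
    have qH: "q < card H" by (rule ncol_card[OF fH])
    have HV: "card H \<le> card V" using card_mono less.prems H by blast
    have "P H C \<le> fact (Suc q) * q ^ (card H - Suc q)"
    proof (cases "clique H")
      case True
      then show ?thesis
        using P_clique[OF fH(1) True] crit_clique_card[OF H(2) True] \<open>card C = Suc q\<close> fC by simp
    next
      case False
      then have nc: "\<exists>u\<in>H. \<exists>v\<in>H. u \<noteq> v \<and> \<not> E u v" unfolding clique_def by blast
      have "P H C < fact (Suc q) * q ^ (card H - Suc q)"
      proof (rule crit_nonclique_less[OF \<open>3 \<le> q\<close> H(2) nc \<open>card C = Suc q\<close>])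
        fix E' :: "'a \<Rightarrow> 'a \<Rightarrow> bool" and V'
        assume a: "ugraph E'" "finite V'" "card V' < card H" "ugraph.conn E' V'" "\<not> ugraph.col E' V' q"
        have "card V' < card V" using a(3) HV by simp
        then show "ugraph.P E' V' C \<le> fact (Suc q) * q ^ (card V' - Suc q)" by (rule less.hyps[OF _ a(1,2,4,5)])
      next
        fix D C' assume a: "4 \<le> q" "finite D" "conn D" "\<not> col D (q - 1)" "card (C'::nat set) = q"
        have b: "q - 1 < q" "3 \<le> q - 1" "Suc (q - 1) = q" using a(1) by auto
        show "P D C' \<le> fact q * (q - 1) ^ (card D - q)"
          using IHq[OF b(1,2) \<open>ugraph E\<close> a(2-4), of C'] a(5) b(3) by simp
      qed
      then show ?thesis by simp
    qed
    then have "P H C * q ^ card (V - H) \<le> fact (Suc q) * q ^ (card H - Suc q) * q ^ card (V - H)"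
      by (rule mult_right_mono) simp
    moreover have "P V C \<le> P H C * q ^ card (V - H)"
    proof -
      have "H \<noteq> {}" using qH by auto
      from P_extend[OF \<open>finite V\<close> fC conn_cov[OF \<open>conn V\<close> H(1) this]] show ?thesis
        using \<open>card C = Suc q\<close> by simp
    qed
    moreover have "q ^ (card H - Suc q) * q ^ card (V - H) = q ^ (card V - Suc q)"
    proof -
      have "card (V - H) = card V - card H" by (rule card_Diff_subset[OF fH(1) H(1)])
      then have "(card H - Suc q) + card (V - H) = card V - Suc q" using qH HV by simp
      then show ?thesis by (simp only: power_add[symmetric])
    qed
    ultimately show ?case by (simp only: mult.assoc)
  qed
qed

section \<open>Attached trees and the case of equality\<close>

context ugraph
begin

text \<open>Read backwards, each step deletes a vertex of degree one, so this is pruning in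
  reverse.\<close>

inductive tree_ext :: "'a set \<Rightarrow> 'a set \<Rightarrow> bool" for H where
  base: "tree_ext H H"
| step: "tree_ext H X \<Longrightarrow> z \<notin> X \<Longrightarrow> Nb X {z} = {u} \<Longrightarrow> tree_ext H (insert z X)"

lemma tree_ext_subset: "tree_ext H X \<Longrightarrow> H \<subseteq> X"
  by (induction rule: tree_ext.induct) auto

text \<open>The rules add a vertex at the outer end. Following a pruning sequence makes the core
  shrink, which requires adding one at the inner end.\<close>

lemma tree_ext_insert:
  assumes "tree_ext (insert z H) X" "z \<notin> H" "Nb H {z} = {u}"
  shows "tree_ext H X"
  using assms(1)
proof (induction rule: tree_ext.induct)
  case base
  show ?case by (rule tree_ext.step[OF tree_ext.base assms(2,3)])
next
  case (step X y w)
  then show ?case using tree_ext.step by blast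
qed

lemma cl_insert:
  assumes "c \<in> cl X C" "z \<notin> X" "i \<in> C" "\<forall>u\<in>Nb X {z}. c u \<noteq> i"
  shows "c(z := i) \<in> cl (insert z X) C"
proof -
  have "c(z := i) \<in> insert z X \<rightarrow>\<^sub>E C" using assms(1,3) unfolding cl_def by (auto simp: PiE_iff extensional_def)
  moreover have "(c(z := i)) u \<noteq> (c(z := i)) w" if uw: "u \<in> insert z X" "w \<in> insert z X" "E u w" for u w
  proof -
    consider "u = z" "w \<in> X" "w \<noteq> z" | "w = z" "u \<in> X" "u \<noteq> z" | "u \<in> X" "w \<in> X" "u \<noteq> z" "w \<noteq> z"
      using uw E_irr assms(2) by blast
    then show ?thesis
    proof cases
      case 1 then have "w \<in> Nb X {z}" using uw unfolding Nb_def by blast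
      then show ?thesis using 1 assms(4) by auto
    next
      case 2 then have "u \<in> Nb X {z}" using uw E_sym unfolding Nb_def by blast
      then show ?thesis using 2 assms(4) by auto
    next
      case 3 then show ?thesis using cl_edge[OF assms(1)] uw by simp
    qed
  qed
  ultimately show ?thesis unfolding cl_def by blast
qed

lemma tree_ext_P:
  assumes "tree_ext H X" "finite H" "finite C"
  shows "finite X \<and> P X C = P H C * (card C - 1) ^ (card X - card H)"
  using assms(1)
proof (induction rule: tree_ext.induct)
  case base
  show ?case using assms by simp
next
  case (step X z u)
  have u: "u \<in> X" "E z u" using step.hyps(3) unfolding Nb_def by blast+
  have fX: "finite X" using step.IH by simp
  let ?f = "\<lambda>(c, i). c(z := i)"
  let ?S = "Sigma (cl X C) (\<lambda>c. C - {c u})"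
  have "inj_on ?f ?S"
  proof (rule inj_onI)
    fix p p' assume a: "p \<in> ?S" "p' \<in> ?S" "?f p = ?f p'"
    obtain c i c' i' where p: "p = (c,i)" "p' = (c',i')" by (metis prod.exhaust)
    have e: "c(z := i) = c'(z := i')" using a p by simp
    then have "i = i'" by (metis fun_upd_same)
    moreover have "c = c'"
    proof (rule cl_eqI)
      show "c \<in> cl X C" "c' \<in> cl X C" using a p by auto
      fix v assume "v \<in> X"
      then have "v \<noteq> z" using step.hyps(2) by blast
      then show "c v = c' v" using e by (metis fun_upd_other)
    qed
    ultimately show "p = p'" using p by simp
  qed
  moreover have "?f ` ?S \<subseteq> cl (insert z X) C"
    using cl_insert[OF _ step.hyps(2)] step.hyps(3) by auto
  moreover have "finite (cl (insert z X) C)" by (rule finite_cl) (use fX assms in auto)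
  ultimately have "card ?S \<le> P (insert z X) C" unfolding P_def by (rule card_inj_on_le)
  moreover have "card ?S = P X C * (card C - 1)"
  proof -
    have "card ?S = (\<Sum>c\<in>cl X C. card (C - {c u}))"
      using finite_cl[OF fX assms(3)] assms(3) by (intro card_SigmaI) auto
    also have "\<dots> = (\<Sum>c\<in>cl X C. card C - 1)"
      using cl_val u(1) assms(3) by (intro sum.cong refl card_Diff_singleton) auto
    finally show ?thesis unfolding P_def by simp
  qed
  moreover have "P (insert z X) C \<le> P X C * (card C - 1)"
  proof -
    have "cov (insert z X) X" by (rule cov_insert_adj[OF cov_self u(1)]) (use u E_sym in blast)
    from P_extend[OF _ assms(3) this] have "P (insert z X) C \<le> P X C * (card C - 1) ^ card (insert z X - X)"
      using fX by simp
    moreover have "insert z X - X = {z}" using step.hyps(2) by blast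
    ultimately show ?thesis by simp
  qed
  ultimately have "P (insert z X) C = P X C * (card C - 1)" by simp
  moreover have "card (insert z X) - card H = Suc (card X - card H)"
    using card_mono[OF fX tree_ext_subset[OF step.hyps(1)]] fX step.hyps(2) by simp
  ultimately show ?case using step.IH fX by (simp add: mult_ac)
qed

text \<open>A new vertex has to avoid the color of its only neighbour and that of the vertex it is
  to differ from; with three colors this is possible.\<close>

lemma tree_ext_separate:
  assumes "tree_ext H X" "finite H" "clique H" "card C = card H" "3 \<le> card C"
  shows "\<exists>c\<in>cl X C. a \<in> X \<longrightarrow> b \<in> X \<longrightarrow> a \<noteq> b \<longrightarrow> c a \<noteq> c b"
  using assms(1)
proof (induction rule: tree_ext.induct)
  case base
  have fC: "finite C" using assms card.infinite by force
  have "P H C \<noteq> 0" using P_clique[OF assms(2-4) fC] by simp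
  then obtain c where c: "c \<in> cl H C" unfolding P_def by fastforce
  have "c a \<noteq> c b" if "a \<in> H" "b \<in> H" "a \<noteq> b"
    using cl_edge[OF c, of b a] that assms(3) unfolding clique_def by blast
  then show ?case using c by blast
next
  case (step X z u)
  obtain c where c: "c \<in> cl X C" "a \<in> X \<Longrightarrow> b \<in> X \<Longrightarrow> a \<noteq> b \<Longrightarrow> c a \<noteq> c b" using step.IH by blast
  \<comment> \<open>If \<open>z\<close> is one of the two vertices, \<open>w\<close> is the other;
    if it is neither, avoiding the color of \<open>a\<close> does no harm.\<close>
  define w where "w = (if a = z then b else a)"
  have "card {c u, c w} \<le> 2" by (simp add: card_insert_if)
  then have "\<not> C \<subseteq> {c u, c w}" using assms(5) card_mono[of "{c u, c w}" C] by auto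
  then obtain i where i: "i \<in> C" "i \<noteq> c u" "i \<noteq> c w" by blast
  have "c(z := i) \<in> cl (insert z X) C" by (rule cl_insert[OF c(1) step.hyps(2) i(1)]) (use step.hyps(3) i in auto)
  moreover have "(c(z := i)) a \<noteq> (c(z := i)) b" if "a \<in> insert z X" "b \<in> insert z X" "a \<noteq> b"
    using that c(2) i(3) unfolding w_def by (cases "a = z"; cases "b = z") auto
  ultimately show ?case by blast
qed

text \<open>Every coloring of \<open>X\<close> has at most \<open>card C - 1\<close> extensions, and
  one with different colors on two neighbours of \<open>y\<close> has at most
  \<open>card C - 2\<close>. A single such coloring makes the inequality strict.\<close>

lemma P_insert_less:
  assumes "finite X" "finite C" "y \<notin> X" "u \<in> X" "u' \<in> X" "E u y" "E u' y" "c \<in> cl X C" "c u \<noteq> c u'" "2 \<le> card C"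
  shows "P (insert y X) C < P X C * (card C - 1)"
proof -
  let ?F = "cl X C - {c}"
  let ?A = "{d \<in> cl (insert y X) C. restrict d X \<in> ?F}" and ?B = "{d \<in> cl (insert y X) C. restrict d X = c}"
  have "card ?A \<le> card ?F * (card C - 1)"
    by (rule card_extend_insert[OF assms(1,2,3,4,6)]) blast
  moreover have "card ?B \<le> card (C - {c u, c u'})"
  proof (rule card_inj_on_le[of "\<lambda>d. d y"])
    show "inj_on (\<lambda>d. d y) ?B"
    proof (rule inj_onI)
      fix d d' assume a: "d \<in> ?B" "d' \<in> ?B" "d y = d' y"
      show "d = d'"
      proof (rule cl_eqI)
        show "d \<in> cl (insert y X) C" "d' \<in> cl (insert y X) C" using a by auto
        fix v assume "v \<in> insert y X"
        moreover have "restrict d X = restrict d' X" using a by simp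
        ultimately show "d v = d' v" using a(3) restrict_eqD[of d X d' v] by blast
      qed
    qed
    show "(\<lambda>d. d y) ` ?B \<subseteq> C - {c u, c u'}"
    proof
      fix i assume "i \<in> (\<lambda>d. d y) ` ?B"
      then obtain d where d: "d \<in> cl (insert y X) C" "restrict d X = c" "i = d y" by blast
      have "d u = c u" "d u' = c u'" using d(2) assms(4,5) by auto
      moreover have "d u \<noteq> d y" "d u' \<noteq> d y"
        using cl_edge[OF d(1), of y u] cl_edge[OF d(1), of y u'] assms(4-7) by auto
      moreover have "d y \<in> C" using cl_val[OF d(1)] by blast
      ultimately show "i \<in> C - {c u, c u'}" using d(3) by auto
    qed
  qed (use assms in simp)
  moreover have "card (C - {c u, c u'}) = card C - 2"
    using cl_val[OF assms(8)] assms(2,4,5,9) by (subst card_Diff_subset) auto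
  moreover have "P (insert y X) C \<le> card ?A + card ?B"
  proof -
    have "restrict d X \<in> cl X C" if "d \<in> cl (insert y X) C" for d using cl_restrict[OF that] by blast
    then have "cl (insert y X) C \<subseteq> ?A \<union> ?B" by blast
    moreover have "finite (cl (insert y X) C)" by (rule finite_cl) (use assms in auto)
    ultimately have "P (insert y X) C \<le> card (?A \<union> ?B)" unfolding P_def by (intro card_mono) auto
    then show ?thesis using card_Un_le[of ?A ?B] by linarith
  qed
  moreover have "P X C = Suc (card ?F)"
    unfolding P_def using card_Suc_Diff1[OF finite_cl[OF assms(1,2)] assms(8)] by simp
  ultimately show ?thesis using assms(10) by simp
qed

text \<open>Equality forces the critical set to be a clique. In a maximal tree extension
  \<open>X\<close> of it, a further vertex next to \<open>X\<close> has a second neighbour in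
  \<open>X\<close>; some coloring of \<open>X\<close> separates the two, and
  \<open>P_insert_less\<close> contradicts equality.\<close>

theorem P_eq_tree_ext:
  assumes "3 \<le> q" "finite V" "conn V" "\<not> col V q" "card C = Suc q"
    and eq: "P V C = fact (Suc q) * q ^ (card V - Suc q)"
  shows "\<exists>H. clique H \<and> card H = Suc q \<and> tree_ext H V"
proof -
  interpret qgraph E q using \<open>3 \<le> q\<close> by unfold_locales simp
  have fC: "finite C" using \<open>card C = Suc q\<close> card.infinite by force
  have ug: "ugraph E" by (rule ugraph_axioms)
  obtain H where H: "H \<subseteq> V" "crit H q" using crit_exists assms by blast
  have fH: "finite H" "\<not> col H q" using H(2) unfolding crit_def by auto
  have qH: "q < card H" by (rule ncol_card[OF fH])
  have HV: "card H \<le> card V" using card_mono assms H by blast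
  have ext: "P V C \<le> P X C * q ^ card (V - X)" if "X \<subseteq> V" "X \<noteq> {}" for X
    using P_extend[OF \<open>finite V\<close> fC conn_cov[OF \<open>conn V\<close> that]] \<open>card C = Suc q\<close> by simp
  have Hne: "H \<noteq> {}" using qH by auto
  have clH: "clique H"
  proof (rule ccontr)
    assume "\<not> clique H"
    then have nc: "\<exists>u\<in>H. \<exists>v\<in>H. u \<noteq> v \<and> \<not> E u v" unfolding clique_def by blast
    have "P H C < fact (Suc q) * q ^ (card H - Suc q)"
    proof (rule crit_nonclique_less[OF \<open>3 \<le> q\<close> H(2) nc \<open>card C = Suc q\<close>])
      fix E' :: "'a \<Rightarrow> 'a \<Rightarrow> bool" and V'
      assume a: "ugraph E'" "finite V'" "card V' < card H" "ugraph.conn E' V'" "\<not> ugraph.col E' V' q"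
      show "ugraph.P E' V' C \<le> fact (Suc q) * q ^ (card V' - Suc q)"
        by (rule P_le[OF assms(1) a(1,2,4,5) assms(5)])
    next
      fix D C' assume a: "4 \<le> q" "finite D" "conn D" "\<not> col D (q - 1)" "card (C'::nat set) = q"
      have b: "3 \<le> q - 1" "Suc (q - 1) = q" using a(1) by auto
      show "P D C' \<le> fact q * (q - 1) ^ (card D - q)"
        using P_le[OF b(1) ug a(2-4), of C'] a(5) b(2) by simp
    qed
    moreover have "0 < q ^ card (V - H)" using assms by simp
    ultimately have "P H C * q ^ card (V - H) < fact (Suc q) * q ^ (card H - Suc q) * q ^ card (V - H)"
      by (rule mult_strict_right_mono)
    moreover have "q ^ (card H - Suc q) * q ^ card (V - H) = q ^ (card V - Suc q)"
    proof -
      have "card (V - H) = card V - card H" by (rule card_Diff_subset[OF fH(1) H(1)])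
      then have "(card H - Suc q) + card (V - H) = card V - Suc q" using qH HV by simp
      then show ?thesis by (simp only: power_add[symmetric])
    qed
    ultimately have "P V C < fact (Suc q) * q ^ (card V - Suc q)"
      using ext[OF H(1) Hne] by (simp only: mult.assoc)
    then show False using eq by simp
  qed
  have cH: "card H = Suc q" by (rule crit_clique_card[OF H(2) clH])
  have PH: "P H C = fact (Suc q)" using P_clique[OF fH(1) clH] cH \<open>card C = Suc q\<close> fC by simp
  define \<X> where "\<X> = {X. X \<subseteq> V \<and> tree_ext H X}"
  have "finite \<X>" unfolding \<X>_def using \<open>finite V\<close> by simp
  moreover have "H \<in> \<X>" unfolding \<X>_def using H(1) tree_ext.base by simp
  ultimately obtain X where X: "X \<in> \<X>" "\<forall>Y\<in>\<X>. X \<subseteq> Y \<longrightarrow> X = Y"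
    using finite_has_maximal[of \<X>] by blast
  have X': "X \<subseteq> V" "tree_ext H X" using X(1) unfolding \<X>_def by auto
  have fX: "finite X" using X'(1) \<open>finite V\<close> finite_subset by blast
  have XV: "X = V"
  proof (rule ccontr)
    assume "X \<noteq> V"
    then have "X \<subset> V" using X' by blast
    moreover have Xne: "X \<noteq> {}" using tree_ext_subset[OF X'(2)] Hne by blast
    ultimately obtain u y where y: "u \<in> X" "y \<in> V" "y \<notin> X" "E u y" using conn_edge[OF assms(3)] by blast
    have "Nb X {y} \<noteq> {u}"
    proof
      assume "Nb X {y} = {u}"
      then have "insert y X \<in> \<X>" unfolding \<X>_def using tree_ext.step[OF X'(2) y(3)] X'(1) y(2) by blast
      then show False using X(2) y(3) by blast
    qed
    moreover have "u \<in> Nb X {y}" using y E_sym unfolding Nb_def by blast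
    ultimately obtain u' where u': "u' \<in> X" "E y u'" "u \<noteq> u'" unfolding Nb_def by blast
    have "card C = card H" "3 \<le> card C" using cH assms by auto
    from tree_ext_separate[OF X'(2) fH(1) clH this, of u u'] obtain c where c: "c \<in> cl X C" "c u \<noteq> c u'"
      using y(1) u' by blast
    have uy: "E u' y" using u' E_sym by blast
    have c2: "2 \<le> card C" using assms by simp
    have less: "P (insert y X) C < P X C * q"
      using P_insert_less[OF fX fC y(3,1) u'(1) y(4) uy c c2] \<open>card C = Suc q\<close> by simp
    have "P V C \<le> P (insert y X) C * q ^ card (V - insert y X)" using ext[of "insert y X"] X'(1) y by simp
    also have "\<dots> < P X C * q * q ^ card (V - insert y X)" using less assms(1) by simp
    also have "\<dots> = P X C * q ^ card (V - X)"
    proof -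
      have "V - X - {y} = V - insert y X" by blast
      then have "card (V - X) = Suc (card (V - insert y X))"
        using card_Suc_Diff1[of "V - X" y] \<open>finite V\<close> y by simp
      then show ?thesis by simp
    qed
    also have "\<dots> = fact (Suc q) * q ^ (card V - Suc q)"
    proof -
      have "P X C = fact (Suc q) * q ^ (card X - Suc q)"
        using tree_ext_P[OF X'(2) fH(1) fC] PH cH \<open>card C = Suc q\<close> by simp
      moreover have "card X - Suc q + card (V - X) = card V - Suc q"
        using card_mono[OF fX tree_ext_subset[OF X'(2)]] cH card_Diff_subset[OF fX X'(1)] card_mono[OF \<open>finite V\<close> X'(1)] by simp
      ultimately show ?thesis by (simp only: mult.assoc power_add[symmetric])
    qed
    finally show False using eq by simp
  qed
  then show ?thesis using clH cH X'(2) by blast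
qed

end

section \<open>Graphs and their 2-cores\<close>

context graph
begin

interpretation U: ugraph "dominates G"
  by unfold_locales (auto dest: adj_not_same arcs_ends_symmetric[OF sym_arcs])

lemma proper_colorings_eq: "proper_colorings G k = U.cl (verts G) {1..k}"
  unfolding proper_colorings_def U.cl_def using adj_in_verts by blast

lemma not_colorable:
  assumes "q < chromatic_number G" shows "\<not> U.col (verts G) q"
proof
  assume "U.col (verts G) q"
  then obtain c :: "'a \<Rightarrow> nat" where c: "\<forall>v\<in>verts G. c v < q" "\<forall>u\<in>verts G. \<forall>v\<in>verts G. u \<rightarrow>\<^bsub>G\<^esub> v \<longrightarrow> c u \<noteq> c v"
    unfolding U.col_def by blast
  have "restrict (\<lambda>v. Suc (c v)) (verts G) \<in> U.cl (verts G) {1..q}"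
    using c unfolding U.cl_def by (auto simp: Suc_le_eq)
  then have "proper_colorings G q \<noteq> {}" unfolding proper_colorings_eq by blast
  then have "chromatic_number G \<le> q" unfolding chromatic_number_def by (rule Least_le)
  then show False using assms by simp
qed

lemma connected_conn: assumes "connected G" shows "U.conn (verts G)"
proof (rule U.connI)
  have sc: "strongly_connected G" by (rule symmetric_connected_imp_strongly_connected[OF sym_arcs assms])
  then show "verts G \<noteq> {}" unfolding strongly_connected_def by blast
  fix X assume X: "X \<subset> verts G" "X \<noteq> {}"
  then obtain a b where ab: "a \<in> X" "a \<in> verts G" "b \<in> verts G" "b \<notin> X" by blast
  show "\<exists>u\<in>X. \<exists>v\<in>verts G - X. u \<rightarrow>\<^bsub>G\<^esub> v"
  proof (rule ccontr)
    assume n: "\<not> ?thesis"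
    have "a \<rightarrow>\<^sup>*\<^bsub>G\<^esub> b" using sc ab unfolding strongly_connected_def by blast
    then have "b \<in> X"
    proof (induction rule: reachable_induct)
      case base show ?case by (rule ab(1))
    next
      case (step x y)
      then show ?case using n adj_in_verts(2)[OF step(2)] by blast
    qed
    then show False using ab by blast
  qed
qed

text \<open>Without parallel arcs the arcs leaving \<open>z\<close> have distinct heads, so counting
  arcs is counting neighbours.\<close>

lemma out_degree_induce:
  assumes "z \<in> X" shows "out_degree (G \<restriction> X) z = card (U.Nb X {z})"
proof -
  have "U.Nb X {z} = head G ` out_arcs (G \<restriction> X) z"
    using assms unfolding U.Nb_def by (auto simp: out_arcs_def arcs_ends_conv)
  moreover have "inj_on (head G) (out_arcs (G \<restriction> X) z)"
    by (rule inj_onI) (auto simp: out_arcs_def arc_to_ends_def intro!: no_multi_arcs)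
  ultimately show ?thesis unfolding out_degree_def by (simp add: card_image)
qed

lemma del_vert_induce: "pre_digraph.del_vert (G \<restriction> X) z = G \<restriction> (X - {z})"
  by (auto simp: pre_digraph.del_vert_def induce_subgraph_def)

lemma induce_verts: "G \<restriction> verts G = G"
  by (auto simp: induce_subgraph_def intro!: pre_digraph.equality)

lemma prune_step_induce:
  "prune_step (G \<restriction> X) K \<longleftrightarrow> (\<exists>z\<in>X. card (U.Nb X {z}) \<le> 1 \<and> K = G \<restriction> (X - {z}))"
  unfolding prune_step_def using out_degree_induce del_vert_induce by auto

lemma tree_ext_prune:
  assumes "U.tree_ext H X"
  shows "prune_step\<^sup>*\<^sup>* (G \<restriction> X) (G \<restriction> H)"
  using assms
proof (induction rule: U.tree_ext.induct)
  case base
  show ?case by simp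
next
  case (step X z u)
  have "U.Nb (insert z X) {z} = U.Nb X {z}" using U.E_irr unfolding U.Nb_def by blast
  then have "card (U.Nb (insert z X) {z}) \<le> 1" using step.hyps(3) by simp
  then have "prune_step (G \<restriction> insert z X) (G \<restriction> X)"
    unfolding prune_step_induce using step.hyps(2) by (intro bexI[of _ z]) simp_all
  then show ?case using step.IH by (rule converse_rtranclp_into_rtranclp)
qed

text \<open>As long as a second vertex remains, connectedness gives the pruned vertex exactly one
  neighbour, and deleting it keeps the graph connected. Requiring \<open>K\<close> to be nonempty
  excludes the final deletion of an isolated vertex, by which a tree is pruned to nothing.\<close>

lemma prune_tree_ext:
  assumes "prune_step\<^sup>*\<^sup>* G K" "connected G" "verts K \<noteq> {}"
  shows "U.conn (verts K) \<and> U.tree_ext (verts K) (verts G)"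
  using assms(1,3)
proof (induction rule: rtranclp_induct)
  case base
  show ?case using connected_conn[OF assms(2)] U.tree_ext.base by blast
next
  case (step K L)
  let ?X = "verts K"
  have K: "K = G \<restriction> ?X" "?X \<subseteq> verts G" using prune_induced[OF step.hyps(1)] by auto
  then obtain z where z: "z \<in> ?X" "card (U.Nb ?X {z}) \<le> 1" "L = G \<restriction> (?X - {z})"
    using step.hyps(2) prune_step_induce[of ?X L] by metis
  have L: "verts L = ?X - {z}" using z(3) by simp
  then have "?X \<noteq> {}" using step.prems by blast
  then have IH: "U.conn ?X" "U.tree_ext ?X (verts G)" using step.IH by auto
  have fX: "finite ?X" using K(2) finite_verts finite_subset by blast
  have "{z} \<subset> ?X" using z(1) L step.prems by blast
  then obtain u where u: "u \<in> ?X" "u \<noteq> z" "z \<rightarrow>\<^bsub>G\<^esub> u" using U.conn_edge[OF IH(1), of "{z}"] by blast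
  have uN: "u \<in> U.Nb ?X {z}" using u unfolding U.Nb_def by blast
  have "finite (U.Nb ?X {z})" using fX unfolding U.Nb_def by simp
  then have N: "U.Nb ?X {z} = {u}" using uN z(2) card_le_Suc0_iff_eq[of "U.Nb ?X {z}"] by auto
  have "U.cov ?X {u}" by (rule U.conn_cov[OF IH(1)]) (use u in auto)
  from U.cov_delete[OF this z(1)] have "U.cov (?X - {z}) {u}" using u(2) N by simp
  then have "U.conn (?X - {z})" by (rule U.conn_root)
  moreover have "U.tree_ext (?X - {z}) (verts G)"
  proof (rule U.tree_ext_insert)
    show "U.tree_ext (insert z (?X - {z})) (verts G)" using IH(2) z(1) by (simp add: insert_absorb)
    show "U.Nb (?X - {z}) {z} = {u}" using N u(2) unfolding U.Nb_def by blast
  qed simp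
  ultimately show ?case unfolding L by blast
qed

text \<open>All degrees in the clique are \<open>k - 1\<close>, hence at least two, so pruning stops
  there; uniqueness of the core does the rest.\<close>

lemma clique_two_core:
  assumes "U.clique H" "U.tree_ext H (verts G)" "card H = k" "3 \<le> k"
  shows "complete_digraph k (two_core G)"
proof -
  have HG: "H \<subseteq> verts G" by (rule U.tree_ext_subset[OF assms(2)])
  have fH: "finite H" using HG finite_verts finite_subset by blast
  have "\<not> prune_step (G \<restriction> H) K" for K
  proof
    assume "prune_step (G \<restriction> H) K"
    then obtain z where z: "z \<in> H" "card (U.Nb H {z}) \<le> 1" unfolding prune_step_induce by blast
    have "H - {z} \<subseteq> U.Nb H {z}" using assms(1) z(1) unfolding U.Nb_def U.clique_def by auto
    moreover have "finite (U.Nb H {z})" using fH unfolding U.Nb_def by simp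
    ultimately have "card (H - {z}) \<le> 1" using card_mono z(2) le_trans by blast
    then show False using assms(3,4) z(1) fH by simp
  qed
  then have "is_two_core G (G \<restriction> H)"
    unfolding is_two_core_def using tree_ext_prune[OF assms(2)] induce_verts by simp
  then have two: "two_core G = G \<restriction> H" using ex1_two_core is_two_core_two_core by blast
  have ind: "induced_subgraph (G \<restriction> H) G" by (rule induced_induce[OF HG])
  interpret D: digraph "G \<restriction> H" by (rule digraphI_induced[OF ind])
  interpret S: sym_digraph "G \<restriction> H" by (rule induced_graph_imp_graph[OF ind])
  have "graph (G \<restriction> H)" by unfold_locales
  moreover have "arcs_ends (G \<restriction> H) = {(u,v). (u,v) \<in> H \<times> H \<and> u \<noteq> v}"
  proof -
    have "(u,v) \<in> arcs_ends (G \<restriction> H) \<longleftrightarrow> u \<in> H \<and> v \<in> H \<and> u \<rightarrow>\<^bsub>G\<^esub> v" for u v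
      unfolding arcs_ends_conv by auto
    then show ?thesis using assms(1) U.E_irr unfolding U.clique_def by auto
  qed
  ultimately show ?thesis unfolding two complete_digraph_def using assms(3) by simp
qed

lemma num_colorings_two_core:
  assumes "complete_digraph k (two_core G)" "connected G" "1 \<le> k"
  shows "num_colorings G k = fact k * (k - 1) ^ (card (verts G) - k)"
proof -
  let ?H = "verts (two_core G)"
  have pr: "prune_step\<^sup>*\<^sup>* G (two_core G)" using is_two_core_two_core unfolding is_two_core_def by blast
  have ind: "two_core G = G \<restriction> ?H" "?H \<subseteq> verts G" using prune_induced[OF pr] by auto
  have cH: "card ?H = k" "arcs_ends (two_core G) = {(u,v). (u,v) \<in> ?H \<times> ?H \<and> u \<noteq> v}"
    using assms(1) unfolding complete_digraph_def by auto
  have fH: "finite ?H" using ind(2) finite_verts finite_subset by blast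
  have "?H \<noteq> {}" using cH(1) assms(3) by auto
  then have te: "U.tree_ext ?H (verts G)" using prune_tree_ext[OF pr assms(2)] by blast
  have cl: "U.clique ?H" unfolding U.clique_def
  proof (intro ballI impI)
    fix u v assume "u \<in> ?H" "v \<in> ?H" "u \<noteq> v"
    then have "u \<rightarrow>\<^bsub>two_core G\<^esub> v" using cH(2) by blast
    then show "u \<rightarrow>\<^bsub>G\<^esub> v" using ind(1) dominates_induce_subgraphD by metis
  qed
  have "U.P ?H {1..k} = fact k" using U.P_clique[OF fH cl, of "{1..k}"] cH(1) by simp
  then show ?thesis
    using U.tree_ext_P[OF te fH, of "{1..k}"] cH(1)
    unfolding num_colorings_def proper_colorings_eq U.P_def by simp
qed

lemma num_colorings_le:
  assumes "4 \<le> k" "connected G" "chromatic_number G = k"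
  shows "num_colorings G k \<le> fact k * (k - 1) ^ (card (verts G) - k)"
proof -
  have k: "3 \<le> k - 1" "Suc (k - 1) = k" using assms(1) by auto
  have "\<not> U.col (verts G) (k - 1)" by (rule not_colorable) (use assms in simp)
  from P_le[OF k(1) U.ugraph_axioms finite_verts connected_conn[OF assms(2)] this, of "{1..k}"] show ?thesis
    unfolding num_colorings_def proper_colorings_eq U.P_def using k(2) by simp
qed

lemma num_colorings_eq_two_core:
  assumes "4 \<le> k" "connected G" "chromatic_number G = k"
    and eq: "num_colorings G k = fact k * (k - 1) ^ (card (verts G) - k)"
  shows "complete_digraph k (two_core G)"
proof -
  have k: "3 \<le> k - 1" "Suc (k - 1) = k" using assms(1) by auto
  have nc: "\<not> U.col (verts G) (k - 1)" by (rule not_colorable) (use assms in simp)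
  have "U.P (verts G) {1..k} = fact (Suc (k - 1)) * (k - 1) ^ (card (verts G) - Suc (k - 1))"
    using eq unfolding num_colorings_def proper_colorings_eq U.P_def k(2) .
  from U.P_eq_tree_ext[OF k(1) finite_verts connected_conn[OF assms(2)] nc _ this]
  obtain H where "U.clique H" "card H = k" "U.tree_ext H (verts G)" using k(2) by auto
  then show ?thesis using assms(1) by (intro clique_two_core) auto
qed

end

theorem theorem1:
  fixes G :: "('a,'b) pre_digraph" and k n :: nat
  assumes "k \<ge> 4"
    and "graph G"
    and "connected G"
    and "card (verts G) = n"
    and "chromatic_number G = k"
  shows "num_colorings G k \<le> fact k * (k - 1) ^ (n - k) \<and>
    (num_colorings G k = fact k * (k - 1) ^ (n - k) \<longleftrightarrow> K\<^bsub>k\<^esub> (two_core G))"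
proof -
  interpret graph G by fact
  show ?thesis
    using num_colorings_le[OF assms(1,3,5)] num_colorings_eq_two_core[OF assms(1,3,5)]
      num_colorings_two_core[OF _ assms(3), of k] assms(1) unfolding assms(4) by linarith
qed

end
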